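(* Let $K$ be a field, $E$ an elliptic curve over $K$ given by a Weierstrass equation, and $m\geq 3$ an integer coprime to $\mathrm{char}(K)$ when $\mathrm{char}(K)>0$. Let $P_1=(x_1,y_1)$, $P_2=(x_2,y_2)$ be a $\mathbb{Z}/m\mathbb{Z}$-basis of $E[m]$ and $\zeta_m:=e_m(P_1,P_2)$. Then $K(E[m])=K(x_1+x_2,\,x_1x_2,\,\zeta_m,\,y_1)$.
   Context: $E[m]$ is the $m$-torsion subgroup of $E(\overline{K})$; $K(E[m])$ is the field obtained from $K$ by adjoining the coordinates of all points of $E[m]$; $e_m$ is the Weil pairing on $E[m]$, so $\zeta_m$ is a primitive $m$-th root of unity. *)

theory Defs
  imports "HOL-Algebra.Algebraic_Closure_Type" "HOL-Algebra.Generated_Fields"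
begin

section \<open>Weierstrass curves and the group law\<close>

text \<open>
  The curve \<open>y\<^sup>2 + a\<^sub>1 x y + a\<^sub>3 y = x\<^sup>3 + a\<^sub>2 x\<^sup>2 + a\<^sub>4 x + a\<^sub>6\<close>; no restriction on the characteristic.
\<close>
datatype 'k weierstrass =
  Weierstrass (a\<^sub>1: 'k) (a\<^sub>2: 'k) (a\<^sub>3: 'k) (a\<^sub>4: 'k) (a\<^sub>6: 'k)

definition discriminant :: "'k::field weierstrass \<Rightarrow> 'k" where
  "discriminant E =
    (let b2 = (a\<^sub>1 E)\<^sup>2 + 4 * a\<^sub>2 E;
         b4 = 2 * a\<^sub>4 E + a\<^sub>1 E * a\<^sub>3 E;
         b6 = (a\<^sub>3 E)\<^sup>2 + 4 * a\<^sub>6 E;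
         b8 = (a\<^sub>1 E)\<^sup>2 * a\<^sub>6 E + 4 * a\<^sub>2 E * a\<^sub>6 E - a\<^sub>1 E * a\<^sub>3 E * a\<^sub>4 E
              + a\<^sub>2 E * (a\<^sub>3 E)\<^sup>2 - (a\<^sub>4 E)\<^sup>2
     in - (b2\<^sup>2 * b8) - 8 * b4 ^ 3 - 27 * b6\<^sup>2 + 9 * b2 * b4 * b6)"

definition elliptic_curve :: "'k::field weierstrass \<Rightarrow> bool" where
  "elliptic_curve E \<longleftrightarrow> discriminant E \<noteq> 0"

datatype 'k ec_point = Infinity | Affine 'k 'k

definition ec_points :: "'k::field weierstrass \<Rightarrow> 'k ec_point set" where
  "ec_points E = insert Infinity
     {Affine x y | x y.
        y\<^sup>2 + a\<^sub>1 E * x * y + a\<^sub>3 E * y = x ^ 3 + a\<^sub>2 E * x\<^sup>2 + a\<^sub>4 E * x + a\<^sub>6 E}"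

fun ec_add :: "'k::field weierstrass \<Rightarrow> 'k ec_point \<Rightarrow> 'k ec_point \<Rightarrow> 'k ec_point" where
  "ec_add E Infinity Q = Q"
| "ec_add E (Affine x1 y1) Infinity = Affine x1 y1"
| "ec_add E (Affine x1 y1) (Affine x2 y2) =
     (if x1 = x2 \<and> y1 + y2 + a\<^sub>1 E * x2 + a\<^sub>3 E = 0 then Infinity
      else
        let l = (if x1 = x2
                 then (3 * x1\<^sup>2 + 2 * a\<^sub>2 E * x1 + a\<^sub>4 E - a\<^sub>1 E * y1) / (2 * y1 + a\<^sub>1 E * x1 + a\<^sub>3 E)
                 else (y2 - y1) / (x2 - x1));
            n = y1 - l * x1;
            x3 = l\<^sup>2 + a\<^sub>1 E * l - a\<^sub>2 E - x1 - x2
        in Affine x3 (- (l + a\<^sub>1 E) * x3 - n - a\<^sub>3 E))"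

definition ec_mult :: "'k::field weierstrass \<Rightarrow> nat \<Rightarrow> 'k ec_point \<Rightarrow> 'k ec_point" where
  "ec_mult E n P = (ec_add E P ^^ n) Infinity"

definition torsion :: "'k::field weierstrass \<Rightarrow> nat \<Rightarrow> 'k ec_point set" where
  "torsion E m = {P \<in> ec_points E. ec_mult E m P = Infinity}"

text \<open>
  A basis of the \<open>\<int>/m\<int>\<close>-module of \<open>m\<close>-torsion points; the elements of \<open>\<int>/m\<int>\<close> are represented by
  \<open>0, \<dots>, m - 1\<close>.
\<close>
definition torsion_basis ::
    "'k::field weierstrass \<Rightarrow> nat \<Rightarrow> 'k ec_point \<Rightarrow> 'k ec_point \<Rightarrow> bool" where
  "torsion_basis E m P Q \<longleftrightarrow> P \<in> torsion E m \<and> Q \<in> torsion E m \<and>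
     bij_betw (\<lambda>(a, b). ec_add E (ec_mult E a P) (ec_mult E b Q)) ({..<m} \<times> {..<m}) (torsion E m)"

section \<open>Rational functions and their divisors\<close>

text \<open>
  A homogeneous polynomial of degree \<open>d\<close> in \<open>X, Y, Z\<close> is represented by its dehomogenization at
  \<open>Z = 1\<close>, a polynomial of total degree at most \<open>d\<close>. In the type \<open>'k poly poly\<close> the outer
  variable is \<open>Y\<close> and the coefficients are polynomials in \<open>X\<close>. The point at infinity is
  \<open>(0 : 1 : 0)\<close>, where the value of the form is its coefficient at \<open>Y\<^sup>d\<close>.
\<close>
definition is_form :: "nat \<Rightarrow> 'k::field poly poly \<Rightarrow> bool" where
  "is_form d u \<longleftrightarrow>
     (\<forall>i j. Polynomial.coeff (Polynomial.coeff u j) i \<noteq> 0 \<longrightarrow> i + j \<le> d)"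

fun form_eval :: "nat \<Rightarrow> 'k::field poly poly \<Rightarrow> 'k ec_point \<Rightarrow> 'k" where
  "form_eval d u (Affine x y) = poly (poly u [:y:]) x"
| "form_eval d u Infinity = Polynomial.coeff (Polynomial.coeff u d) 0"

text \<open>
  Over an algebraically closed field the curve has infinitely many points, and two elements of its
  function field are equal iff their values agree at all but finitely many points. An element of
  the function field is therefore represented by any function on points that agrees with a
  quotient of two forms of equal degree outside a finite set, and equality in the function field
  is the following relation.
\<close>
definition ae_eq ::
    "'k::alg_closed_field weierstrass \<Rightarrow> ('k ec_point \<Rightarrow> 'k) \<Rightarrow> ('k ec_point \<Rightarrow> 'k) \<Rightarrow> bool" where
  "ae_eq E f g \<longleftrightarrow> finite {Q \<in> ec_points E. f Q \<noteq> g Q}"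

definition function_field :: "'k::alg_closed_field weierstrass \<Rightarrow> ('k ec_point \<Rightarrow> 'k) set" where
  "function_field E = {f. \<exists>d u v. is_form d u \<and> is_form d v \<and>
     (\<exists>Q \<in> ec_points E. form_eval d v Q \<noteq> 0) \<and>
     ae_eq E f (\<lambda>Q. form_eval d u Q / form_eval d v Q)}"

definition local_ring ::
    "'k::alg_closed_field weierstrass \<Rightarrow> 'k ec_point \<Rightarrow> ('k ec_point \<Rightarrow> 'k) set" where
  "local_ring E P = {f. \<exists>d u v. is_form d u \<and> is_form d v \<and> form_eval d v P \<noteq> 0 \<and>
     ae_eq E f (\<lambda>Q. form_eval d u Q / form_eval d v Q)}"

definition maximal_ideal ::
    "'k::alg_closed_field weierstrass \<Rightarrow> 'k ec_point \<Rightarrow> ('k ec_point \<Rightarrow> 'k) set" where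
  "maximal_ideal E P = {f. \<exists>d u v. is_form d u \<and> is_form d v \<and>
     form_eval d v P \<noteq> 0 \<and> form_eval d u P = 0 \<and>
     ae_eq E f (\<lambda>Q. form_eval d u Q / form_eval d v Q)}"

primrec maximal_ideal_power ::
    "'k::alg_closed_field weierstrass \<Rightarrow> 'k ec_point \<Rightarrow> nat \<Rightarrow> ('k ec_point \<Rightarrow> 'k) set" where
  "maximal_ideal_power E P 0 = local_ring E P"
| "maximal_ideal_power E P (Suc n) =
     {f. \<exists>(k::nat) g h. (\<forall>i<k. g i \<in> maximal_ideal E P \<and> h i \<in> maximal_ideal_power E P n) \<and>
         ae_eq E f (\<lambda>Q. \<Sum>i<k. g i Q * h i Q)}"

text \<open>The order at \<open>P\<close> of a nonzero element of the local ring, then of the function field.\<close>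
definition ord_regular ::
    "'k::alg_closed_field weierstrass \<Rightarrow> 'k ec_point \<Rightarrow> ('k ec_point \<Rightarrow> 'k) \<Rightarrow> nat" where
  "ord_regular E P f = Max {n. f \<in> maximal_ideal_power E P n}"

definition ord_at ::
    "'k::alg_closed_field weierstrass \<Rightarrow> 'k ec_point \<Rightarrow> ('k ec_point \<Rightarrow> 'k) \<Rightarrow> int" where
  "ord_at E P f = (THE n. \<exists>g \<in> local_ring E P. \<exists>h \<in> local_ring E P.
     \<not> ae_eq E g (\<lambda>_. 0) \<and> \<not> ae_eq E h (\<lambda>_. 0) \<and> ae_eq E f (\<lambda>Q. g Q / h Q) \<and>
     n = int (ord_regular E P g) - int (ord_regular E P h))"

section \<open>The Weil pairing\<close>

text \<open>
  For an \<open>m\<close>-torsion point \<open>T\<close>, the function \<open>g\<close> has divisor \<open>[m]\<^sup>*(T) - [m]\<^sup>*(O)\<close>. For \<open>m\<close> prime to the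
  characteristic, multiplication by \<open>m\<close> is unramified, so this divisor is the sum of all points \<open>P\<close>
  with \<open>m P = T\<close> minus the sum of all points \<open>P\<close> with \<open>m P = O\<close>. It determines \<open>g\<close> up to a constant factor.
\<close>
definition weil_function ::
    "'k::alg_closed_field weierstrass \<Rightarrow> nat \<Rightarrow> 'k ec_point \<Rightarrow> ('k ec_point \<Rightarrow> 'k) \<Rightarrow> bool" where
  "weil_function E m T g \<longleftrightarrow> g \<in> function_field E \<and> \<not> ae_eq E g (\<lambda>_. 0) \<and>
     (\<forall>P \<in> ec_points E.
        ord_at E P g = of_bool (ec_mult E m P = T) - of_bool (ec_mult E m P = Infinity))"

text \<open>\<open>e\<^sub>m(S, T)\<close> is the constant \<open>g(Q + S) / g(Q)\<close>.\<close>
definition weil_pairing ::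
    "'k::alg_closed_field weierstrass \<Rightarrow> nat \<Rightarrow> 'k ec_point \<Rightarrow> 'k ec_point \<Rightarrow> 'k" where
  "weil_pairing E m S T =
     (THE c. \<exists>g. weil_function E m T g \<and> ae_eq E (\<lambda>Q. g (ec_add E Q S)) (\<lambda>Q. c * g Q))"

section \<open>Fields of definition\<close>

definition adjoin :: "'a::field alg_closure set \<Rightarrow> 'a alg_closure set" where
  "adjoin S = generate_field ring_of_type_algebra (range to_ac \<union> S)"

abbreviation base_change :: "'a::field weierstrass \<Rightarrow> 'a alg_closure weierstrass" where
  "base_change E \<equiv> map_weierstrass to_ac E"

definition torsion_field :: "'a::field weierstrass \<Rightarrow> nat \<Rightarrow> 'a alg_closure set" where
  "torsion_field E m =
     adjoin (\<Union>{{x, y} | x y. Affine x y \<in> torsion (base_change E) m})"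

end

theory Submission
  imports Defs
begin

text \<open>
  A field automorphism \<open>\<sigma>\<close> fixing \<open>K(x\<^sub>1 + x\<^sub>2, x\<^sub>1 x\<^sub>2, \<zeta>, y\<^sub>1)\<close> permutes \<open>{x\<^sub>1, x\<^sub>2}\<close>. If it swaps them, then
  \<open>\<sigma> P\<^sub>1 = \<plusminus>P\<^sub>2\<close> and \<open>\<sigma> P\<^sub>2 = \<plusminus>P\<^sub>1\<close>; equal signs give \<open>\<zeta> = \<zeta>\<^sup>-\<^sup>1\<close> by the Weil pairing, opposite signs give \<open>P\<^sub>1 = -P\<^sub>1\<close>
  because \<open>y\<^sub>1\<close> is fixed. If it fixes \<open>x\<^sub>1\<close> and \<open>x\<^sub>2\<close> but not \<open>y\<^sub>2\<close>, then \<open>\<sigma> P\<^sub>1 = P\<^sub>1\<close> and \<open>\<sigma> P\<^sub>2 = -P\<^sub>2\<close>, so again \<open>\<zeta>\<^sup>2 = 1\<close>.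
  Since \<open>m \<ge> 3\<close>, both are impossible. Only quadratic extensions occur, and they are separable because \<open>x\<^sub>1 \<noteq> x\<^sub>2\<close> and \<open>P\<^sub>2 \<noteq> -P\<^sub>2\<close>.

  The Weil pairing itself rests on the following. The local ring at each point is a discrete valuation ring,
  so that lines have the expected divisors; functions without poles are constant; hence \<open>(A) - (B)\<close> is principal only
  for \<open>A = B\<close>, which gives associativity. A divisor of degree zero is reduced to \<open>(P) - (O)\<close> by lines, which
  produces the functions \<open>g\<close>. Additivity in the second argument uses the function \<open>\<Prod>h(Q + R)\<close>, with \<open>R\<close> ranging over the torsion points, which is invariant under
  translation by torsion points. If the pairing with \<open>T \<noteq> O\<close> were trivial, then \<open>g\<close> would be invariant, and \<open>g - g(A)\<close> would force
  \<open>m\<^sup>2 A = O\<close> for every point \<open>A\<close>.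
\<close>


section \<open>Weierstrass curves over an algebraically closed field\<close>

text \<open>Functions on the curve count only up to finite sets of points (the filter
  \<open>generic\<close>), so the value of a function at a point is a datum of its own, tracked by
  \<open>regular\<close>. Orders are computed with an explicit uniformizer (\<open>has_ord\<close>)
  and identified with \<open>ord_at\<close> afterwards. That E[m] has \<open>m * m\<close> elements
  is read off from the given basis. The count enters through cosets: the sum of A + E[m] is the sum
  of E[m] plus m^2 A. Hence a function with divisor (A + E[m]) - (E[m]) exists when m^2 A = O, which
  holds if m A is an m-torsion point; for m^2 A \<noteq> O the defect (m^2 A) - (O) is what
  contradicts triviality of the pairing. For the reverse inclusion, \<zeta> is fixed by every
  automorphism that fixes the torsion coordinates. As X^m - 1 is separable for m prime to the
  characteristic, an element \<zeta> outside K(E[m]) would have a conjugate different from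
  itself.\<close>

fun xc :: "'k::zero ec_point \<Rightarrow> 'k" where
  "xc Infinity = 0"
| "xc (Affine x y) = x"

fun yc :: "'k::zero ec_point \<Rightarrow> 'k" where
  "yc Infinity = 0"
| "yc (Affine x y) = y"

fun ec_neg :: "'k::field weierstrass \<Rightarrow> 'k ec_point \<Rightarrow> 'k ec_point" where
  "ec_neg E Infinity = Infinity"
| "ec_neg E (Affine x y) = Affine x (- y - a\<^sub>1 E * x - a\<^sub>3 E)"

lemma infinite_UNIV_alg_closed: "infinite (UNIV :: 'k::alg_closed_field set)"
proof
  assume fin: "finite (UNIV :: 'k set)"
  \<comment> \<open>Value 1 at every element but positive degree: a polynomial without
    roots.\<close>
  define p :: "'k poly" where "p = (\<Prod>c\<in>UNIV. [:- c, 1:]) + 1"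
  have p0: "poly p x = 1" for x
    using fin by (auto simp: p_def poly_prod)
  have "Polynomial.degree (\<Prod>c\<in>(UNIV::'k set). [:- c, 1:]) = card (UNIV :: 'k set)"
    by (subst degree_prod_sum_eq) auto
  moreover have "card (UNIV :: 'k set) > 0"
    using fin by (simp add: card_gt_0_iff)
  ultimately have "Polynomial.degree p > 0"
    unfolding p_def by (subst degree_add_eq_left) auto
  then obtain x where "poly p x = 0"
    using alg_closed_imp_poly_has_root by blast
  with p0 show False by simp
qed

locale elliptic =
  fixes E :: "'k::alg_closed_field weierstrass"
  assumes elliptic: "elliptic_curve E"
begin

definition cubic :: "'k poly" where
  "cubic = [:a\<^sub>6 E, a\<^sub>4 E, a\<^sub>2 E, 1:]"

definition lin :: "'k poly" where
  "lin = [:a\<^sub>3 E, a\<^sub>1 E:]"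

text \<open>Up to the sign of the first, \<open>W\<^sub>x\<close> and \<open>W\<^sub>y\<close> are
  the partial derivatives of the Weierstrass equation; their quotient is the slope of the
  tangent.\<close>

definition W\<^sub>x :: "'k \<Rightarrow> 'k \<Rightarrow> 'k" where
  "W\<^sub>x x y = 3 * x\<^sup>2 + 2 * a\<^sub>2 E * x + a\<^sub>4 E - a\<^sub>1 E * y"

definition W\<^sub>y :: "'k \<Rightarrow> 'k \<Rightarrow> 'k" where
  "W\<^sub>y x y = 2 * y + a\<^sub>1 E * x + a\<^sub>3 E"

text \<open>Truth at all but finitely many points of the curve, as a filter, so that exceptional
  sets combine by \<open>eventually_elim\<close>; \<open>ae_eq\<close> is equality along it.\<close>

definition generic :: "'k ec_point filter" where
  "generic = inf cofinite (principal (ec_points E))"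

definition coordfun :: "'k poly \<Rightarrow> 'k poly \<Rightarrow> 'k ec_point \<Rightarrow> 'k" where
  "coordfun a b Q = poly a (xc Q) + poly b (xc Q) * yc Q"

text \<open>The norm of a + b y over the rational functions in x. The conjugate of y is -y -
  \<open>lin\<close>, which is y composed with negation of points.\<close>

definition pnorm :: "'k poly \<Rightarrow> 'k poly \<Rightarrow> 'k poly" where
  "pnorm a b = a * a - lin * (a * b) - b * b * cubic"

lemma Infinity_in [simp]: "Infinity \<in> ec_points E"
  by (simp add: ec_points_def)

lemma Affine_in_iff:
  "Affine x y \<in> ec_points E \<longleftrightarrow> y\<^sup>2 + a\<^sub>1 E * x * y + a\<^sub>3 E * y = x ^ 3 + a\<^sub>2 E * x\<^sup>2 + a\<^sub>4 E * x + a\<^sub>6 E"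
  by (simp add: ec_points_def)

lemma poly_cubic: "poly cubic x = x ^ 3 + a\<^sub>2 E * x\<^sup>2 + a\<^sub>4 E * x + a\<^sub>6 E"
  by (simp add: cubic_def power2_eq_square power3_eq_cube algebra_simps)

lemma poly_lin: "poly lin x = a\<^sub>1 E * x + a\<^sub>3 E"
  by (simp add: lin_def)

lemma Affine_in_iff': "Affine x y \<in> ec_points E \<longleftrightarrow> y * y + poly lin x * y = poly cubic x"
  by (simp add: Affine_in_iff poly_cubic poly_lin power2_eq_square algebra_simps)

lemma on_curve:
  assumes "Q \<in> ec_points E" "Q \<noteq> Infinity"
  shows "yc Q * yc Q = poly cubic (xc Q) - poly lin (xc Q) * yc Q"
  using assms by (cases Q) (auto simp: Affine_in_iff' eq_diff_eq)

lemma ec_neg_in [simp]: "Q \<in> ec_points E \<Longrightarrow> ec_neg E Q \<in> ec_points E"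
  by (cases Q) (auto simp: Affine_in_iff power2_eq_square algebra_simps)

lemma ec_neg_neg [simp]: "ec_neg E (ec_neg E Q) = Q"
  by (cases Q) auto

lemma ec_neg_eq_Infinity [simp]: "ec_neg E Q = Infinity \<longleftrightarrow> Q = Infinity"
  by (cases Q) auto

lemma ec_neg_eq_iff [simp]: "ec_neg E P = ec_neg E Q \<longleftrightarrow> P = Q"
  by (metis ec_neg_neg)

lemma xc_neg [simp]: "xc (ec_neg E Q) = xc Q"
  by (cases Q) auto

lemma yc_neg: "Q \<noteq> Infinity \<Longrightarrow> yc (ec_neg E Q) = - yc Q - poly lin (xc Q)"
  by (cases Q) (auto simp: poly_lin)

lemma same_xc:
  assumes "P \<in> ec_points E" "Q \<in> ec_points E" "P \<noteq> Infinity" "Q \<noteq> Infinity" "xc P = xc Q"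
  shows "Q = P \<or> Q = ec_neg E P"
proof -
  obtain x y where P: "P = Affine x y" using assms by (cases P) auto
  obtain y' where Q: "Q = Affine x y'" using assms P by (cases Q) auto
  have "(y' - y) * (y' + y + a\<^sub>1 E * x + a\<^sub>3 E) = 0"
    using assms(1,2) unfolding P Q Affine_in_iff by (auto simp: power2_eq_square algebra_simps)
  thus ?thesis
    by (auto simp: P Q) (simp_all add: eq_neg_iff_add_eq_0 algebra_simps)
qed

lemma ex_point: "\<exists>y. Affine x y \<in> ec_points E"
proof -
  have "\<exists>y. poly [:- poly cubic x, poly lin x, 1:] y = 0"
    by (rule alg_closed_imp_poly_has_root) auto
  then obtain y where "poly [:- poly cubic x, poly lin x, 1:] y = 0" by blast
  hence "Affine x y \<in> ec_points E"
    by (simp add: Affine_in_iff' algebra_simps)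
  thus ?thesis ..
qed

lemma finite_xc_fibre:
  assumes "finite A"
  shows "finite {Q \<in> ec_points E. xc Q \<in> A}"
proof -
  have "finite {Q \<in> ec_points E. xc Q = x}" for x
  proof -
    obtain y where y: "Affine x y \<in> ec_points E" using ex_point by blast
    have "{Q \<in> ec_points E. xc Q = x} \<subseteq> {Infinity, Affine x y, ec_neg E (Affine x y)}"
      using same_xc[OF y] by fastforce
    thus ?thesis by (rule finite_subset) simp
  qed
  moreover have "{Q \<in> ec_points E. xc Q \<in> A} = (\<Union>x\<in>A. {Q \<in> ec_points E. xc Q = x})" by auto
  ultimately show ?thesis using assms by simp
qed

lemma infinite_points: "infinite (ec_points E)"
proof
  assume "finite (ec_points E)"
  hence "finite (xc ` ec_points E)" by simp
  moreover have "xc ` ec_points E = UNIV"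
    using ex_point by force
  ultimately show False using infinite_UNIV_alg_closed[where 'k = 'k] by simp
qed

lemma eventually_generic: "eventually P generic \<longleftrightarrow> finite {Q \<in> ec_points E. \<not> P Q}"
proof -
  have "eventually P generic \<longleftrightarrow> finite {Q. \<not> (Q \<in> ec_points E \<longrightarrow> P Q)}"
    by (simp add: generic_def eventually_inf_principal eventually_cofinite)
  also have "{Q. \<not> (Q \<in> ec_points E \<longrightarrow> P Q)} = {Q \<in> ec_points E. \<not> P Q}" by auto
  finally show ?thesis .
qed

lemma ae_eq_iff: "ae_eq E f g \<longleftrightarrow> (\<forall>\<^sub>F Q in generic. f Q = g Q)"
  by (simp add: ae_eq_def eventually_generic)

lemma generic_neq_bot [simp]: "generic \<noteq> bot"
  using infinite_points eventually_generic[of "\<lambda>_. False"] by (auto simp: trivial_limit_def)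

lemma eventually_genI:
  assumes "finite A" "\<And>Q. Q \<in> ec_points E \<Longrightarrow> Q \<notin> A \<Longrightarrow> P Q"
  shows "eventually P generic"
  unfolding eventually_generic by (rule finite_subset[OF _ assms(1)]) (use assms(2) in auto)

lemma eventually_affine: "\<forall>\<^sub>F Q in generic. Q \<in> ec_points E \<and> Q \<noteq> Infinity"
  by (rule eventually_genI[of "{Infinity}"]) auto

lemma eventually_neq: "\<forall>\<^sub>F Q in generic. Q \<noteq> P"
  by (rule eventually_genI[of "{P}"]) auto

text \<open>Injectivity keeps the exceptional set finite under pullback. This is what lets negation,
  translations and automorphisms act on functions modulo finite sets.\<close>

lemma eventually_generic_ex: "eventually P generic \<Longrightarrow> \<exists>Q. P Q"
  using eventually_happens[of P generic] by simp

lemma eventually_generic_inj: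
  assumes "inj_on \<phi> (ec_points E)" "\<And>Q. Q \<in> ec_points E \<Longrightarrow> \<phi> Q \<in> ec_points E" "eventually P generic"
  shows "\<forall>\<^sub>F Q in generic. P (\<phi> Q)"
proof -
  have "finite (\<phi> -` {Q \<in> ec_points E. \<not> P Q} \<inter> ec_points E)"
    using assms(1,3) by (intro finite_vimage_IntI) (auto simp: eventually_generic)
  thus ?thesis
    unfolding eventually_generic by (rule finite_subset[rotated]) (use assms(2) in auto)
qed

lemma eventually_neg: "eventually P generic \<Longrightarrow> \<forall>\<^sub>F Q in generic. P (ec_neg E Q)"
  by (rule eventually_generic_inj) (auto simp: inj_on_def)

lemma eventually_poly_neq_0:
  assumes "c \<noteq> 0"
  shows "\<forall>\<^sub>F Q in generic. poly c (xc Q) \<noteq> 0"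
proof -
  have "finite {Q \<in> ec_points E. xc Q \<in> {x. poly c x = 0}}"
    using assms by (intro finite_xc_fibre poly_roots_finite)
  thus ?thesis by (simp add: eventually_generic)
qed

lemma eventually_poly_eq_0:
  assumes "\<forall>\<^sub>F Q in generic. poly c (xc Q) = 0"
  shows "c = 0"
proof (rule ccontr)
  assume "c \<noteq> 0"
  from eventually_poly_neq_0[OF this] assms have "\<forall>\<^sub>F Q in generic. False"
    by eventually_elim auto
  thus False by simp
qed

section \<open>Conjugation and norms\<close>

lemma coordfun_mult_conj:
  assumes "Q \<in> ec_points E" "Q \<noteq> Infinity"
  shows "coordfun a b Q * coordfun a b (ec_neg E Q) = poly (pnorm a b) (xc Q)"
proof -
  have "coordfun a b Q * coordfun a b (ec_neg E Q) = poly a (xc Q) * poly a (xc Q) - poly a (xc Q) * poly b (xc Q) * poly lin (xc Q)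
      - poly b (xc Q) * poly b (xc Q) * (yc Q * yc Q + poly lin (xc Q) * yc Q)"
    using assms by (simp add: coordfun_def yc_neg algebra_simps)
  thus ?thesis
    using assms by (simp add: pnorm_def on_curve algebra_simps)
qed

lemma degree_lin_le: "Polynomial.degree lin \<le> 1"
  by (simp add: lin_def)

lemma degree_cubic: "Polynomial.degree cubic = 3"
  by (simp add: cubic_def)

text \<open>\<open>a * a\<close> has even degree, \<open>b * b * cubic\<close> has odd degree, and
  the mixed term has smaller degree than the larger of the two, so nothing can cancel.\<close>

lemma pnorm_eq_0:
  assumes "pnorm a b = 0"
  shows "a = 0 \<and> b = 0"
proof -
  have eq: "a * a - lin * (a * b) = b * b * cubic"
    using assms by (simp add: pnorm_def)
  have "b = 0"
  proof (rule ccontr)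
    assume b: "b \<noteq> 0"
    have cub0: "cubic \<noteq> 0" using degree_cubic by force
    let ?n = "Polynomial.degree a" and ?k = "Polynomial.degree b"
    have R: "Polynomial.degree (b * b * cubic) = 2 * ?k + 3"
      using b cub0 by (simp add: degree_mult_eq degree_cubic)
    have a: "a \<noteq> 0" using eq b cub0 by auto
    have A: "Polynomial.degree (a * a) = 2 * ?n"
      using a by (simp add: degree_mult_eq)
    have B: "Polynomial.degree (lin * (a * b)) \<le> 1 + ?n + ?k"
      using degree_mult_le[of lin "a * b"] degree_mult_le[of a b] degree_lin_le by linarith
    show False
    proof (cases "?n \<ge> ?k + 2")
      case True
      have "Polynomial.degree (a * a + - (lin * (a * b))) = 2 * ?n"
        using A B True by (subst degree_add_eq_left) auto
      thus False using eq R by simp presburger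
    next
      case False
      have "Polynomial.degree (a * a - lin * (a * b)) \<le> 2 * ?k + 2"
        using A B False by (intro degree_diff_le) auto
      thus False using eq R by simp
    qed
  qed
  thus ?thesis using eq by simp
qed

lemma eventually_coordfun_neq_0:
  assumes "a \<noteq> 0 \<or> b \<noteq> 0"
  shows "\<forall>\<^sub>F Q in generic. coordfun a b Q \<noteq> 0"
proof -
  have "pnorm a b \<noteq> 0" using assms pnorm_eq_0 by blast
  from eventually_poly_neq_0[OF this] eventually_affine show ?thesis
    by eventually_elim (metis coordfun_mult_conj mult_zero_left)
qed

text \<open>A singular point expresses a3, a4 and a6 through its coordinates and a1, a2. The
  invariants b4, b6, b8 then depend only on x and \<open>B\<close>, which is b2, and the
  discriminant cancels identically.\<close>

lemma nonsingular:
  assumes "Affine x y \<in> ec_points E"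
  shows "W\<^sub>x x y \<noteq> 0 \<or> W\<^sub>y x y \<noteq> 0"
proof (rule ccontr)
  assume "\<not> ?thesis"
  hence wx: "W\<^sub>x x y = 0" and wy: "W\<^sub>y x y = 0" by auto
  define A1 A2 A3 A4 A6 where A: "A1 = a\<^sub>1 E" "A2 = a\<^sub>2 E" "A3 = a\<^sub>3 E" "A4 = a\<^sub>4 E" "A6 = a\<^sub>6 E"
  have a6: "A6 = y\<^sup>2 + A1 * x * y + A3 * y - x ^ 3 - A2 * x\<^sup>2 - A4 * x"
    using assms by (simp add: Affine_in_iff A algebra_simps)
  have a3: "A3 = - 2 * y - A1 * x" using wy by (simp add: W\<^sub>y_def A algebra_simps eq_neg_iff_add_eq_0)
  have a4: "A4 = A1 * y - 3 * x\<^sup>2 - 2 * A2 * x" using wx by (simp add: W\<^sub>x_def A algebra_simps)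
  define B where "B = A1\<^sup>2 + 4 * A2"
  have b4: "2 * A4 + A1 * A3 = - 6 * x\<^sup>2 - B * x"
    unfolding a4 a3 B_def by (simp add: algebra_simps power2_eq_square)
  have b6: "A3\<^sup>2 + 4 * A6 = 8 * x ^ 3 + B * x\<^sup>2"
    unfolding a6 unfolding a4 a3 B_def by (simp add: algebra_simps power2_eq_square power3_eq_cube)
  have b8: "A1\<^sup>2 * A6 + 4 * A2 * A6 - A1 * A3 * A4 + A2 * A3\<^sup>2 - A4\<^sup>2 = - 9 * x ^ 4 - B * x ^ 3"
    unfolding a6 unfolding a4 a3 B_def by (simp add: algebra_simps power2_eq_square power3_eq_cube power4_eq_xxxx)
  have "discriminant E = 0"
    unfolding discriminant_def Let_def A[symmetric] b4 b6 b8 B_def[symmetric]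
    by (simp add: algebra_simps power2_eq_square power3_eq_cube power4_eq_xxxx)
  thus False using elliptic by (simp add: elliptic_curve_def)
qed

text \<open>If 2 y + a1 x + a3 vanished identically, then 2 = 0 and a1 = a3 = 0, which makes b2, b4,
  b6 and with them the discriminant zero. So only finitely many points are their own
  negatives.\<close>

lemma eventually_Wy_neq_0: "\<forall>\<^sub>F Q in generic. W\<^sub>y (xc Q) (yc Q) \<noteq> 0"
proof -
  have "lin \<noteq> 0 \<or> [:2::'k:] \<noteq> 0"
  proof (rule ccontr)
    assume "\<not> ?thesis"
    hence 0: "a\<^sub>1 E = 0" "a\<^sub>3 E = 0" "(2::'k) = 0" by (auto simp: lin_def)
    have "(4::'k) = 2 * 2" "(8::'k) = 2 * 4" "(27::'k) = 1 + 2 * 13" by simp_all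
    hence "discriminant E = 0"
      unfolding discriminant_def Let_def 0 by simp
    thus False using elliptic by (simp add: elliptic_curve_def)
  qed
  from eventually_coordfun_neq_0[OF this] show ?thesis
    by eventually_elim (simp add: coordfun_def W\<^sub>y_def poly_lin algebra_simps)
qed

end

section \<open>Forms and polynomial functions on the curve\<close>

lemma is_form_add: "is_form d u \<Longrightarrow> is_form d v \<Longrightarrow> is_form d (u + v)"
  unfolding is_form_def coeff_add by (metis add_0)

lemma is_form_const: "is_form d [:[:c:]:]"
  by (auto simp: is_form_def coeff_pCons split: nat.splits)

lemma is_form_mult:
  assumes "is_form d u" "is_form e v"
  shows "is_form (d + e) (u * v)"
  unfolding is_form_def
proof (intro allI impI)
  fix i j assume "Polynomial.coeff (Polynomial.coeff (u * v) j) i \<noteq> 0"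
  hence "(\<Sum>k\<le>j. \<Sum>l\<le>i. Polynomial.coeff (Polynomial.coeff u k) l * Polynomial.coeff (Polynomial.coeff v (j - k)) (i - l)) \<noteq> 0"
    by (simp add: coeff_mult coeff_sum)
  then obtain k where k: "k \<le> j"
    "(\<Sum>l\<le>i. Polynomial.coeff (Polynomial.coeff u k) l * Polynomial.coeff (Polynomial.coeff v (j - k)) (i - l)) \<noteq> 0"
    by (meson atMost_iff sum.neutral)
  then obtain l where l: "l \<le> i"
    "Polynomial.coeff (Polynomial.coeff u k) l * Polynomial.coeff (Polynomial.coeff v (j - k)) (i - l) \<noteq> 0"
    by (meson atMost_iff sum.neutral)
  have "l + k \<le> d" "(i - l) + (j - k) \<le> e"
    using assms l(2) unfolding is_form_def by (metis mult_zero_left, metis mult_zero_right)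
  thus "i + j \<le> d + e" using k(1) l(1) by linarith
qed

lemma form_eval_add: "form_eval d (u + v) P = form_eval d u P + form_eval d v P"
  by (cases P) auto

lemma form_eval_mult:
  assumes "is_form d u" "is_form e v"
  shows "form_eval (d + e) (u * v) P = form_eval d u P * form_eval e v P"
proof (cases P)
  case Infinity
  let ?g = "\<lambda>k. Polynomial.coeff (Polynomial.coeff u k) 0 * Polynomial.coeff (Polynomial.coeff v (d + e - k)) 0"
  have "form_eval (d + e) (u * v) P = (\<Sum>k\<le>d+e. ?g k)"
    by (simp add: Infinity coeff_mult coeff_sum)
  \<comment> \<open>The degree bounds force k \<le> d and d + e - k \<le> e, so only k = d
    contributes.\<close>
  also have "\<dots> = (\<Sum>k\<in>{d}. ?g k)"
  proof (rule sum.mono_neutral_right)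
    show "\<forall>k\<in>{..d + e} - {d}. ?g k = 0"
    proof
      fix k assume k: "k \<in> {..d + e} - {d}"
      show "?g k = 0"
      proof (rule ccontr)
        assume "?g k \<noteq> 0"
        hence "0 + k \<le> d" "0 + (d + e - k) \<le> e"
          using assms unfolding is_form_def by (metis mult_zero_left, metis mult_zero_right)
        thus False using k by auto
      qed
    qed
  qed auto
  finally show ?thesis by (simp add: Infinity)
qed auto

lemma poly_eq_sum_degree_le:
  fixes p :: "'a::comm_ring_1 poly"
  assumes "Polynomial.degree p \<le> n"
  shows "poly p x = (\<Sum>i\<le>n. Polynomial.coeff p i * x ^ i)"
  unfolding poly_altdef
  by (rule sum.mono_neutral_left) (use assms in \<open>auto simp: coeff_eq_0\<close>)

lemma form_eval_Affine:
  assumes "is_form d u"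
  shows "form_eval d u (Affine x y) = (\<Sum>j\<le>d. \<Sum>i\<le>d. Polynomial.coeff (Polynomial.coeff u j) i * x ^ i * y ^ j)"
proof -
  have du: "Polynomial.degree u \<le> d"
  proof (rule degree_le, intro allI impI)
    fix j assume "d < j"
    show "Polynomial.coeff u j = 0"
      by (rule poly_eqI) (use assms \<open>d < j\<close> in \<open>force simp: is_form_def\<close>)
  qed
  have dc: "Polynomial.degree (Polynomial.coeff u j) \<le> d" for j
    by (rule degree_le) (use assms in \<open>force simp: is_form_def\<close>)
  have "poly (poly u [:y:]) x = (\<Sum>j\<le>d. poly (Polynomial.coeff u j) x * y ^ j)"
    by (simp add: poly_eq_sum_degree_le[OF du] poly_sum poly_power)
  also have "\<dots> = (\<Sum>j\<le>d. \<Sum>i\<le>d. Polynomial.coeff (Polynomial.coeff u j) i * x ^ i * y ^ j)"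
    by (simp add: poly_eq_sum_degree_le[OF dc] sum_distrib_right)
  finally show ?thesis by simp
qed

context elliptic
begin

text \<open>
  The number \<open>n\<close> bounds the order of the pole at infinity, where \<open>x\<close> and \<open>y\<close> have poles of order \<open>2\<close> and \<open>3\<close>.
\<close>
definition polyfun :: "nat \<Rightarrow> ('k ec_point \<Rightarrow> 'k) \<Rightarrow> bool" where
  "polyfun n f \<longleftrightarrow> (\<exists>a b. 2 * Polynomial.degree a \<le> n \<and> (b = 0 \<or> 2 * Polynomial.degree b + 3 \<le> n) \<and>
     (\<forall>Q\<in>ec_points E - {Infinity}. f Q = coordfun a b Q))"

lemma polyfun_mono: "polyfun n f \<Longrightarrow> n \<le> m \<Longrightarrow> polyfun m f"
  unfolding polyfun_def by (elim exE) (metis le_trans)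

lemma polyfun_const: "polyfun 0 (\<lambda>_. c)"
  unfolding polyfun_def by (intro exI[of _ "[:c:]"] exI[of _ 0]) (simp add: coordfun_def)

lemma polyfun_xc: "polyfun 2 xc"
  unfolding polyfun_def by (intro exI[of _ "[:0, 1:]"] exI[of _ 0]) (simp add: coordfun_def)

lemma polyfun_yc: "polyfun 3 yc"
  unfolding polyfun_def by (intro exI[of _ 0] exI[of _ 1]) (simp add: coordfun_def)

lemma polyfun_add:
  assumes "polyfun n f" "polyfun n g"
  shows "polyfun n (\<lambda>Q. f Q + g Q)"
proof -
  obtain a b a' b' where ab: "2 * Polynomial.degree a \<le> n" "b = 0 \<or> 2 * Polynomial.degree b + 3 \<le> n"
      "\<forall>Q\<in>ec_points E - {Infinity}. f Q = coordfun a b Q"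
      "2 * Polynomial.degree a' \<le> n" "b' = 0 \<or> 2 * Polynomial.degree b' + 3 \<le> n"
      "\<forall>Q\<in>ec_points E - {Infinity}. g Q = coordfun a' b' Q"
    using assms unfolding polyfun_def by blast
  have "2 * Polynomial.degree (a + a') \<le> n"
    using ab(1,4) degree_add_le_max[of a a'] by linarith
  moreover have "b + b' = 0 \<or> 2 * Polynomial.degree (b + b') + 3 \<le> n"
    using ab(2,5) degree_add_le_max[of b b'] by (auto simp: max_def split: if_splits)
  ultimately show ?thesis
    unfolding polyfun_def using ab(3,6)
    by (intro exI[of _ "a + a'"] exI[of _ "b + b'"]) (auto simp: coordfun_def algebra_simps)
qed

text \<open>Replacing y * y by \<open>cubic\<close> - \<open>lin\<close> * y respects pole orders:
  \<open>cubic\<close> has weight 6 = 3 + 3, and \<open>lin\<close> * y has weight at most 2 +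
  3.\<close>

lemma polyfun_mult:
  assumes "polyfun n f" "polyfun m g"
  shows "polyfun (n + m) (\<lambda>Q. f Q * g Q)"
proof -
  obtain a b a' b' where ab: "2 * Polynomial.degree a \<le> n" "b = 0 \<or> 2 * Polynomial.degree b + 3 \<le> n"
      "\<forall>Q\<in>ec_points E - {Infinity}. f Q = coordfun a b Q"
      "2 * Polynomial.degree a' \<le> m" "b' = 0 \<or> 2 * Polynomial.degree b' + 3 \<le> m"
      "\<forall>Q\<in>ec_points E - {Infinity}. g Q = coordfun a' b' Q"
    using assms unfolding polyfun_def by blast
  have le: "Polynomial.degree (p * q) \<le> Polynomial.degree p + Polynomial.degree q" for p q :: "'k poly"
    by (rule degree_mult_le)
  have "2 * Polynomial.degree (a * a' + b * b' * cubic) \<le> n + m"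
  proof -
    have "2 * Polynomial.degree (a * a') \<le> n + m" using le[of a a'] ab by linarith
    moreover have "2 * Polynomial.degree (b * b' * cubic) \<le> n + m"
    proof (cases "b = 0 \<or> b' = 0")
      case False
      thus ?thesis using le[of "b * b'" cubic] le[of b b'] ab degree_cubic by simp
    qed auto
    ultimately show ?thesis using degree_add_le_max[of "a * a'" "b * b' * cubic"] by linarith
  qed
  moreover have "a * b' + a' * b - b * b' * lin = 0 \<or> 2 * Polynomial.degree (a * b' + a' * b - b * b' * lin) + 3 \<le> n + m"
  proof -
    have 1: "a * b' = 0 \<or> 2 * Polynomial.degree (a * b') + 3 \<le> n + m"
      using le[of a b'] ab by auto
    have 2: "a' * b = 0 \<or> 2 * Polynomial.degree (a' * b) + 3 \<le> n + m"
      using le[of a' b] ab by auto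
    have 3: "b * b' * lin = 0 \<or> 2 * Polynomial.degree (b * b' * lin) + 3 \<le> n + m"
      using le[of "b * b'" lin] le[of b b'] ab degree_lin_le by fastforce
    have sum: "p + q = 0 \<or> 2 * Polynomial.degree (p + q) + 3 \<le> n + m"
      if "p = 0 \<or> 2 * Polynomial.degree p + 3 \<le> n + m" "q = 0 \<or> 2 * Polynomial.degree q + 3 \<le> n + m" for p q :: "'k poly"
      using that degree_add_le_max[of p q] by (auto simp: max_def split: if_splits)
    have "a * b' + a' * b + - (b * b' * lin) = 0 \<or> 2 * Polynomial.degree (a * b' + a' * b + - (b * b' * lin)) + 3 \<le> n + m"
      by (intro sum 1 2) (use 3 in simp)
    thus ?thesis by simp
  qed
  moreover have "\<forall>Q\<in>ec_points E - {Infinity}. f Q * g Q = coordfun (a * a' + b * b' * cubic) (a * b' + a' * b - b * b' * lin) Q"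
  proof
    fix Q assume Q: "Q \<in> ec_points E - {Infinity}"
    have "coordfun a b Q * coordfun a' b' Q = poly a (xc Q) * poly a' (xc Q) + (poly a (xc Q) * poly b' (xc Q) + poly a' (xc Q) * poly b (xc Q)) * yc Q
       + poly b (xc Q) * poly b' (xc Q) * (yc Q * yc Q)"
      by (simp add: coordfun_def algebra_simps)
    also have "\<dots> = coordfun (a * a' + b * b' * cubic) (a * b' + a' * b - b * b' * lin) Q"
      using Q by (simp add: on_curve coordfun_def algebra_simps)
    finally show "f Q * g Q = coordfun (a * a' + b * b' * cubic) (a * b' + a' * b - b * b' * lin) Q"
      using ab(3,6) Q by simp
  qed
  ultimately show ?thesis unfolding polyfun_def by blast
qed

lemma polyfun_power: "polyfun n f \<Longrightarrow> polyfun (k * n) (\<lambda>Q. f Q ^ k)"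
proof (induction k)
  case (Suc k)
  thus ?case using polyfun_mult[of n f "k * n" "\<lambda>Q. f Q ^ k"] by simp
qed (use polyfun_const[of 1] in simp)

lemma polyfun_sum:
  "(\<And>i. i \<in> A \<Longrightarrow> polyfun n (\<lambda>Q. f i Q)) \<Longrightarrow> polyfun n (\<lambda>Q. \<Sum>i\<in>A. f i Q)"
proof (induction A rule: infinite_finite_induct)
  case (insert x A)
  thus ?case using polyfun_add[of n "f x" "\<lambda>Q. \<Sum>i\<in>A. f i Q"] by simp
qed (use polyfun_mono[OF polyfun_const[of 0]] in simp_all)

lemma polyfun_cmult: "polyfun n f \<Longrightarrow> polyfun n (\<lambda>Q. c * f Q)"
  using polyfun_mult[OF polyfun_const[of c]] by simp

lemma polyfun_cong:
  "polyfun n f \<Longrightarrow> (\<And>Q. Q \<in> ec_points E \<Longrightarrow> Q \<noteq> Infinity \<Longrightarrow> f Q = g Q) \<Longrightarrow> polyfun n g"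
  unfolding polyfun_def by (metis DiffE insertI1)

lemma polyfun_monom: "polyfun (2 * i + 3 * j) (\<lambda>Q. c * xc Q ^ i * yc Q ^ j)"
  using polyfun_cmult[OF polyfun_mult[OF polyfun_power[OF polyfun_xc, of i] polyfun_power[OF polyfun_yc, of j]], of c]
  by (simp add: mult_ac)

lemma form_eval_eq_sum:
  assumes "is_form d u" "Q \<noteq> Infinity"
  shows "form_eval d u Q = (\<Sum>j\<le>d. \<Sum>i\<le>d. Polynomial.coeff (Polynomial.coeff u j) i * xc Q ^ i * yc Q ^ j)"
proof (cases Q)
  case (Affine x y)
  thus ?thesis using form_eval_Affine[OF assms(1), of x y] by (simp del: form_eval.simps)
qed (use assms in simp)

lemma polyfun_form:
  assumes "is_form d u"
  shows "polyfun (5 * d) (form_eval d u)"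
proof (rule polyfun_cong)
  show "polyfun (5 * d) (\<lambda>Q. \<Sum>j\<le>d. \<Sum>i\<le>d. Polynomial.coeff (Polynomial.coeff u j) i * xc Q ^ i * yc Q ^ j)"
    by (intro polyfun_sum) (rule polyfun_mono[OF polyfun_monom], simp)
qed (use form_eval_eq_sum[OF assms] in simp)

text \<open>The weight 2 i + 3 j of a monomial with i + j \<le> d is at most 3 d, and y^d alone
  attains it.\<close>

lemma polyfun_form_minus_lead:
  assumes "is_form d u" "d > 0"
  shows "polyfun (3 * d - 1) (\<lambda>Q. form_eval d u Q - Polynomial.coeff (Polynomial.coeff u d) 0 * yc Q ^ d)"
proof (rule polyfun_cong)
  let ?t = "\<lambda>Q j i. Polynomial.coeff (Polynomial.coeff u j) i * xc Q ^ i * yc Q ^ j"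
  let ?I = "{..d} \<times> {..d} - {(d, 0)}"
  show "polyfun (3 * d - 1) (\<lambda>Q. \<Sum>(j, i)\<in>?I. ?t Q j i)"
  proof (rule polyfun_sum)
    fix p assume p: "p \<in> ?I"
    obtain j i where ji: "p = (j, i)" by fastforce
    have "polyfun (3 * d - 1) (\<lambda>Q. ?t Q j i)"
    proof (cases "Polynomial.coeff (Polynomial.coeff u j) i = 0")
      case False
      hence "i + j \<le> d" using assms(1) by (simp add: is_form_def)
      hence "2 * i + 3 * j \<le> 3 * d - 1" using p ji by (cases "i = 0") auto
      thus ?thesis using polyfun_monom polyfun_mono by blast
    next
      case True
      thus ?thesis using polyfun_mono[OF polyfun_const[of 0]] by simp
    qed
    thus "polyfun (3 * d - 1) (\<lambda>Q. case p of (j, i) \<Rightarrow> ?t Q j i)" by (simp add: ji)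
  qed
  fix Q assume Q: "Q \<in> ec_points E" "Q \<noteq> Infinity"
  have "form_eval d u Q = (\<Sum>(j, i)\<in>{..d} \<times> {..d}. ?t Q j i)"
    using form_eval_eq_sum[OF assms(1) Q(2)] by (simp add: sum.cartesian_product)
  also have "\<dots> = ?t Q d 0 + (\<Sum>(j, i)\<in>?I. ?t Q j i)"
    by (subst sum.remove[of _ "(d, 0)"]) auto
  finally show "(\<Sum>(j, i)\<in>?I. ?t Q j i) = form_eval d u Q - Polynomial.coeff (Polynomial.coeff u d) 0 * yc Q ^ d"
    by simp
qed

text \<open>Norms separate the two sides: the norm of y is -\<open>cubic\<close>, so that of y^d has
  degree 3 d, while the norm of a function of weight 3 d - 1 has degree at most 3 d - 1.\<close>

lemma not_polyfun_yc_power: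
  assumes "polyfun (3 * d - 1) f" "d > 0" "\<forall>\<^sub>F Q in generic. f Q = yc Q ^ d"
  shows False
proof -
  obtain a b where ab: "2 * Polynomial.degree a \<le> 3 * d - 1" "b = 0 \<or> 2 * Polynomial.degree b + 3 \<le> 3 * d - 1"
      "\<forall>Q\<in>ec_points E - {Infinity}. f Q = coordfun a b Q"
    using assms(1) unfolding polyfun_def by blast
  have *: "\<forall>\<^sub>F Q in generic. coordfun a b Q = yc Q ^ d"
    using assms(3) eventually_affine by eventually_elim (use ab(3) in auto)
  have "\<forall>\<^sub>F Q in generic. poly (pnorm a b - (- cubic) ^ d) (xc Q) = 0"
    using * eventually_neg[OF *] eventually_affine
  proof eventually_elim
    case (elim Q)
    have "poly (pnorm a b) (xc Q) = (yc Q * yc (ec_neg E Q)) ^ d"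
      using coordfun_mult_conj[of Q a b] elim by (simp add: power_mult_distrib)
    also have "yc Q * yc (ec_neg E Q) = - (yc Q * yc Q + poly lin (xc Q) * yc Q)"
      using elim by (simp add: yc_neg algebra_simps)
    also have "\<dots> = - poly cubic (xc Q)"
      using elim by (simp add: on_curve)
    finally show ?case by (simp add: poly_power)
  qed
  hence eq: "pnorm a b = (- cubic) ^ d"
    using eventually_poly_eq_0[of "pnorm a b - (- cubic) ^ d"] by simp
  have "cubic \<noteq> 0" using degree_cubic by force
  hence "Polynomial.degree (pnorm a b) = 3 * d"
    unfolding eq by (simp add: degree_power_eq degree_cubic)
  moreover have "Polynomial.degree (pnorm a b) \<le> 3 * d - 1"
  proof -
    have "Polynomial.degree (a * a) \<le> 3 * d - 1"
      using ab(1) degree_mult_le[of a a] by linarith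
    moreover have "Polynomial.degree (b * b * cubic) \<le> 3 * d - 1"
      using ab(2) degree_mult_le[of "b * b" cubic] degree_mult_le[of b b] degree_cubic by auto
    moreover have "Polynomial.degree (lin * (a * b)) \<le> 3 * d - 1"
      using ab(1,2) degree_mult_le[of lin "a * b"] degree_mult_le[of a b] degree_lin_le by auto
    ultimately show ?thesis unfolding pnorm_def by (intro degree_diff_le) auto
  qed
  ultimately show False using assms(2) by simp
qed

lemma polyfun_cases:
  assumes "polyfun n f"
  shows "(\<forall>Q\<in>ec_points E - {Infinity}. f Q = 0) \<or> (\<forall>\<^sub>F Q in generic. f Q \<noteq> 0)"
proof -
  obtain a b where ab: "\<forall>Q\<in>ec_points E - {Infinity}. f Q = coordfun a b Q"
    using assms unfolding polyfun_def by blast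
  show ?thesis
  proof (cases "a = 0 \<and> b = 0")
    case True
    thus ?thesis using ab by (auto simp: coordfun_def)
  next
    case False
    hence "\<forall>\<^sub>F Q in generic. coordfun a b Q \<noteq> 0" using eventually_coordfun_neq_0 by blast
    hence "\<forall>\<^sub>F Q in generic. f Q \<noteq> 0"
      using eventually_affine by eventually_elim (use ab in auto)
    thus ?thesis ..
  qed
qed

text \<open>The delicate point is infinity, where a nonzero value is a nonzero coefficient of Y^d.
  If the form vanished at all affine points, this coefficient would express y^d by a function of
  smaller weight.\<close>

lemma form_eventually_neq_0:
  assumes "is_form d u" "P \<in> ec_points E" "form_eval d u P \<noteq> 0"
  shows "\<forall>\<^sub>F Q in generic. form_eval d u Q \<noteq> 0"
proof (rule ccontr)
  assume not: "\<not> ?thesis"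
  hence 0: "\<forall>Q\<in>ec_points E - {Infinity}. form_eval d u Q = 0"
    using polyfun_cases[OF polyfun_form[OF assms(1)]] by blast
  hence P: "P = Infinity" using assms by blast
  define c where "c = Polynomial.coeff (Polynomial.coeff u d) 0"
  have c: "c \<noteq> 0" using assms(3) P by (simp add: c_def)
  show False
  proof (cases "d = 0")
    case True
    obtain Q where Q: "Q \<in> ec_points E" "Q \<noteq> Infinity"
      using eventually_generic_ex[OF eventually_affine] by blast
    hence "form_eval d u Q = c"
      using form_eval_eq_sum[OF assms(1) Q(2)] by (simp add: True c_def)
    thus False using 0 Q c by auto
  next
    case False
    have "polyfun (3 * d - 1) (\<lambda>Q. - (1 / c) * (form_eval d u Q - c * yc Q ^ d))"
      unfolding c_def using polyfun_form_minus_lead[OF assms(1)] False by (intro polyfun_cmult) simp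
    moreover have "\<forall>\<^sub>F Q in generic. - (1 / c) * (form_eval d u Q - c * yc Q ^ d) = yc Q ^ d"
      using eventually_affine by eventually_elim (use 0 c in simp)
    ultimately show False using not_polyfun_yc_power False by blast
  qed
qed

lemma form_vanishes:
  assumes "is_form d u" "P \<in> ec_points E" "\<forall>\<^sub>F Q in generic. form_eval d u Q = 0"
  shows "form_eval d u P = 0"
proof (rule ccontr)
  assume "form_eval d u P \<noteq> 0"
  from form_eventually_neq_0[OF assms(1,2) this] assms(3) have "\<forall>\<^sub>F Q in generic. False"
    by eventually_elim auto
  thus False by simp
qed

end

section \<open>Local rings\<close>

context elliptic
begin

text \<open>
  \<open>f\<close> lies in the local ring at \<open>P\<close> and has the value \<open>a\<close> there; \<open>f P\<close> itself carries no information.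
\<close>
definition regular :: "'k ec_point \<Rightarrow> ('k ec_point \<Rightarrow> 'k) \<Rightarrow> 'k \<Rightarrow> bool" where
  "regular P f a \<longleftrightarrow> (\<exists>d u v. is_form d u \<and> is_form d v \<and> form_eval d v P \<noteq> 0 \<and>
     (\<forall>\<^sub>F Q in generic. f Q = form_eval d u Q / form_eval d v Q) \<and> a = form_eval d u P / form_eval d v P)"

lemma local_ring_iff: "f \<in> local_ring E P \<longleftrightarrow> (\<exists>a. regular P f a)"
  unfolding local_ring_def regular_def ae_eq_iff by auto

lemma maximal_ideal_iff: "f \<in> maximal_ideal E P \<longleftrightarrow> regular P f 0"
  unfolding maximal_ideal_def regular_def ae_eq_iff by auto

lemma regular_cong:
  assumes "regular P f a" "\<forall>\<^sub>F Q in generic. f Q = g Q"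
  shows "regular P g a"
proof -
  obtain d u v where *: "is_form d u" "is_form d v" "form_eval d v P \<noteq> 0"
     "\<forall>\<^sub>F Q in generic. f Q = form_eval d u Q / form_eval d v Q" "a = form_eval d u P / form_eval d v P"
    using assms(1) unfolding regular_def by blast
  have "\<forall>\<^sub>F Q in generic. g Q = form_eval d u Q / form_eval d v Q"
    using *(4) assms(2) by eventually_elim simp
  thus ?thesis unfolding regular_def using * by blast
qed

lemma regular_const: "regular P (\<lambda>_. c) c"
proof -
  have "form_eval 0 [:[:c:]:] Q = c" "form_eval 0 [:[:1:]:] Q = 1" for Q
    by (cases Q; simp)+
  thus ?thesis unfolding regular_def
    by (intro exI[of _ 0] exI[of _ "[:[:c:]:]"] exI[of _ "[:[:1:]:]"]) (auto simp: is_form_const)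
qed

lemma regular_add:
  assumes P: "P \<in> ec_points E" and "regular P f a" "regular P g b"
  shows "regular P (\<lambda>Q. f Q + g Q) (a + b)"
proof -
  obtain d u v where 1: "is_form d u" "is_form d v" "form_eval d v P \<noteq> 0"
     "\<forall>\<^sub>F Q in generic. f Q = form_eval d u Q / form_eval d v Q" "a = form_eval d u P / form_eval d v P"
    using assms(2) unfolding regular_def by blast
  obtain d' u' v' where 2: "is_form d' u'" "is_form d' v'" "form_eval d' v' P \<noteq> 0"
     "\<forall>\<^sub>F Q in generic. g Q = form_eval d' u' Q / form_eval d' v' Q" "b = form_eval d' u' P / form_eval d' v' P"
    using assms(3) unfolding regular_def by blast
  have n: "form_eval (d + d') (u * v' + v * u') Q = form_eval d u Q * form_eval d' v' Q + form_eval d' u' Q * form_eval d v Q" for Q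
    by (simp only: form_eval_add form_eval_mult[OF 1(1) 2(2)] form_eval_mult[OF 1(2) 2(1)])
      (simp only: mult.commute)
  have m: "form_eval (d + d') (v * v') Q = form_eval d v Q * form_eval d' v' Q" for Q
    by (rule form_eval_mult[OF 1(2) 2(2)])
  have "\<forall>\<^sub>F Q in generic. f Q + g Q = form_eval (d + d') (u * v' + v * u') Q / form_eval (d + d') (v * v') Q"
    using 1(4) 2(4) form_eventually_neq_0[OF 1(2) P 1(3)] form_eventually_neq_0[OF 2(2) P 2(3)]
    by eventually_elim (simp add: n m add_frac_eq)
  moreover have "a + b = form_eval (d + d') (u * v' + v * u') P / form_eval (d + d') (v * v') P"
    using 1(3) 2(3) by (simp add: 1(5) 2(5) n m add_frac_eq)
  moreover have "is_form (d + d') (u * v' + v * u')" "is_form (d + d') (v * v')"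
    by (intro is_form_add is_form_mult 1 2)+
  moreover have "form_eval (d + d') (v * v') P \<noteq> 0"
    using 1 2 by (simp add: form_eval_mult[OF 1(2) 2(2)])
  ultimately show ?thesis unfolding regular_def by blast
qed

lemma regular_mult:
  assumes "regular P f a" "regular P g b"
  shows "regular P (\<lambda>Q. f Q * g Q) (a * b)"
proof -
  obtain d u v where 1: "is_form d u" "is_form d v" "form_eval d v P \<noteq> 0"
     "\<forall>\<^sub>F Q in generic. f Q = form_eval d u Q / form_eval d v Q" "a = form_eval d u P / form_eval d v P"
    using assms(1) unfolding regular_def by blast
  obtain d' u' v' where 2: "is_form d' u'" "is_form d' v'" "form_eval d' v' P \<noteq> 0"
     "\<forall>\<^sub>F Q in generic. g Q = form_eval d' u' Q / form_eval d' v' Q" "b = form_eval d' u' P / form_eval d' v' P"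
    using assms(2) unfolding regular_def by blast
  have "\<forall>\<^sub>F Q in generic. f Q * g Q = form_eval (d + d') (u * u') Q / form_eval (d + d') (v * v') Q"
    using 1(4) 2(4)
    by eventually_elim (simp add: form_eval_mult[OF 1(1) 2(1)] form_eval_mult[OF 1(2) 2(2)])
  moreover have "a * b = form_eval (d + d') (u * u') P / form_eval (d + d') (v * v') P"
    using 1 2 by (simp add: form_eval_mult[OF 1(1) 2(1)] form_eval_mult[OF 1(2) 2(2)])
  moreover have "is_form (d + d') (u * u')" "is_form (d + d') (v * v')"
    by (intro is_form_mult 1 2)+
  moreover have "form_eval (d + d') (v * v') P \<noteq> 0"
    using 1 2 by (simp add: form_eval_mult[OF 1(2) 2(2)])
  ultimately show ?thesis unfolding regular_def by blast
qed

lemma regular_inverse: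
  assumes "regular P f a" "a \<noteq> 0"
  shows "regular P (\<lambda>Q. inverse (f Q)) (inverse a)"
proof -
  obtain d u v where 1: "is_form d u" "is_form d v" "form_eval d v P \<noteq> 0"
     "\<forall>\<^sub>F Q in generic. f Q = form_eval d u Q / form_eval d v Q" "a = form_eval d u P / form_eval d v P"
    using assms(1) unfolding regular_def by blast
  have "\<forall>\<^sub>F Q in generic. inverse (f Q) = form_eval d v Q / form_eval d u Q"
    using 1(4) by eventually_elim simp
  thus ?thesis unfolding regular_def using 1 assms(2)
    by (intro exI[of _ d] exI[of _ v] exI[of _ u]) auto
qed

lemma regular_minus: "regular P f a \<Longrightarrow> regular P (\<lambda>Q. - f Q) (- a)"
  using regular_mult[OF regular_const[of P "-1"], of f a] by simp

lemma regular_diff: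
  "P \<in> ec_points E \<Longrightarrow> regular P f a \<Longrightarrow> regular P g b \<Longrightarrow> regular P (\<lambda>Q. f Q - g Q) (a - b)"
  using regular_add[of P f a "\<lambda>Q. - g Q" "- b"] regular_minus[of P g b] by simp

lemma regular_divide:
  "regular P f a \<Longrightarrow> regular P g b \<Longrightarrow> b \<noteq> 0 \<Longrightarrow> regular P (\<lambda>Q. f Q / g Q) (a / b)"
  using regular_mult[of P f a "\<lambda>Q. inverse (g Q)" "inverse b"] regular_inverse[of P g b] by (simp add: divide_inverse)

lemma regular_power: "regular P f a \<Longrightarrow> regular P (\<lambda>Q. f Q ^ n) (a ^ n)"
  by (induction n) (auto intro: regular_const regular_mult)

text \<open>Two values of f give a representation of the zero function by forms; its numerator
  vanishes generically and therefore, by \<open>form_vanishes\<close>, also at P.\<close>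

lemma regular_unique:
  assumes P: "P \<in> ec_points E" and "regular P f a" "regular P f b"
  shows "a = b"
proof -
  have "regular P (\<lambda>Q. f Q - f Q) (a - b)" using regular_diff[OF assms] .
  hence "regular P (\<lambda>_. 0) (a - b)" by simp
  then obtain d u v where 1: "is_form d u" "is_form d v" "form_eval d v P \<noteq> 0"
     "\<forall>\<^sub>F Q in generic. 0 = form_eval d u Q / form_eval d v Q" "a - b = form_eval d u P / form_eval d v P"
    unfolding regular_def by blast
  have "\<forall>\<^sub>F Q in generic. form_eval d u Q = 0"
    using 1(4) form_eventually_neq_0[OF 1(2) P 1(3)] by eventually_elim simp
  hence "form_eval d u P = 0" using form_vanishes[OF 1(1) P] by blast
  thus ?thesis using 1 by simp
qed

lemma regular_eventually_neq_0:
  assumes P: "P \<in> ec_points E" and "regular P f a" "a \<noteq> 0"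
  shows "\<forall>\<^sub>F Q in generic. f Q \<noteq> 0"
proof -
  obtain d u v where 1: "is_form d u" "is_form d v" "form_eval d v P \<noteq> 0"
     "\<forall>\<^sub>F Q in generic. f Q = form_eval d u Q / form_eval d v Q" "a = form_eval d u P / form_eval d v P"
    using assms(2) unfolding regular_def by blast
  have "form_eval d u P \<noteq> 0" using 1 assms(3) by auto
  from form_eventually_neq_0[OF 1(1) P this] form_eventually_neq_0[OF 1(2) P 1(3)] 1(4)
  show ?thesis by eventually_elim simp
qed

text \<open>
  Affine coordinates around \<open>P\<close>. At infinity these are \<open>X/Y\<close> and \<open>Z/Y\<close>, both of which vanish there, in
  agreement with the junk values of \<^const>\<open>xc\<close> and \<^const>\<open>yc\<close>.
\<close>
definition chart1 :: "'k ec_point \<Rightarrow> 'k ec_point \<Rightarrow> 'k" where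
  "chart1 P Q = (if P = Infinity then xc Q / yc Q else xc Q)"

definition chart2 :: "'k ec_point \<Rightarrow> 'k ec_point \<Rightarrow> 'k" where
  "chart2 P Q = (if P = Infinity then 1 / yc Q else yc Q)"

lemma is_form_xyz: "is_form 1 [:[:0, 1:]:]" "is_form 1 [:0, 1:]" "is_form 1 1"
  by (auto simp: is_form_def coeff_pCons one_pCons split: nat.splits)

lemma regular_chart1: "regular P (chart1 P) (xc P)"
proof (cases "P = Infinity")
  case True
  have "\<forall>\<^sub>F Q in generic. chart1 P Q = form_eval 1 [:[:0, 1:]:] Q / form_eval 1 [:0, 1:] Q"
    using eventually_affine
  proof eventually_elim
    case (elim Q)
    thus ?case by (cases Q) (auto simp: True chart1_def)
  qed
  thus ?thesis unfolding regular_def using is_form_xyz True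
    by (intro exI[of _ 1] exI[of _ "[:[:0, 1:]:]"] exI[of _ "[:0, 1:]"]) auto
next
  case False
  have "\<forall>\<^sub>F Q in generic. chart1 P Q = form_eval 1 [:[:0, 1:]:] Q / form_eval 1 1 Q"
    using eventually_affine
  proof eventually_elim
    case (elim Q)
    thus ?case by (cases Q) (auto simp: False chart1_def)
  qed
  thus ?thesis unfolding regular_def using is_form_xyz False
    by (intro exI[of _ 1] exI[of _ "[:[:0, 1:]:]"] exI[of _ "1"]; cases P) auto
qed

lemma regular_chart2: "regular P (chart2 P) (yc P)"
proof (cases "P = Infinity")
  case True
  have "\<forall>\<^sub>F Q in generic. chart2 P Q = form_eval 1 1 Q / form_eval 1 [:0, 1:] Q"
    using eventually_affine
  proof eventually_elim
    case (elim Q)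
    thus ?case by (cases Q) (auto simp: True chart2_def)
  qed
  thus ?thesis unfolding regular_def using is_form_xyz True
    by (intro exI[of _ 1] exI[of _ "1"] exI[of _ "[:0, 1:]"]) auto
next
  case False
  have "\<forall>\<^sub>F Q in generic. chart2 P Q = form_eval 1 [:0, 1:] Q / form_eval 1 1 Q"
    using eventually_affine
  proof eventually_elim
    case (elim Q)
    thus ?case by (cases Q) (auto simp: False chart2_def)
  qed
  thus ?thesis unfolding regular_def using is_form_xyz False
    by (intro exI[of _ 1] exI[of _ "[:0, 1:]"] exI[of _ "1"]; cases P) auto
qed

lemma eventually_xc_neq: "\<forall>\<^sub>F Q in generic. xc Q \<noteq> c"
  using eventually_poly_neq_0[of "[:- c, 1:]"] by simp

lemma eventually_yc_neq: "\<forall>\<^sub>F Q in generic. yc Q \<noteq> c"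
  using eventually_coordfun_neq_0[of "[:- c:]" 1] by (simp add: coordfun_def)

text \<open>At infinity the form is divided by Y^d, which turns the monomial x^i y^j into (X/Y)^i
  (Z/Y)^(d-i-j). Both chart coordinates vanish there, so only i = 0, j = d survives in the
  value.\<close>

lemma form_in_chart:
  fixes P :: "'k ec_point"
  assumes u: "is_form d u"
  defines "e \<equiv> (\<lambda>i j. if P = Infinity then d - i - j else j)"
  shows "\<forall>\<^sub>F Q in generic. form_eval d u Q / (if P = Infinity then yc Q ^ d else 1) =
           (\<Sum>j\<le>d. \<Sum>i\<le>d. Polynomial.coeff (Polynomial.coeff u j) i * (chart1 P Q ^ i * chart2 P Q ^ e i j))"
    and "form_eval d u P = (\<Sum>j\<le>d. \<Sum>i\<le>d. Polynomial.coeff (Polynomial.coeff u j) i * (xc P ^ i * yc P ^ e i j))"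
proof -
  show "\<forall>\<^sub>F Q in generic. form_eval d u Q / (if P = Infinity then yc Q ^ d else 1) =
           (\<Sum>j\<le>d. \<Sum>i\<le>d. Polynomial.coeff (Polynomial.coeff u j) i * (chart1 P Q ^ i * chart2 P Q ^ e i j))"
    using eventually_affine eventually_yc_neq[of 0]
  proof eventually_elim
    case (elim Q)
    have "Polynomial.coeff (Polynomial.coeff u j) i * xc Q ^ i * yc Q ^ j / (if P = Infinity then yc Q ^ d else 1) =
          Polynomial.coeff (Polynomial.coeff u j) i * (chart1 P Q ^ i * chart2 P Q ^ e i j)" for i j
    proof (cases "P = Infinity \<and> Polynomial.coeff (Polynomial.coeff u j) i \<noteq> 0")
      case True
      hence "i + j \<le> d" using u by (simp add: is_form_def)
      hence "d = i + j + (d - i - j)" by simp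
      hence "yc Q ^ d = yc Q ^ i * yc Q ^ j * yc Q ^ (d - i - j)" by (metis power_add)
      thus ?thesis using True elim by (simp add: chart1_def chart2_def e_def power_divide field_simps)
    qed (auto simp: chart1_def chart2_def e_def)
    thus ?case
      using elim by (simp add: form_eval_eq_sum[OF u] sum_divide_distrib)
  qed
  show "form_eval d u P = (\<Sum>j\<le>d. \<Sum>i\<le>d. Polynomial.coeff (Polynomial.coeff u j) i * (xc P ^ i * yc P ^ e i j))"
  proof (cases "P = Infinity")
    case True
    have "Polynomial.coeff (Polynomial.coeff u j) i * (xc P ^ i * yc P ^ e i j) =
          (if j = d then if i = 0 then Polynomial.coeff (Polynomial.coeff u j) i else 0 else 0)" if "j \<le> d" for i j
    proof (cases "Polynomial.coeff (Polynomial.coeff u j) i = 0")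
      case False
      hence "i + j \<le> d" using u by (simp add: is_form_def)
      thus ?thesis using True that by (auto simp: e_def power_0_left)
    qed auto
    hence "(\<Sum>j\<le>d. \<Sum>i\<le>d. Polynomial.coeff (Polynomial.coeff u j) i * (xc P ^ i * yc P ^ e i j)) =
       (\<Sum>j\<le>d. \<Sum>i\<le>d. if j = d then if i = 0 then Polynomial.coeff (Polynomial.coeff u j) i else 0 else 0)"
      by (intro sum.cong refl) auto
    also have "\<dots> = (\<Sum>j\<le>d. if j = d then Polynomial.coeff (Polynomial.coeff u d) 0 else 0)"
      by (intro sum.cong refl) auto
    finally show ?thesis using True by simp
  next
    case False
    thus ?thesis by (simp add: form_eval_eq_sum[OF u] e_def mult_ac)
  qed
qed

text \<open>The local ring arises from the constants and the two chart coordinates by sums, products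
  and inverses of units. A property closed under these operations has to be checked on the
  coordinates only; first-order expansions, pullbacks and automorphisms are all treated in this
  way.\<close>

lemma regular_induct:
  assumes P: "P \<in> ec_points E" and f: "regular P f a"
    and cong: "\<And>f g a. V f a \<Longrightarrow> \<forall>\<^sub>F Q in generic. f Q = g Q \<Longrightarrow> V g a"
    and const: "\<And>c. V (\<lambda>_. c) c"
    and add: "\<And>f a g b. V f a \<Longrightarrow> V g b \<Longrightarrow> V (\<lambda>Q. f Q + g Q) (a + b)"
    and mult: "\<And>f a g b. V f a \<Longrightarrow> V g b \<Longrightarrow> V (\<lambda>Q. f Q * g Q) (a * b)"
    and inverse: "\<And>f a. V f a \<Longrightarrow> a \<noteq> 0 \<Longrightarrow> V (\<lambda>Q. inverse (f Q)) (inverse a)"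
    and c1: "V (chart1 P) (xc P)" and c2: "V (chart2 P) (yc P)"
  shows "V f a"
proof -
  have power: "V f a \<Longrightarrow> V (\<lambda>Q. f Q ^ n) (a ^ n)" for f a n
    by (induction n) (use const mult in auto)
  have sum: "(\<And>i. i \<in> A \<Longrightarrow> V (f i) (a i)) \<Longrightarrow> V (\<lambda>Q. \<Sum>i\<in>A. f i Q) (\<Sum>i\<in>A. a i)" for A :: "nat set" and f a
    by (induction A rule: infinite_finite_induct) (use const[of 0] add in auto)
  obtain d u v where 1: "is_form d u" "is_form d v" "form_eval d v P \<noteq> 0"
     "\<forall>\<^sub>F Q in generic. f Q = form_eval d u Q / form_eval d v Q" "a = form_eval d u P / form_eval d v P"
    using f unfolding regular_def by blast
  let ?s = "\<lambda>Q. if P = Infinity then yc Q ^ d else 1"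
  have form: "V (\<lambda>Q. form_eval d w Q / ?s Q) (form_eval d w P)" if w: "is_form d w" for w
  proof (rule cong)
    show "V (\<lambda>Q. \<Sum>j\<le>d. \<Sum>i\<le>d. Polynomial.coeff (Polynomial.coeff w j) i *
            (chart1 P Q ^ i * chart2 P Q ^ (if P = Infinity then d - i - j else j))) (form_eval d w P)"
      unfolding form_in_chart(2)[OF w] by (intro sum mult const power c1 c2)
  qed (use form_in_chart(1)[OF w, of P] in \<open>eventually_elim; simp\<close>)
  have "V (\<lambda>Q. form_eval d u Q / ?s Q * inverse (form_eval d v Q / ?s Q)) (form_eval d u P * inverse (form_eval d v P))"
    by (intro mult inverse form 1)
  hence "V (\<lambda>Q. form_eval d u Q / ?s Q * inverse (form_eval d v Q / ?s Q)) a"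
    by (simp add: 1(5) divide_inverse)
  thus ?thesis
  proof (rule cong)
    show "\<forall>\<^sub>F Q in generic. form_eval d u Q / ?s Q * inverse (form_eval d v Q / ?s Q) = f Q"
      using 1(4) eventually_yc_neq[of 0] by eventually_elim (auto simp: divide_inverse)
  qed
qed


text \<open>A uniformizer. Where the derivative with respect to y is nonzero, x is a local
  parameter; at the remaining affine points nonsingularity makes y one.\<close>

definition unif :: "'k ec_point \<Rightarrow> 'k ec_point \<Rightarrow> 'k" where
  "unif P Q = (if P = Infinity then xc Q / yc Q
     else if W\<^sub>y (xc P) (yc P) \<noteq> 0 then xc Q - xc P else yc Q - yc P)"

lemma eventually_unif_neq_0: "\<forall>\<^sub>F Q in generic. unif P Q \<noteq> 0"
  using eventually_xc_neq[of "xc P"] eventually_yc_neq[of "yc P"] eventually_xc_neq[of 0] eventually_yc_neq[of 0]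
  by eventually_elim (auto simp: unif_def)

lemma regular_xc: "P \<noteq> Infinity \<Longrightarrow> regular P xc (xc P)"
  using regular_chart1[of P] by (simp add: chart1_def[abs_def])

lemma regular_yc: "P \<noteq> Infinity \<Longrightarrow> regular P yc (yc P)"
  using regular_chart2[of P] by (simp add: chart2_def[abs_def])

lemma regular_unif:
  assumes "P \<in> ec_points E"
  shows "regular P (unif P) 0"
proof (cases "P = Infinity")
  case True
  thus ?thesis using regular_chart1[of P] by (simp add: chart1_def[abs_def] unif_def[abs_def])
next
  case False
  have "regular P (\<lambda>Q. xc Q - xc P) (xc P - xc P)" "regular P (\<lambda>Q. yc Q - yc P) (yc P - yc P)"
    by (intro regular_diff regular_xc regular_yc regular_const False assms)+
  thus ?thesis using False by (cases "W\<^sub>y (xc P) (yc P) = 0") (simp_all add: unif_def[abs_def])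
qed

text \<open>The difference of the curve equations at Q and P. Its two cofactors specialize at Q = P
  to \<open>W\<^sub>y\<close> and \<open>W\<^sub>x\<close>, so each of the two coordinate
  differences is the other one times a quotient that is regular where its denominator does not
  vanish.\<close>

lemma chord_identity:
  assumes "P \<in> ec_points E" "P \<noteq> Infinity" "Q \<in> ec_points E" "Q \<noteq> Infinity"
  shows "(yc Q - yc P) * (yc Q + yc P + a\<^sub>1 E * xc Q + a\<^sub>3 E) =
     (xc Q - xc P) * ((xc Q)\<^sup>2 + xc Q * xc P + (xc P)\<^sup>2 + a\<^sub>2 E * (xc Q + xc P) + a\<^sub>4 E - a\<^sub>1 E * yc P)"
proof -
  have "yc R * yc R + poly lin (xc R) * yc R - poly cubic (xc R) = 0" if "R \<in> {P, Q}" for R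
    using on_curve[of R] assms that by auto
  hence "(yc Q * yc Q + poly lin (xc Q) * yc Q - poly cubic (xc Q)) - (yc P * yc P + poly lin (xc P) * yc P - poly cubic (xc P)) = 0"
    by simp
  thus ?thesis
    by (simp add: poly_cubic poly_lin power2_eq_square power3_eq_cube algebra_simps)
qed

text \<open>In the coordinates u = x / y and w = 1 / y the curve equation reads w *
  \<open>unit_inf\<close> = u^3, and \<open>unit_inf\<close> has value 1 at infinity. Hence w has
  order 3 there.\<close>

definition unit_inf :: "'k ec_point \<Rightarrow> 'k" where
  "unit_inf Q = 1 + a\<^sub>1 E * (xc Q / yc Q) + a\<^sub>3 E * (1 / yc Q) - a\<^sub>2 E * (xc Q / yc Q)\<^sup>2
     - a\<^sub>4 E * ((xc Q / yc Q) * (1 / yc Q)) - a\<^sub>6 E * (1 / yc Q)\<^sup>2"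

lemma regular_unit_inf: "regular Infinity unit_inf 1"
proof -
  have w: "regular Infinity (\<lambda>Q. xc Q / yc Q) 0" "regular Infinity (\<lambda>Q. 1 / yc Q) 0"
    using regular_chart1[of Infinity] regular_chart2[of Infinity] by (simp_all add: chart1_def[abs_def] chart2_def[abs_def])
  have "regular Infinity unit_inf (1 + a\<^sub>1 E * 0 + a\<^sub>3 E * 0 - a\<^sub>2 E * 0\<^sup>2 - a\<^sub>4 E * (0 * 0) - a\<^sub>6 E * 0\<^sup>2)"
    unfolding unit_inf_def[abs_def]
    by (intro regular_diff regular_add regular_mult regular_power regular_const w Infinity_in)
  thus ?thesis by simp
qed

lemma unit_inf_identity: "\<forall>\<^sub>F Q in generic. (1 / yc Q) * unit_inf Q = (xc Q / yc Q) ^ 3"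
  using eventually_affine eventually_yc_neq[of 0]
proof eventually_elim
  case (elim Q)
  obtain x y where Q: "Q = Affine x y" using elim by (cases Q) auto
  have y: "y \<noteq> 0" using elim Q by simp
  have "(1 / y) * (1 + a\<^sub>1 E * (x / y) + a\<^sub>3 E * (1 / y) - a\<^sub>2 E * (x / y)\<^sup>2
     - a\<^sub>4 E * ((x / y) * (1 / y)) - a\<^sub>6 E * (1 / y)\<^sup>2) =
     (y\<^sup>2 + a\<^sub>1 E * x * y + a\<^sub>3 E * y - a\<^sub>2 E * x\<^sup>2 - a\<^sub>4 E * x - a\<^sub>6 E) / y ^ 3"
    using y by (simp add: field_simps power2_eq_square power3_eq_cube)
  also have "\<dots> = (x / y) ^ 3"
    using elim Q by (simp add: Affine_in_iff power_divide)
  finally show ?case using Q by (simp add: unit_inf_def)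
qed

lemma regular_chord:
  assumes "P \<in> ec_points E" "P \<noteq> Infinity"
  shows "regular P (\<lambda>Q. yc Q + yc P + a\<^sub>1 E * xc Q + a\<^sub>3 E) (W\<^sub>y (xc P) (yc P))"
    and "regular P (\<lambda>Q. (xc Q)\<^sup>2 + xc Q * xc P + (xc P)\<^sup>2 + a\<^sub>2 E * (xc Q + xc P) + a\<^sub>4 E - a\<^sub>1 E * yc P) (W\<^sub>x (xc P) (yc P))"
proof -
  have "regular P (\<lambda>Q. yc Q + yc P + a\<^sub>1 E * xc Q + a\<^sub>3 E) (yc P + yc P + a\<^sub>1 E * xc P + a\<^sub>3 E)"
    using assms by (intro regular_add regular_mult regular_const regular_xc regular_yc)
  thus "regular P (\<lambda>Q. yc Q + yc P + a\<^sub>1 E * xc Q + a\<^sub>3 E) (W\<^sub>y (xc P) (yc P))"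
    by (simp add: W\<^sub>y_def)
  have "regular P (\<lambda>Q. (xc Q)\<^sup>2 + xc Q * xc P + (xc P)\<^sup>2 + a\<^sub>2 E * (xc Q + xc P) + a\<^sub>4 E - a\<^sub>1 E * yc P)
     ((xc P)\<^sup>2 + xc P * xc P + (xc P)\<^sup>2 + a\<^sub>2 E * (xc P + xc P) + a\<^sub>4 E - a\<^sub>1 E * yc P)"
    using assms by (intro regular_diff regular_add regular_mult regular_const regular_xc regular_yc regular_power)
  thus "regular P (\<lambda>Q. (xc Q)\<^sup>2 + xc Q * xc P + (xc P)\<^sup>2 + a\<^sub>2 E * (xc Q + xc P) + a\<^sub>4 E - a\<^sub>1 E * yc P) (W\<^sub>x (xc P) (yc P))"
    by (simp add: W\<^sub>x_def power2_eq_square algebra_simps)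
qed

lemma W\<^sub>x_neq_0: "P \<in> ec_points E \<Longrightarrow> P \<noteq> Infinity \<Longrightarrow> W\<^sub>y (xc P) (yc P) = 0 \<Longrightarrow> W\<^sub>x (xc P) (yc P) \<noteq> 0"
  using nonsingular by (cases P) auto

text \<open>The maximal ideal at P is generated by \<open>unif P\<close>. On the coordinate that is
  not itself the uniformizer this comes from \<open>chord_identity\<close> at affine points and from
  \<open>unit_inf_identity\<close> at infinity.\<close>

lemma regular_decomp:
  assumes P: "P \<in> ec_points E" and "regular P f a"
  shows "\<exists>h b. regular P h b \<and> (\<forall>\<^sub>F Q in generic. f Q = a + unif P Q * h Q)"
proof -
  define V where "V f a \<longleftrightarrow> regular P f a \<and> (\<exists>h b. regular P h b \<and> (\<forall>\<^sub>F Q in generic. f Q = a + unif P Q * h Q))" for f a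
  have VI: "V f a" if "regular P f a" "regular P h b" "\<forall>\<^sub>F Q in generic. f Q = a + unif P Q * h Q" for f a h b
    using that unfolding V_def by blast
  have "V f a"
  proof (rule regular_induct[OF assms])
    fix f g a assume f: "V f a" and fg: "\<forall>\<^sub>F Q in generic. f Q = g Q"
    then obtain h b where h: "regular P h b" "\<forall>\<^sub>F Q in generic. f Q = a + unif P Q * h Q" unfolding V_def by blast
    have "\<forall>\<^sub>F Q in generic. g Q = a + unif P Q * h Q" using h(2) fg by eventually_elim simp
    thus "V g a" using f fg h(1) regular_cong VI unfolding V_def by blast
  next
    fix c show "V (\<lambda>_. c) c" by (rule VI[OF regular_const regular_const[of _ 0]]) simp
  next
    fix f a g b assume f: "V f a" and g: "V g b"
    then obtain h c where h: "regular P h c" "\<forall>\<^sub>F Q in generic. f Q = a + unif P Q * h Q" unfolding V_def by blast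
    obtain k d where k: "regular P k d" "\<forall>\<^sub>F Q in generic. g Q = b + unif P Q * k Q" using g unfolding V_def by blast
    have fg: "regular P f a" "regular P g b" using f g unfolding V_def by auto
    show "V (\<lambda>Q. f Q + g Q) (a + b)"
    proof (rule VI[OF regular_add[OF P fg] regular_add[OF P h(1) k(1)]])
      show "\<forall>\<^sub>F Q in generic. f Q + g Q = a + b + unif P Q * (h Q + k Q)"
        using h(2) k(2) by eventually_elim (simp add: algebra_simps)
    qed
    show "V (\<lambda>Q. f Q * g Q) (a * b)"
    proof (rule VI[OF regular_mult[OF fg] regular_add[OF P regular_mult[OF regular_const[of _ a] k(1)] regular_mult[OF h(1) fg(2)]]])
      show "\<forall>\<^sub>F Q in generic. f Q * g Q = a * b + unif P Q * (a * k Q + h Q * g Q)"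
        using h(2) k(2) by eventually_elim (simp add: algebra_simps)
    qed
  next
    fix f a assume f: "V f a" and a: "a \<noteq> 0"
    then obtain h c where h: "regular P h c" "\<forall>\<^sub>F Q in generic. f Q = a + unif P Q * h Q" unfolding V_def by blast
    have f': "regular P f a" using f unfolding V_def by auto
    show "V (\<lambda>Q. inverse (f Q)) (inverse a)"
    proof (rule VI[OF regular_inverse[OF f' a] regular_mult[OF regular_const[of _ "- inverse a"] regular_mult[OF h(1) regular_inverse[OF f' a]]]])
      show "\<forall>\<^sub>F Q in generic. inverse (f Q) = inverse a + unif P Q * (- inverse a * (h Q * inverse (f Q)))"
        using h(2) regular_eventually_neq_0[OF P f' a]
      proof eventually_elim
        case (elim Q)
        hence u: "unif P Q * h Q = f Q - a" by simp
        \<comment> \<open>With f = a + t h one has 1/f - 1/a = - t h / (a f).\<close>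
        have "unif P Q * (- inverse a * (h Q * inverse (f Q))) = - inverse a * (unif P Q * h Q) * inverse (f Q)"
          by simp
        also have "\<dots> = inverse (f Q) - inverse a"
          unfolding u using a elim(2) by (simp add: field_simps)
        finally show ?case by simp
      qed
    qed
  next
    have id: "V f a" if "regular P f a" "\<forall>\<^sub>F Q in generic. f Q = a + unif P Q" for f a
      using VI[OF that(1) regular_const[of _ 1]] that(2) by simp
    show "V (chart1 P) (xc P)"
    proof (cases "P \<noteq> Infinity \<and> W\<^sub>y (xc P) (yc P) = 0")
      case False
      show ?thesis by (rule id[OF regular_chart1]) (use False in \<open>auto simp: chart1_def unif_def\<close>)
    next
      case True
      note c = regular_chord[OF P conjunct1[OF True]]
      show ?thesis
      proof (rule VI[OF regular_chart1 regular_divide[OF c]])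
        show "W\<^sub>x (xc P) (yc P) \<noteq> 0" using W\<^sub>x_neq_0 P True by blast
        from regular_eventually_neq_0[OF P c(2) this] eventually_affine
        show "\<forall>\<^sub>F Q in generic. chart1 P Q = xc P + unif P Q * ((yc Q + yc P + a\<^sub>1 E * xc Q + a\<^sub>3 E) /
          ((xc Q)\<^sup>2 + xc Q * xc P + (xc P)\<^sup>2 + a\<^sub>2 E * (xc Q + xc P) + a\<^sub>4 E - a\<^sub>1 E * yc P))"
        proof eventually_elim
          case (elim Q)
          thus ?case using chord_identity[OF P conjunct1[OF True], of Q] True
            by (simp add: chart1_def unif_def)
        qed
      qed
    qed
    show "V (chart2 P) (yc P)"
    proof (cases "P = Infinity")
      case inf: True
      have "regular P (\<lambda>Q. (xc Q / yc Q)\<^sup>2 / unit_inf Q) (0\<^sup>2 / 1)"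
        using regular_unit_inf regular_chart1[of Infinity] inf
        by (intro regular_divide regular_power) (simp_all add: chart1_def[abs_def])
      moreover have "\<forall>\<^sub>F Q in generic. chart2 P Q = yc P + unif P Q * ((xc Q / yc Q)\<^sup>2 / unit_inf Q)"
        using unit_inf_identity regular_eventually_neq_0[OF Infinity_in regular_unit_inf one_neq_zero]
      proof eventually_elim
        case (elim Q)
        have "chart2 P Q = (xc Q / yc Q) ^ 3 / unit_inf Q"
          using elim(2) inf unfolding elim(1)[symmetric] by (simp add: chart2_def)
        thus ?case using inf by (simp add: unif_def power3_eq_cube power2_eq_square mult.assoc)
      qed
      ultimately show ?thesis by (rule VI[OF regular_chart2])
    next
      case aff: False
      show ?thesis
      proof (cases "W\<^sub>y (xc P) (yc P) = 0")
        case True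
        show ?thesis by (rule id[OF regular_chart2]) (use True aff in \<open>auto simp: chart2_def unif_def\<close>)
      next
        case False
        note c = regular_chord[OF P aff]
        show ?thesis
        proof (rule VI[OF regular_chart2 regular_divide[OF c(2,1) False]])
          from regular_eventually_neq_0[OF P c(1) False] eventually_affine
          show "\<forall>\<^sub>F Q in generic. chart2 P Q = yc P + unif P Q * (((xc Q)\<^sup>2 + xc Q * xc P + (xc P)\<^sup>2 + a\<^sub>2 E * (xc Q + xc P) + a\<^sub>4 E - a\<^sub>1 E * yc P) /
            (yc Q + yc P + a\<^sub>1 E * xc Q + a\<^sub>3 E))"
          proof eventually_elim
            case (elim Q)
            have "yc Q - yc P = (xc Q - xc P) * ((xc Q)\<^sup>2 + xc Q * xc P + (xc P)\<^sup>2 + a\<^sub>2 E * (xc Q + xc P) + a\<^sub>4 E - a\<^sub>1 E * yc P) /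
               (yc Q + yc P + a\<^sub>1 E * xc Q + a\<^sub>3 E)"
              using chord_identity[OF P aff, of Q] elim by (metis nonzero_mult_div_cancel_right)
            thus ?case using False aff by (simp add: chart2_def unif_def diff_eq_eq add.commute)
          qed
        qed
      qed
    qed
  qed
  thus ?thesis unfolding V_def by blast
qed

section \<open>Orders of vanishing relative to a uniformizer\<close>

definition has_ord :: "'k ec_point \<Rightarrow> ('k ec_point \<Rightarrow> 'k) \<Rightarrow> int \<Rightarrow> bool" where
  "has_ord P f n \<longleftrightarrow> (\<exists>u a. a \<noteq> 0 \<and> regular P u a \<and> (\<forall>\<^sub>F Q in generic. f Q = unif P Q powi n * u Q))"

lemma valI: "regular P u a \<Longrightarrow> a \<noteq> 0 \<Longrightarrow> \<forall>\<^sub>F Q in generic. f Q = unif P Q powi n * u Q \<Longrightarrow> has_ord P f n"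
  unfolding has_ord_def by blast

lemma has_ord_cong:
  assumes "has_ord P f n" "\<forall>\<^sub>F Q in generic. f Q = g Q"
  shows "has_ord P g n"
proof -
  obtain u a where u: "a \<noteq> 0" "regular P u a" "\<forall>\<^sub>F Q in generic. f Q = unif P Q powi n * u Q"
    using assms(1) unfolding has_ord_def by blast
  have "\<forall>\<^sub>F Q in generic. g Q = unif P Q powi n * u Q"
    using u(3) assms(2) by eventually_elim simp
  thus ?thesis using u valI by blast
qed

lemma has_ord_regular: "regular P f a \<Longrightarrow> a \<noteq> 0 \<Longrightarrow> has_ord P f 0"
  by (rule valI) auto

lemma has_ord_const: "c \<noteq> 0 \<Longrightarrow> has_ord P (\<lambda>_. c) 0"
  using has_ord_regular[OF regular_const] .

lemma has_ord_unif: "has_ord P (unif P) 1"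
  by (rule valI[OF regular_const[of _ 1]]) auto

lemma has_ord_mult:
  assumes "has_ord P f n" "has_ord P g m"
  shows "has_ord P (\<lambda>Q. f Q * g Q) (n + m)"
proof -
  obtain u a where u: "a \<noteq> 0" "regular P u a" "\<forall>\<^sub>F Q in generic. f Q = unif P Q powi n * u Q"
    using assms(1) unfolding has_ord_def by blast
  obtain v b where v: "b \<noteq> 0" "regular P v b" "\<forall>\<^sub>F Q in generic. g Q = unif P Q powi m * v Q"
    using assms(2) unfolding has_ord_def by blast
  show ?thesis
  proof (rule valI[OF regular_mult[OF u(2) v(2)]])
    show "\<forall>\<^sub>F Q in generic. f Q * g Q = unif P Q powi (n + m) * (u Q * v Q)"
      using u(3) v(3) eventually_unif_neq_0[of P] by eventually_elim (simp add: power_int_add)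
  qed (use u v in simp)
qed

lemma has_ord_inverse:
  assumes "has_ord P f n"
  shows "has_ord P (\<lambda>Q. inverse (f Q)) (- n)"
proof -
  obtain u a where u: "a \<noteq> 0" "regular P u a" "\<forall>\<^sub>F Q in generic. f Q = unif P Q powi n * u Q"
    using assms(1) unfolding has_ord_def by blast
  show ?thesis
  proof (rule valI[OF regular_inverse[OF u(2,1)]])
    show "\<forall>\<^sub>F Q in generic. inverse (f Q) = unif P Q powi (- n) * inverse (u Q)"
      using u(3) by eventually_elim (simp add: power_int_minus)
  qed (use u in simp)
qed

lemma has_ord_divide: "has_ord P f n \<Longrightarrow> has_ord P g m \<Longrightarrow> has_ord P (\<lambda>Q. f Q / g Q) (n - m)"
  using has_ord_mult[of P f n "\<lambda>Q. inverse (g Q)" "- m"] has_ord_inverse[of P g m] by (simp add: divide_inverse)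

lemma has_ord_power: "has_ord P f n \<Longrightarrow> has_ord P (\<lambda>Q. f Q ^ k) (int k * n)"
proof (induction k)
  case (Suc k)
  thus ?case using has_ord_mult[of P f n "\<lambda>Q. f Q ^ k" "int k * n"] by (simp add: algebra_simps)
qed (simp add: has_ord_const)

lemma has_ord_power_int:
  assumes "has_ord P f n"
  shows "has_ord P (\<lambda>Q. f Q powi k) (k * n)"
proof (cases "k \<ge> 0")
  case True
  thus ?thesis using has_ord_power[OF assms, of "nat k"] by (simp add: power_int_def)
next
  case False
  thus ?thesis using has_ord_inverse[OF has_ord_power[OF assms, of "nat (- k)"]] by (simp add: power_int_def power_inverse)
qed

lemma has_ord_eventually_neq_0:
  assumes "P \<in> ec_points E" "has_ord P f n"
  shows "\<forall>\<^sub>F Q in generic. f Q \<noteq> 0"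
proof -
  obtain u a where u: "a \<noteq> 0" "regular P u a" "\<forall>\<^sub>F Q in generic. f Q = unif P Q powi n * u Q"
    using assms(2) unfolding has_ord_def by blast
  from u(3) regular_eventually_neq_0[OF assms(1) u(2,1)] eventually_unif_neq_0[of P]
  show ?thesis by eventually_elim simp
qed

lemma has_ord_nonneg_regular:
  assumes P: "P \<in> ec_points E" and "has_ord P f n" "n \<ge> 0"
  shows "\<exists>a. regular P f a \<and> (a = 0 \<longleftrightarrow> n > 0)"
proof -
  obtain u a where u: "a \<noteq> 0" "regular P u a" "\<forall>\<^sub>F Q in generic. f Q = unif P Q powi n * u Q"
    using assms(2) unfolding has_ord_def by blast
  \<comment> \<open>The convention 0 ^ 0 = 1 gives the value a for n = 0 and the value 0 for n >
    0.\<close>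
  have "regular P (\<lambda>Q. unif P Q ^ nat n * u Q) (0 ^ nat n * a)"
    using regular_mult[OF regular_power[OF regular_unif[OF P], of "nat n"] u(2)] .
  moreover have "\<forall>\<^sub>F Q in generic. unif P Q ^ nat n * u Q = f Q"
    using u(3) by eventually_elim (use assms(3) in \<open>simp add: power_int_def\<close>)
  ultimately have "regular P f (0 ^ nat n * a)" using regular_cong by blast
  thus ?thesis using u(1) assms(3) by (intro exI[of _ "0 ^ nat n * a"]) auto
qed

text \<open>A regular function of negative order would have an inverse that vanishes at P, and then
  the constant 1 would have the value 0 there.\<close>

lemma regular_has_ord:
  assumes P: "P \<in> ec_points E" and "has_ord P f n" and f: "regular P f a"
  shows "n \<ge> 0 \<and> (a = 0 \<longleftrightarrow> n > 0)"
proof -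
  have "n \<ge> 0"
  proof (rule ccontr)
    assume "\<not> n \<ge> 0"
    hence "has_ord P (\<lambda>Q. inverse (f Q)) (- n)" "- n > 0" using has_ord_inverse[OF assms(2)] by auto
    then obtain b where b: "regular P (\<lambda>Q. inverse (f Q)) b" "b = 0"
      using has_ord_nonneg_regular[OF P, of _ "- n"] by auto
    have "regular P (\<lambda>Q. f Q * inverse (f Q)) (a * 0)" using regular_mult[OF f b(1)] b(2) by simp
    moreover have "\<forall>\<^sub>F Q in generic. f Q * inverse (f Q) = 1"
      using has_ord_eventually_neq_0[OF P assms(2)] by eventually_elim simp
    ultimately have "regular P (\<lambda>_. 1) 0" using regular_cong by force
    thus False using regular_unique[OF P _ regular_const[of P 1]] by fastforce
  qed
  thus ?thesis using has_ord_nonneg_regular[OF P assms(2)] regular_unique[OF P f] by blast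
qed

lemma has_ord_unique:
  assumes P: "P \<in> ec_points E" and "has_ord P f n" "has_ord P f m"
  shows "n = m"
proof -
  have "has_ord P (\<lambda>Q. f Q / f Q) (n - m)" using has_ord_divide assms by blast
  moreover have "\<forall>\<^sub>F Q in generic. f Q / f Q = 1"
    using has_ord_eventually_neq_0[OF assms(1,2)] by eventually_elim simp
  ultimately have "has_ord P (\<lambda>_. 1) (n - m)" using has_ord_cong by force
  hence "n - m \<ge> 0 \<and> \<not> n - m > 0" using regular_has_ord[OF P _ regular_const[of P 1]] by force
  thus ?thesis by simp
qed

lemma has_ord_add_less:
  assumes P: "P \<in> ec_points E" and "has_ord P f n" "has_ord P g m" "n < m"
  shows "has_ord P (\<lambda>Q. f Q + g Q) n"
proof -
  obtain u a where u: "a \<noteq> 0" "regular P u a" "\<forall>\<^sub>F Q in generic. f Q = unif P Q powi n * u Q"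
    using assms(2) unfolding has_ord_def by blast
  obtain v b where v: "b \<noteq> 0" "regular P v b" "\<forall>\<^sub>F Q in generic. g Q = unif P Q powi m * v Q"
    using assms(3) unfolding has_ord_def by blast
  let ?k = "nat (m - n)"
  have k: "?k > 0" "m = n + int ?k" using assms(4) by auto
  have "regular P (\<lambda>Q. u Q + unif P Q ^ ?k * v Q) (a + 0 ^ ?k * b)"
    by (intro regular_add[OF P] regular_mult regular_power regular_unif u v P)
  moreover have "a + 0 ^ ?k * b \<noteq> 0" using u(1) k(1) by (metis add.right_neutral mult_zero_left zero_power)
  moreover have "\<forall>\<^sub>F Q in generic. f Q + g Q = unif P Q powi n * (u Q + unif P Q ^ ?k * v Q)"
    using u(3) v(3) eventually_unif_neq_0[of P]
  proof eventually_elim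
    case (elim Q)
    have "unif P Q powi m = unif P Q powi n * unif P Q ^ ?k"
      using elim(3) power_int_add[of "unif P Q" n "int ?k"] k(2) by (metis power_int_of_nat)
    thus ?case using elim by (simp add: algebra_simps)
  qed
  ultimately show ?thesis by (rule valI)
qed

text \<open>Whenever f vanishes at P, a uniformizer splits off from f and the order of the product
  drops by one; after at most n such steps f has become a unit. This is how a + b y gets an order
  from that of its norm.\<close>

lemma has_ord_factor:
  assumes P: "P \<in> ec_points E"
  shows "regular P f a \<Longrightarrow> regular P g b \<Longrightarrow> has_ord P (\<lambda>Q. f Q * g Q) (int n) \<Longrightarrow> \<exists>k. has_ord P f k"
proof (induction n arbitrary: f a)
  case 0
  have "a * b \<noteq> 0" using regular_has_ord[OF P 0(3) regular_mult[OF 0(1,2)]] by simp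
  thus ?case using has_ord_regular[OF 0(1)] by auto
next
  case (Suc n)
  show ?case
  proof (cases "a = 0")
    case True
    obtain h c where h: "regular P h c" "\<forall>\<^sub>F Q in generic. f Q = a + unif P Q * h Q"
      using regular_decomp[OF P Suc.prems(1)] by blast
    have "has_ord P (\<lambda>Q. f Q * g Q / unif P Q) (int (Suc n) - 1)"
      by (intro has_ord_divide Suc.prems has_ord_unif)
    moreover have "\<forall>\<^sub>F Q in generic. f Q * g Q / unif P Q = h Q * g Q"
      using h(2) eventually_unif_neq_0[of P] by eventually_elim (simp add: True)
    ultimately have "has_ord P (\<lambda>Q. h Q * g Q) (int n)" using has_ord_cong by fastforce
    then obtain k where "has_ord P h k" using Suc.IH[OF h(1) Suc.prems(2)] by blast
    hence "has_ord P (\<lambda>Q. unif P Q * h Q) (1 + k)" by (rule has_ord_mult[OF has_ord_unif])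
    moreover have "\<forall>\<^sub>F Q in generic. unif P Q * h Q = f Q"
      using h(2) by eventually_elim (simp add: True)
    ultimately show ?thesis using has_ord_cong by blast
  next
    case False
    thus ?thesis using has_ord_regular[OF Suc.prems(1)] by blast
  qed
qed

end

section \<open>The function field and orders of vanishing\<close>

context elliptic
begin

lemma polyfun_poly: "polyfun (2 * Polynomial.degree c) (\<lambda>Q. poly c (xc Q))"
  unfolding polyfun_def by (intro exI[of _ c] exI[of _ 0]) (simp add: coordfun_def)

text \<open>Denominators can be taken in x alone, because multiplication by the conjugate turns a
  denominator a + b y into its norm.\<close>

definition ratfun :: "('k ec_point \<Rightarrow> 'k) \<Rightarrow> bool" where
  "ratfun f \<longleftrightarrow> (\<exists>n g c. polyfun n g \<and> c \<noteq> 0 \<and> (\<forall>\<^sub>F Q in generic. f Q = g Q / poly c (xc Q)))"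

lemma ffI: "polyfun n g \<Longrightarrow> c \<noteq> 0 \<Longrightarrow> \<forall>\<^sub>F Q in generic. f Q = g Q / poly c (xc Q) \<Longrightarrow> ratfun f"
  unfolding ratfun_def by blast

lemma ratfun_cong:
  assumes "ratfun f" "\<forall>\<^sub>F Q in generic. f Q = g Q"
  shows "ratfun g"
proof -
  obtain n f1 c where f: "polyfun n f1" "c \<noteq> 0" "\<forall>\<^sub>F Q in generic. f Q = f1 Q / poly c (xc Q)"
    using assms(1) unfolding ratfun_def by blast
  from f(3) assms(2) have "\<forall>\<^sub>F Q in generic. g Q = f1 Q / poly c (xc Q)" by eventually_elim simp
  thus ?thesis by (rule ffI[OF f(1,2)])
qed

lemma ratfun_polyfun: "polyfun n f \<Longrightarrow> ratfun f"
  by (rule ffI[of n f 1]) auto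

lemma ratfun_const: "ratfun (\<lambda>_. c)" by (rule ratfun_polyfun[OF polyfun_const])
lemma ratfun_xc: "ratfun xc" by (rule ratfun_polyfun[OF polyfun_xc])
lemma ratfun_yc: "ratfun yc" by (rule ratfun_polyfun[OF polyfun_yc])

lemma ratfun_mult:
  assumes "ratfun f" "ratfun g"
  shows "ratfun (\<lambda>Q. f Q * g Q)"
proof -
  obtain n f1 c where f: "polyfun n f1" "c \<noteq> 0" "\<forall>\<^sub>F Q in generic. f Q = f1 Q / poly c (xc Q)"
    using assms(1) unfolding ratfun_def by blast
  obtain m g1 d where g: "polyfun m g1" "d \<noteq> 0" "\<forall>\<^sub>F Q in generic. g Q = g1 Q / poly d (xc Q)"
    using assms(2) unfolding ratfun_def by blast
  show ?thesis
  proof (rule ffI[OF polyfun_mult[OF f(1) g(1)]])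
    show "\<forall>\<^sub>F Q in generic. f Q * g Q = f1 Q * g1 Q / poly (c * d) (xc Q)"
      using f(3) g(3) by eventually_elim simp
  qed (use f g in simp)
qed

lemma ratfun_add:
  assumes "ratfun f" "ratfun g"
  shows "ratfun (\<lambda>Q. f Q + g Q)"
proof -
  obtain n f1 c where f: "polyfun n f1" "c \<noteq> 0" "\<forall>\<^sub>F Q in generic. f Q = f1 Q / poly c (xc Q)"
    using assms(1) unfolding ratfun_def by blast
  obtain m g1 d where g: "polyfun m g1" "d \<noteq> 0" "\<forall>\<^sub>F Q in generic. g Q = g1 Q / poly d (xc Q)"
    using assms(2) unfolding ratfun_def by blast
  let ?N = "n + m + 2 * Polynomial.degree c + 2 * Polynomial.degree d"
  have "polyfun ?N (\<lambda>Q. f1 Q * poly d (xc Q) + g1 Q * poly c (xc Q))"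
    by (intro polyfun_add; rule polyfun_mono[OF polyfun_mult[OF _ polyfun_poly]], fact, simp)
  thus ?thesis
  proof (rule ffI)
    show "\<forall>\<^sub>F Q in generic. f Q + g Q = (f1 Q * poly d (xc Q) + g1 Q * poly c (xc Q)) / poly (c * d) (xc Q)"
      using f(3) g(3) eventually_poly_neq_0[OF f(2)] eventually_poly_neq_0[OF g(2)]
      by eventually_elim (simp add: add_frac_eq)
  qed (use f g in simp)
qed

lemma ratfun_minus: "ratfun f \<Longrightarrow> ratfun (\<lambda>Q. - f Q)"
  using ratfun_mult[OF ratfun_const[of "-1"], of f] by simp

lemma ratfun_diff: "ratfun f \<Longrightarrow> ratfun g \<Longrightarrow> ratfun (\<lambda>Q. f Q - g Q)"
  using ratfun_add[OF _ ratfun_minus, of f g] by simp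

lemma ratfun_power: "ratfun f \<Longrightarrow> ratfun (\<lambda>Q. f Q ^ n)"
  by (induction n) (auto intro: ratfun_const ratfun_mult)

lemma polyfun_conj:
  assumes "polyfun n f"
  shows "\<exists>m. polyfun m (\<lambda>Q. f (ec_neg E Q))"
proof -
  obtain a b where ab: "\<forall>Q\<in>ec_points E - {Infinity}. f Q = coordfun a b Q"
    using assms unfolding polyfun_def by blast
  have "polyfun (2 * Polynomial.degree (a - lin * b) + 2 * Polynomial.degree b + 3) (\<lambda>Q. f (ec_neg E Q))"
    unfolding polyfun_def
    by (intro exI[of _ "a - lin * b"] exI[of _ "- b"]) (use ab in \<open>auto simp: coordfun_def yc_neg algebra_simps\<close>)
  thus ?thesis ..
qed

lemma ratfun_cases:
  assumes "ratfun f"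
  shows "(\<forall>\<^sub>F Q in generic. f Q = 0) \<or> (\<forall>\<^sub>F Q in generic. f Q \<noteq> 0)"
proof -
  obtain n f1 c where f: "polyfun n f1" "c \<noteq> 0" "\<forall>\<^sub>F Q in generic. f Q = f1 Q / poly c (xc Q)"
    using assms(1) unfolding ratfun_def by blast
  consider "\<forall>Q\<in>ec_points E - {Infinity}. f1 Q = 0" | "\<forall>\<^sub>F Q in generic. f1 Q \<noteq> 0" using polyfun_cases[OF f(1)] by blast
  thus ?thesis
  proof cases
    case 1
    have "\<forall>\<^sub>F Q in generic. f Q = 0"
      using f(3) eventually_affine by eventually_elim (use 1 in simp)
    thus ?thesis ..
  next
    case 2
    have "\<forall>\<^sub>F Q in generic. f Q \<noteq> 0"
      using f(3) 2 eventually_poly_neq_0[OF f(2)] by eventually_elim simp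
    thus ?thesis ..
  qed
qed

lemma ratfun_inverse:
  assumes "ratfun f"
  shows "ratfun (\<lambda>Q. inverse (f Q))"
proof -
  obtain n f1 c where f: "polyfun n f1" "c \<noteq> 0" "\<forall>\<^sub>F Q in generic. f Q = f1 Q / poly c (xc Q)"
    using assms(1) unfolding ratfun_def by blast
  obtain a b where ab: "\<forall>Q\<in>ec_points E - {Infinity}. f1 Q = coordfun a b Q"
    using f(1) unfolding polyfun_def by blast
  obtain m where m: "polyfun m (\<lambda>Q. f1 (ec_neg E Q))" using polyfun_conj[OF f(1)] by blast
  show ?thesis
  proof (cases "a = 0 \<and> b = 0")
    case True
    have "\<forall>\<^sub>F Q in generic. 0 = inverse (f Q)"
      using f(3) eventually_affine by eventually_elim (use ab True in \<open>simp add: coordfun_def\<close>)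
    thus ?thesis by (rule ratfun_cong[OF ratfun_const[of 0]])
  next
    case False
    hence N: "pnorm a b \<noteq> 0" using pnorm_eq_0 by blast
    show ?thesis
    proof (rule ffI[OF polyfun_mult[OF polyfun_poly[of c] m] N])
      show "\<forall>\<^sub>F Q in generic. inverse (f Q) = poly c (xc Q) * f1 (ec_neg E Q) / poly (pnorm a b) (xc Q)"
        using f(3) eventually_affine eventually_poly_neq_0[OF N]
      proof eventually_elim
        case (elim Q)
        have "f1 Q * f1 (ec_neg E Q) = poly (pnorm a b) (xc Q)"
          using coordfun_mult_conj[of Q a b] ab elim by simp
        moreover from this elim(3) have "f1 Q \<noteq> 0" by auto
        ultimately show ?case using elim by (simp add: frac_eq_eq) (simp add: mult_ac)
      qed
    qed
  qed
qed

lemma ratfun_divide: "ratfun f \<Longrightarrow> ratfun g \<Longrightarrow> ratfun (\<lambda>Q. f Q / g Q)"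
  using ratfun_mult[OF _ ratfun_inverse, of f g] by (simp add: divide_inverse)

lemma ratfun_poly: "ratfun f \<Longrightarrow> ratfun (\<lambda>Q. poly p (f Q))"
proof (induction p)
  case (pCons a p)
  thus ?case using ratfun_add[OF ratfun_const[of a] ratfun_mult[of f "\<lambda>Q. poly p (f Q)"]] by simp
qed (simp add: ratfun_const)

lemma ratfun_form: "is_form d u \<Longrightarrow> ratfun (form_eval d u)"
  using ratfun_polyfun[OF polyfun_form] .

lemma regular_ratfun:
  assumes "regular P f a"
  shows "ratfun f"
proof -
  obtain d u v where 1: "is_form d u" "is_form d v" "\<forall>\<^sub>F Q in generic. f Q = form_eval d u Q / form_eval d v Q"
    using assms unfolding regular_def by blast
  from 1(3) have "\<forall>\<^sub>F Q in generic. form_eval d u Q / form_eval d v Q = f Q" by eventually_elim simp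
  thus ?thesis by (rule ratfun_cong[OF ratfun_divide[OF ratfun_form[OF 1(1)] ratfun_form[OF 1(2)]]])
qed

lemma form_eval_coordfun: "Q \<noteq> Infinity \<Longrightarrow> form_eval d [:a, b:] Q = coordfun a b Q"
  by (cases Q) (auto simp: coordfun_def)

lemma is_form_pair:
  fixes a b :: "'k poly"
  shows "is_form (Polynomial.degree a + Polynomial.degree b + 1) [:a, b:]"
proof -
  have "i \<le> Polynomial.degree p" if "Polynomial.coeff p i \<noteq> 0" for p :: "'k poly" and i
    using that by (rule le_degree)
  from this[of a] this[of b] show ?thesis
    unfolding is_form_def by (fastforce simp: coeff_pCons split: nat.splits)
qed

lemma is_form_mono: "is_form d u \<Longrightarrow> d \<le> e \<Longrightarrow> is_form e u"
  unfolding is_form_def using le_trans by blast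

lemma function_field_iff: "f \<in> function_field E \<longleftrightarrow> ratfun f"
proof
  assume "f \<in> function_field E"
  then obtain d u v where "is_form d u" "is_form d v" "\<forall>\<^sub>F Q in generic. f Q = form_eval d u Q / form_eval d v Q"
    unfolding function_field_def ae_eq_iff by blast
  moreover from this(3) have "\<forall>\<^sub>F Q in generic. form_eval d u Q / form_eval d v Q = f Q" by eventually_elim simp
  ultimately show "ratfun f" using ratfun_cong[OF ratfun_divide[OF ratfun_form ratfun_form]] by blast
next
  assume "ratfun f"
  then obtain n g c where g: "polyfun n g" "c \<noteq> 0" "\<forall>\<^sub>F Q in generic. f Q = g Q / poly c (xc Q)"
    unfolding ratfun_def by blast
  obtain a b where ab: "\<forall>Q\<in>ec_points E - {Infinity}. g Q = coordfun a b Q"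
    using g(1) unfolding polyfun_def by blast
  \<comment> \<open>One degree large enough for both forms. The denominator c is written
    \<open>[:c, 0:]\<close>, the shape a + b y with b = 0, so that the same lemmas serve for
    both.\<close>
  define d where "d = (Polynomial.degree a + Polynomial.degree b + 1) + (Polynomial.degree c + Polynomial.degree (0::'k poly) + 1)"
  have "is_form d [:a, b:]" "is_form d [:c, 0:]"
    unfolding d_def by (rule is_form_mono[OF is_form_pair], simp)+
  moreover have "\<exists>Q\<in>ec_points E. form_eval d [:c, 0:] Q \<noteq> 0"
  proof -
    have "\<forall>\<^sub>F Q in generic. Q \<in> ec_points E \<and> form_eval d [:c, 0:] Q \<noteq> 0"
      using eventually_affine eventually_poly_neq_0[OF g(2)]
      by eventually_elim (simp add: form_eval_coordfun coordfun_def del: pCons_0_0)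
    thus ?thesis using eventually_generic_ex by blast
  qed
  moreover have "\<forall>\<^sub>F Q in generic. f Q = form_eval d [:a, b:] Q / form_eval d [:c, 0:] Q"
    using g(3) eventually_affine
    by eventually_elim (use ab in \<open>simp add: form_eval_coordfun coordfun_def del: pCons_0_0\<close>)
  ultimately show "f \<in> function_field E"
    unfolding function_field_def ae_eq_iff by blast
qed

lemma has_ord_xc_inf: "has_ord Infinity (\<lambda>Q. xc Q - c) (-2)" and has_ord_yc_inf: "has_ord Infinity yc (-3)"
proof -
  have w: "regular Infinity (\<lambda>Q. xc Q / yc Q) 0"
    using regular_chart1[of Infinity] by (simp add: chart1_def[abs_def])
  \<comment> \<open>With u = x / y, the identity u^2 x = \<open>unit_inf\<close> gives u^2 (x - c) =
    \<open>unit_inf\<close> - c u^2, a unit with value 1. Likewise u^3 y = \<open>unit_inf\<close>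
    below.\<close>
  have u: "regular Infinity (\<lambda>Q. unit_inf Q - c * (xc Q / yc Q)\<^sup>2) (1 - c * 0\<^sup>2)"
    by (intro regular_diff regular_unit_inf regular_mult regular_const regular_power w Infinity_in)
  show "has_ord Infinity (\<lambda>Q. xc Q - c) (-2)"
  proof (rule valI[OF u])
    show "\<forall>\<^sub>F Q in generic. xc Q - c = unif Infinity Q powi - 2 * (unit_inf Q - c * (xc Q / yc Q)\<^sup>2)"
      using unit_inf_identity eventually_xc_neq[of 0] eventually_yc_neq[of 0]
    proof eventually_elim
      case (elim Q)
      have u: "unit_inf Q = xc Q * (xc Q / yc Q)\<^sup>2"
        using elim by (simp add: field_simps power2_eq_square power3_eq_cube)
      have "unif Infinity Q powi - 2 = 1 / (xc Q / yc Q)\<^sup>2"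
        by (simp add: unif_def power_int_minus divide_inverse)
      thus ?case unfolding u left_diff_distrib[symmetric] using elim by simp
    qed
  qed simp
  show "has_ord Infinity yc (-3)"
  proof (rule valI[OF regular_unit_inf])
    show "\<forall>\<^sub>F Q in generic. yc Q = unif Infinity Q powi - 3 * unit_inf Q"
      using unit_inf_identity eventually_xc_neq[of 0] eventually_yc_neq[of 0]
    proof eventually_elim
      case (elim Q)
      have u: "unit_inf Q = yc Q * (xc Q / yc Q) ^ 3"
        using elim(1)[symmetric] elim(3) by simp
      have "unif Infinity Q powi - 3 = 1 / (xc Q / yc Q) ^ 3"
        by (simp add: unif_def power_int_minus divide_inverse)
      thus ?case unfolding u using elim by simp
    qed
  qed simp
qed

lemma neg_eq_self_iff: "P \<noteq> Infinity \<Longrightarrow> ec_neg E P = P \<longleftrightarrow> W\<^sub>y (xc P) (yc P) = 0"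
proof -
  have "- y - s - t = y \<longleftrightarrow> 2 * y + s + t = 0" for y s t :: 'k
    using eq_iff_diff_eq_0[of y "- y - s - t"] by (auto simp: algebra_simps)
  moreover assume "P \<noteq> Infinity"
  ultimately show ?thesis by (cases P) (simp_all add: W\<^sub>y_def)
qed

lemma has_ord_xc_affine:
  assumes P: "P \<in> ec_points E" "P \<noteq> Infinity" and A: "A \<in> ec_points E" "A \<noteq> Infinity"
  shows "has_ord P (\<lambda>Q. xc Q - xc A) (of_bool (P = A) + of_bool (P = ec_neg E A))"
proof (cases "xc P = xc A")
  case False
  have "regular P (\<lambda>Q. xc Q - xc A) (xc P - xc A)" by (intro regular_diff regular_xc regular_const P)
  hence "has_ord P (\<lambda>Q. xc Q - xc A) 0" by (rule has_ord_regular) (use False in simp)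
  moreover have "P \<noteq> A" "P \<noteq> ec_neg E A" using False by auto
  ultimately show ?thesis by simp
next
  case True
  have PA: "P = A \<or> P = ec_neg E A" using same_xc[OF A(1) P(1) A(2) P(2)] True by simp
  show ?thesis
  proof (cases "W\<^sub>y (xc P) (yc P) = 0")
    case False
    hence "ec_neg E P \<noteq> P" using neg_eq_self_iff P by blast
    hence "of_bool (P = A) + of_bool (P = ec_neg E A) = (1::int)" using PA by auto
    moreover have "unif P = (\<lambda>Q. xc Q - xc A)" using False P True by (simp add: unif_def[abs_def])
    ultimately show ?thesis using has_ord_unif[of P] by simp
  next
    case wy: True
    hence "ec_neg E P = P" using neg_eq_self_iff P by blast
    hence "of_bool (P = A) + of_bool (P = ec_neg E A) = (2::int)" using PA by auto
    moreover have "has_ord P (\<lambda>Q. xc Q - xc A) 2"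
    proof -
      note c = regular_chord[OF P]
      have wx: "W\<^sub>x (xc P) (yc P) \<noteq> 0" using W\<^sub>x_neq_0 P wy by blast
      let ?D = "\<lambda>Q. (xc Q)\<^sup>2 + xc Q * xc P + (xc P)\<^sup>2 + a\<^sub>2 E * (xc Q + xc P) + a\<^sub>4 E - a\<^sub>1 E * yc P"
      let ?C = "\<lambda>Q. yc Q + yc P + a\<^sub>1 E * xc Q + a\<^sub>3 E"
      have "regular P (\<lambda>Q. (1 + a\<^sub>1 E * (?C Q / ?D Q)) / ?D Q) ((1 + a\<^sub>1 E * (W\<^sub>y (xc P) (yc P) / W\<^sub>x (xc P) (yc P))) / W\<^sub>x (xc P) (yc P))"
        by (intro regular_divide regular_add regular_mult regular_const c P wx)
      moreover have "(1 + a\<^sub>1 E * (W\<^sub>y (xc P) (yc P) / W\<^sub>x (xc P) (yc P))) / W\<^sub>x (xc P) (yc P) \<noteq> 0"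
        using wx wy by simp
      moreover have "\<forall>\<^sub>F Q in generic. xc Q - xc A = unif P Q powi 2 * ((1 + a\<^sub>1 E * (?C Q / ?D Q)) / ?D Q)"
        using eventually_affine regular_eventually_neq_0[OF P(1) c(2) wx]
      proof eventually_elim
        case (elim Q)
        define D where "D = ?D Q"
        have D: "D \<noteq> 0" using elim by (simp add: D_def)
        have x: "xc Q - xc P = (yc Q - yc P) * ?C Q / D"
          using chord_identity[OF P, of Q] elim D unfolding D_def by simp
        \<comment> \<open>Since \<open>W\<^sub>y\<close> = 0, the cofactor \<open>?C\<close>
          vanishes at P too and contributes the second factor y - y(P): the vertical line is tangent
          here.\<close>
        have "?C Q = (yc Q - yc P) + a\<^sub>1 E * (xc Q - xc P) + W\<^sub>y (xc P) (yc P)"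
          by (simp add: W\<^sub>y_def algebra_simps)
        also have "\<dots> = (yc Q - yc P) * (1 + a\<^sub>1 E * (?C Q / D))"
          by (subst x) (simp add: wy algebra_simps)
        finally have "xc Q - xc P = (yc Q - yc P) * ((yc Q - yc P) * (1 + a\<^sub>1 E * (?C Q / D))) / D"
          using x by simp
        thus ?case using True wy P by (simp add: unif_def D_def power2_eq_square)
      qed
      ultimately show ?thesis by (rule valI)
    qed
    ultimately show ?thesis by simp
  qed
qed

lemma has_ord_xc_minus:
  assumes P: "P \<in> ec_points E" and A: "A \<in> ec_points E" "A \<noteq> Infinity"
  shows "has_ord P (\<lambda>Q. xc Q - xc A) (of_bool (P = A) + of_bool (P = ec_neg E A) - 2 * of_bool (P = Infinity))"
proof (cases "P = Infinity")
  case True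
  have "P \<noteq> A" "P \<noteq> ec_neg E A" using True A(2) ec_neg_eq_Infinity by metis+
  thus ?thesis using has_ord_xc_inf[of "xc A"] True by simp
qed (use has_ord_xc_affine[OF P _ A] in simp)

lemma has_ord_poly_xc:
  assumes P: "P \<in> ec_points E"
  shows "c \<noteq> 0 \<Longrightarrow> \<exists>n. has_ord P (\<lambda>Q. poly c (xc Q)) n \<and> (P = Infinity \<longrightarrow> n = - 2 * int (Polynomial.degree c))"
proof (induction "Polynomial.degree c" arbitrary: c)
  case 0
  then obtain k where "c = [:k:]" by (metis degree_eq_zeroE)
  thus ?case using 0 has_ord_const[of k P] by auto
next
  case (Suc d)
  obtain r where "poly c r = 0" using alg_closed_imp_poly_has_root[of c] Suc(2) by auto
  then obtain q where q: "c = [:- r, 1:] * q" using poly_eq_0_iff_dvd by (metis dvdE)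
  have q0: "q \<noteq> 0" using q Suc(3) by auto
  hence deg: "Polynomial.degree c = Suc (Polynomial.degree q)" unfolding q by (subst degree_mult_eq) auto
  obtain n where n: "has_ord P (\<lambda>Q. poly q (xc Q)) n" "P = Infinity \<longrightarrow> n = - 2 * int (Polynomial.degree q)"
    using Suc(1)[of q] deg q0 Suc(2) by auto
  obtain y where y: "Affine r y \<in> ec_points E" using ex_point by blast
  have "has_ord P (\<lambda>Q. (xc Q - r) * poly q (xc Q))
     ((of_bool (P = Affine r y) + of_bool (P = ec_neg E (Affine r y)) - 2 * of_bool (P = Infinity)) + n)"
    using has_ord_mult[OF has_ord_xc_minus[OF P y] n(1)] by simp
  moreover have "(\<lambda>Q. (xc Q - r) * poly q (xc Q)) = (\<lambda>Q. poly c (xc Q))" by (auto simp: q algebra_simps)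
  moreover have "P = Infinity \<longrightarrow> (of_bool (P = Affine r y) + of_bool (P = ec_neg E (Affine r y)) - 2 * of_bool (P = Infinity)) + n = - 2 * int (Polynomial.degree c)"
    using n(2) deg by auto
  ultimately show ?case by metis
qed

text \<open>The order of a(x) at infinity is even and that of b(x) y is odd, so the two summands
  cannot cancel.\<close>

lemma has_ord_coordfun_inf:
  assumes "a \<noteq> 0 \<or> b \<noteq> 0"
  shows "has_ord Infinity (coordfun a b) (- max (if a = 0 then 0 else 2 * int (Polynomial.degree a)) (if b = 0 then 0 else 2 * int (Polynomial.degree b) + 3))"
proof -
  have a: "has_ord Infinity (\<lambda>Q. poly a (xc Q)) (- 2 * int (Polynomial.degree a))" if "a \<noteq> 0"
    using has_ord_poly_xc[OF Infinity_in that] by blast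
  have b: "has_ord Infinity (\<lambda>Q. poly b (xc Q) * yc Q) (- 2 * int (Polynomial.degree b) + - 3)" if "b \<noteq> 0"
    by (rule has_ord_mult[OF _ has_ord_yc_inf]) (use has_ord_poly_xc[OF Infinity_in that] in blast)
  consider "a = 0" "b \<noteq> 0" | "a \<noteq> 0" "b = 0" | "a \<noteq> 0" "b \<noteq> 0" using assms by blast
  thus ?thesis
  proof cases
    case 3
    show ?thesis
    proof (cases "2 * int (Polynomial.degree a) < 2 * int (Polynomial.degree b) + 3")
      case True
      have "has_ord Infinity (\<lambda>Q. poly b (xc Q) * yc Q + poly a (xc Q)) (- 2 * int (Polynomial.degree b) + - 3)"
        by (rule has_ord_add_less[OF Infinity_in b a]) (use 3 True in auto)
      thus ?thesis using 3 True by (simp add: coordfun_def[abs_def] add.commute)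
    next
      case False
      hence "2 * int (Polynomial.degree b) + 3 < 2 * int (Polynomial.degree a)" by presburger
      hence "has_ord Infinity (\<lambda>Q. poly a (xc Q) + poly b (xc Q) * yc Q) (- 2 * int (Polynomial.degree a))"
        by (intro has_ord_add_less[OF Infinity_in a b]) (use 3 in auto)
      thus ?thesis using 3 False by (simp add: coordfun_def[abs_def] add.commute)
    qed
  qed (use a b in \<open>simp_all add: coordfun_def[abs_def]\<close>)
qed

lemma regular_poly: "P \<in> ec_points E \<Longrightarrow> regular P f a \<Longrightarrow> regular P (\<lambda>Q. poly p (f Q)) (poly p a)"
proof (induction p)
  case (pCons c p)
  thus ?case using regular_add[OF _ regular_const[of _ c] regular_mult[of P f a "\<lambda>Q. poly p (f Q)"]] by simp
qed (use regular_const[of P 0] in simp)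

lemma regular_coordfun: "P \<in> ec_points E \<Longrightarrow> P \<noteq> Infinity \<Longrightarrow> regular P (coordfun a b) (coordfun a b P)"
  unfolding coordfun_def[abs_def] by (intro regular_add regular_mult regular_poly regular_xc regular_yc)

text \<open>A polynomial function divides its norm, which is a polynomial in \<open>x\<close> alone.\<close>
lemma has_ord_coordfun:
  assumes P: "P \<in> ec_points E" and ab: "a \<noteq> 0 \<or> b \<noteq> 0"
  shows "\<exists>n. has_ord P (coordfun a b) n"
proof (cases "P = Infinity")
  case False
  have N: "pnorm a b \<noteq> 0" using ab pnorm_eq_0 by blast
  obtain n where n: "has_ord P (\<lambda>Q. poly (pnorm a b) (xc Q)) n" using has_ord_poly_xc[OF P N] by blast
  have n0: "n \<ge> 0" using regular_has_ord[OF P n regular_poly[OF P regular_xc[OF False]]] by blast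
  have "\<forall>\<^sub>F Q in generic. poly (pnorm a b) (xc Q) = coordfun a b Q * coordfun (a - lin * b) (- b) Q"
    using eventually_affine
  proof eventually_elim
    case (elim Q)
    have "coordfun (a - lin * b) (- b) Q = coordfun a b (ec_neg E Q)"
      using elim by (auto simp: coordfun_def yc_neg algebra_simps)
    thus ?case using coordfun_mult_conj[of Q a b] elim by simp
  qed
  hence "has_ord P (\<lambda>Q. coordfun a b Q * coordfun (a - lin * b) (- b) Q) (int (nat n))"
    using has_ord_cong[OF n] n0 by simp
  thus ?thesis using has_ord_factor[OF P regular_coordfun regular_coordfun] P False by blast
qed (use has_ord_coordfun_inf[OF ab] in auto)

lemma ratfun_has_ord:
  assumes P: "P \<in> ec_points E" and f: "ratfun f" "\<not> (\<forall>\<^sub>F Q in generic. f Q = 0)"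
  shows "\<exists>n. has_ord P f n"
proof -
  obtain n g c where g: "polyfun n g" "c \<noteq> 0" "\<forall>\<^sub>F Q in generic. f Q = g Q / poly c (xc Q)"
    using f(1) unfolding ratfun_def by blast
  obtain a b where ab: "\<forall>Q\<in>ec_points E - {Infinity}. g Q = coordfun a b Q"
    using g(1) unfolding polyfun_def by blast
  have eq: "\<forall>\<^sub>F Q in generic. coordfun a b Q / poly c (xc Q) = f Q"
    using g(3) eventually_affine by eventually_elim (use ab in simp)
  have "a \<noteq> 0 \<or> b \<noteq> 0"
  proof (rule ccontr)
    assume 0: "\<not> ?thesis"
    have "\<forall>\<^sub>F Q in generic. f Q = 0" using eq by eventually_elim (use 0 in \<open>auto simp: coordfun_def\<close>)
    thus False using f(2) by blast
  qed
  then obtain k l where "has_ord P (coordfun a b) k" "has_ord P (\<lambda>Q. poly c (xc Q)) l"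
    using has_ord_coordfun[OF P] has_ord_poly_xc[OF P g(2)] by blast
  hence "has_ord P (\<lambda>Q. coordfun a b Q / poly c (xc Q)) (k - l)" by (rule has_ord_divide)
  thus ?thesis using has_ord_cong[OF _ eq] by blast
qed

lemma has_ord_ratfun: "has_ord P f n \<Longrightarrow> ratfun f"
proof -
  assume "has_ord P f n"
  then obtain u a where u: "regular P u a" "\<forall>\<^sub>F Q in generic. f Q = unif P Q powi n * u Q"
    unfolding has_ord_def by blast
  have "ratfun (unif P)"
    unfolding unif_def[abs_def] by (cases "P = Infinity"; cases "W\<^sub>y (xc P) (yc P) = 0")
      (auto intro!: ratfun_divide ratfun_xc ratfun_yc ratfun_diff[OF ratfun_xc ratfun_const] ratfun_diff[OF ratfun_yc ratfun_const])
  hence "ratfun (\<lambda>Q. unif P Q powi n)"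
    by (cases "n \<ge> 0") (auto simp: power_int_def intro!: ratfun_power ratfun_inverse)
  hence "ratfun (\<lambda>Q. unif P Q powi n * u Q)" using regular_ratfun[OF u(1)] ratfun_mult by blast
  moreover have "\<forall>\<^sub>F Q in generic. unif P Q powi n * u Q = f Q" using u(2) by eventually_elim simp
  ultimately show "ratfun f" by (rule ratfun_cong)
qed

text \<open>By \<open>regular_decomp\<close> every element of the maximal ideal is a multiple of
  \<open>unif P\<close>; so every sum of products in the n-th power has the common factor
  \<open>unif P ^ n\<close>.\<close>

lemma maximal_ideal_power_iff:
  assumes P: "P \<in> ec_points E"
  shows "f \<in> maximal_ideal_power E P n \<longleftrightarrow> (\<exists>h b. regular P h b \<and> (\<forall>\<^sub>F Q in generic. f Q = unif P Q ^ n * h Q))"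
proof (induction n arbitrary: f)
  case 0
  show ?case
  proof
    assume "\<exists>h b. regular P h b \<and> (\<forall>\<^sub>F Q in generic. f Q = unif P Q ^ 0 * h Q)"
    then obtain h b where h: "regular P h b" "\<forall>\<^sub>F Q in generic. f Q = h Q" by auto
    from h(2) have "\<forall>\<^sub>F Q in generic. h Q = f Q" by eventually_elim simp
    thus "f \<in> maximal_ideal_power E P 0" using regular_cong[OF h(1)] by (auto simp: local_ring_iff)
  qed (auto simp: local_ring_iff intro!: exI[of _ f])
next
  case (Suc n)
  show ?case
  proof
    assume "f \<in> maximal_ideal_power E P (Suc n)"
    then obtain k :: nat and g h where gh: "\<forall>i<k. g i \<in> maximal_ideal E P \<and> h i \<in> maximal_ideal_power E P n"
       "\<forall>\<^sub>F Q in generic. f Q = (\<Sum>i<k. g i Q * h i Q)"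
      unfolding maximal_ideal_power.simps ae_eq_iff by blast
    note IH = Suc.IH
    have "\<exists>s b. regular P s b \<and> (\<forall>\<^sub>F Q in generic. (\<Sum>i<j. g i Q * h i Q) = unif P Q ^ Suc n * s Q)" if "j \<le> k" for j
      using that
    proof (induction j)
      case 0
      show ?case by (rule exI[of _ "\<lambda>_. 0"], rule exI[of _ 0]) (simp add: regular_const)
    next
      case (Suc j)
      then obtain s b where s: "regular P s b" "\<forall>\<^sub>F Q in generic. (\<Sum>i<j. g i Q * h i Q) = unif P Q ^ Suc n * s Q"
        by auto
      have "regular P (g j) 0" "h j \<in> maximal_ideal_power E P n" using gh(1) Suc(2) by (auto simp: maximal_ideal_iff)
      then obtain g' b1 h' b2 where gg: "regular P g' b1" "\<forall>\<^sub>F Q in generic. g j Q = 0 + unif P Q * g' Q"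
         and hh: "regular P h' b2" "\<forall>\<^sub>F Q in generic. h j Q = unif P Q ^ n * h' Q"
        using regular_decomp[OF P] IH by meson
      have "regular P (\<lambda>Q. s Q + g' Q * h' Q) (b + b1 * b2)" by (intro regular_add regular_mult P s gg hh)
      moreover have "\<forall>\<^sub>F Q in generic. (\<Sum>i<Suc j. g i Q * h i Q) = unif P Q ^ Suc n * (s Q + g' Q * h' Q)"
        using s(2) gg(2) hh(2) by eventually_elim (simp add: algebra_simps)
      ultimately show ?case by blast
    qed
    from this[of k] obtain s b where s: "regular P s b" "\<forall>\<^sub>F Q in generic. (\<Sum>i<k. g i Q * h i Q) = unif P Q ^ Suc n * s Q" by auto
    from gh(2) s(2) have "\<forall>\<^sub>F Q in generic. f Q = unif P Q ^ Suc n * s Q" by eventually_elim simp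
    thus "\<exists>h b. regular P h b \<and> (\<forall>\<^sub>F Q in generic. f Q = unif P Q ^ Suc n * h Q)" using s(1) by blast
  next
    assume "\<exists>h b. regular P h b \<and> (\<forall>\<^sub>F Q in generic. f Q = unif P Q ^ Suc n * h Q)"
    then obtain h b where h: "regular P h b" "\<forall>\<^sub>F Q in generic. f Q = unif P Q ^ Suc n * h Q" by blast
    have "(\<lambda>Q. unif P Q ^ n * h Q) \<in> maximal_ideal_power E P n"
      unfolding Suc.IH using h(1) by auto
    moreover have "unif P \<in> maximal_ideal E P" using regular_unif[OF P] by (simp add: maximal_ideal_iff)
    moreover have "\<forall>\<^sub>F Q in generic. f Q = (\<Sum>i<1::nat. unif P Q * (unif P Q ^ n * h Q))"
      using h(2) by eventually_elim simp
    ultimately show "f \<in> maximal_ideal_power E P (Suc n)"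
      unfolding maximal_ideal_power.simps ae_eq_iff
      by (intro CollectI exI[of _ 1] exI[of _ "\<lambda>_. unif P"] exI[of _ "\<lambda>_ Q. unif P Q ^ n * h Q"]) auto
  qed
qed

lemma ord_regular_has_ord:
  assumes P: "P \<in> ec_points E" and f: "has_ord P f (int n)"
  shows "ord_regular E P f = n"
proof -
  have "f \<in> maximal_ideal_power E P j \<longleftrightarrow> j \<le> n" for j
  proof
    assume "f \<in> maximal_ideal_power E P j"
    then obtain h b where h: "regular P h b" "\<forall>\<^sub>F Q in generic. f Q = unif P Q ^ j * h Q"
      unfolding maximal_ideal_power_iff[OF P] by blast
    have "has_ord P (\<lambda>Q. f Q / unif P Q ^ j) (int n - int j * 1)" by (intro has_ord_divide f has_ord_power has_ord_unif)
    moreover have "\<forall>\<^sub>F Q in generic. f Q / unif P Q ^ j = h Q"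
      using h(2) eventually_unif_neq_0[of P] by eventually_elim simp
    ultimately have "has_ord P h (int n - int j)" using has_ord_cong by fastforce
    thus "j \<le> n" using regular_has_ord[OF P _ h(1)] by fastforce
  next
    assume j: "j \<le> n"
    obtain u a where u: "a \<noteq> 0" "regular P u a" "\<forall>\<^sub>F Q in generic. f Q = unif P Q powi int n * u Q"
      using f unfolding has_ord_def by blast
    have "regular P (\<lambda>Q. unif P Q ^ (n - j) * u Q) (0 ^ (n - j) * a)"
      by (intro regular_mult regular_power regular_unif P u)
    moreover have "\<forall>\<^sub>F Q in generic. f Q = unif P Q ^ j * (unif P Q ^ (n - j) * u Q)"
      using u(3) by eventually_elim (use j in \<open>simp flip: mult.assoc power_add\<close>)
    ultimately show "f \<in> maximal_ideal_power E P j"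
      unfolding maximal_ideal_power_iff[OF P] by blast
  qed
  hence "{j. f \<in> maximal_ideal_power E P j} = {..n}" by auto
  thus ?thesis unfolding ord_regular_def by (simp add: Max_eq_iff)
qed

lemma ord_at_has_ord:
  assumes P: "P \<in> ec_points E" and f: "has_ord P f n"
  shows "ord_at E P f = n"
  unfolding ord_at_def
proof (rule the_equality)
  have lr: "\<exists>k. has_ord P g (int k) \<and> ord_regular E P g = k" if g: "g \<in> local_ring E P" "\<not> ae_eq E g (\<lambda>_. 0)" for g
  proof -
    obtain a where a: "regular P g a" using g(1) by (auto simp: local_ring_iff)
    obtain k where k: "has_ord P g k" using ratfun_has_ord[OF P regular_ratfun[OF a]] g(2) by (auto simp: ae_eq_iff)
    have "k \<ge> 0" using regular_has_ord[OF P k a] by blast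
    thus ?thesis using ord_regular_has_ord[OF P, of g "nat k"] k by auto
  qed
  {
    fix k assume "\<exists>g \<in> local_ring E P. \<exists>h \<in> local_ring E P. \<not> ae_eq E g (\<lambda>_. 0) \<and> \<not> ae_eq E h (\<lambda>_. 0) \<and>
      ae_eq E f (\<lambda>Q. g Q / h Q) \<and> k = int (ord_regular E P g) - int (ord_regular E P h)"
    then obtain g h where gh: "g \<in> local_ring E P" "h \<in> local_ring E P" "\<not> ae_eq E g (\<lambda>_. 0)" "\<not> ae_eq E h (\<lambda>_. 0)"
      "\<forall>\<^sub>F Q in generic. f Q = g Q / h Q" "k = int (ord_regular E P g) - int (ord_regular E P h)"
      unfolding ae_eq_iff by blast
    have "has_ord P (\<lambda>Q. g Q / h Q) k"
      using lr[OF gh(1,3)] lr[OF gh(2,4)] gh(6) has_ord_divide by blast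
    moreover from gh(5) have "\<forall>\<^sub>F Q in generic. g Q / h Q = f Q" by eventually_elim simp
    ultimately have "has_ord P f k" by (rule has_ord_cong)
    thus "k = n" using has_ord_unique[OF P f] by blast
  }
  have lrI: "g \<in> local_ring E P \<and> \<not> ae_eq E g (\<lambda>_. 0) \<and> ord_regular E P g = k" if "has_ord P g (int k)" for g k
  proof -
    have "\<not> ae_eq E g (\<lambda>_. 0)"
    proof
      assume "ae_eq E g (\<lambda>_. 0)"
      hence "\<forall>\<^sub>F Q in generic. False"
        unfolding ae_eq_iff using has_ord_eventually_neq_0[OF P that] by eventually_elim simp
      thus False by simp
    qed
    thus ?thesis using that has_ord_nonneg_regular[OF P that] ord_regular_has_ord[OF P that] by (auto simp: local_ring_iff)
  qed
  show "\<exists>g \<in> local_ring E P. \<exists>h \<in> local_ring E P. \<not> ae_eq E g (\<lambda>_. 0) \<and> \<not> ae_eq E h (\<lambda>_. 0) \<and>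
      ae_eq E f (\<lambda>Q. g Q / h Q) \<and> n = int (ord_regular E P g) - int (ord_regular E P h)"
  proof (cases "n \<ge> 0")
    case True
    have "has_ord P f (int (nat n))" "has_ord P (\<lambda>_. 1) (int 0)" using f has_ord_const[of 1] True by auto
    note * = lrI[OF this(1)] lrI[OF this(2)]
    show ?thesis using * True by (intro bexI[of _ f] bexI[of _ "\<lambda>_. 1"]) (auto simp: ae_eq_iff)
  next
    case False
    have "has_ord P (\<lambda>Q. inverse (f Q)) (int (nat (- n)))" "has_ord P (\<lambda>_. 1) (int 0)" using has_ord_inverse[OF f] has_ord_const[of 1] False by auto
    \<comment> \<open>For negative order f is presented as 1 / (1 / f), whose denominator lies in
      the local ring.\<close>
    note * = lrI[OF this(1)] lrI[OF this(2)]
    show ?thesis using * False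
      by (intro bexI[of _ "\<lambda>_. 1"] bexI[of _ "\<lambda>Q. inverse (f Q)"]) (auto simp: ae_eq_iff divide_inverse)
  qed
qed

end

section \<open>Divisors and the group law\<close>

context elliptic
begin

definition nzfun :: "('k ec_point \<Rightarrow> 'k) \<Rightarrow> bool" where
  "nzfun f \<longleftrightarrow> ratfun f \<and> (\<forall>\<^sub>F Q in generic. f Q \<noteq> 0)"

lemma nzfun_iff: "nzfun f \<longleftrightarrow> ratfun f \<and> \<not> (\<forall>\<^sub>F Q in generic. f Q = 0)"
proof -
  have "\<not> (\<forall>\<^sub>F Q in generic. f Q = 0)" if n: "\<forall>\<^sub>F Q in generic. f Q \<noteq> 0"
  proof
    assume "\<forall>\<^sub>F Q in generic. f Q = 0"
    with n have "\<forall>\<^sub>F Q in generic. False" by eventually_elim simp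
    thus False by simp
  qed
  thus ?thesis unfolding nzfun_def using ratfun_cases by blast
qed

lemma nzfun_has_ord: "nzfun f \<Longrightarrow> P \<in> ec_points E \<Longrightarrow> has_ord P f (ord_at E P f)"
  using ratfun_has_ord[of P f] ord_at_has_ord[of P f] unfolding nzfun_iff by blast

lemma nzI: "P \<in> ec_points E \<Longrightarrow> has_ord P f n \<Longrightarrow> nzfun f"
  unfolding nzfun_def using has_ord_ratfun has_ord_eventually_neq_0 by blast

lemma nzfun_const: "c \<noteq> 0 \<Longrightarrow> nzfun (\<lambda>_. c)"
  unfolding nzfun_def by (simp add: ratfun_const)

lemma nzfun_mult: "nzfun f \<Longrightarrow> nzfun g \<Longrightarrow> nzfun (\<lambda>Q. f Q * g Q)"
  unfolding nzfun_def by (auto intro: ratfun_mult elim: eventually_elim2)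

lemma nzfun_inverse: "nzfun f \<Longrightarrow> nzfun (\<lambda>Q. inverse (f Q))"
  unfolding nzfun_def by (auto intro: ratfun_inverse elim: eventually_mono)

lemma nzfun_divide: "nzfun f \<Longrightarrow> nzfun g \<Longrightarrow> nzfun (\<lambda>Q. f Q / g Q)"
  using nzfun_mult[OF _ nzfun_inverse, of f g] by (simp add: divide_inverse)

lemma nzfun_prod: "(\<And>i. i \<in> A \<Longrightarrow> nzfun (f i)) \<Longrightarrow> nzfun (\<lambda>Q. \<Prod>i\<in>A. f i Q)"
  by (induction A rule: infinite_finite_induct) (auto intro: nzfun_const nzfun_mult)

lemma nzfun_cong: "nzfun f \<Longrightarrow> \<forall>\<^sub>F Q in generic. f Q = g Q \<Longrightarrow> nzfun g"
  unfolding nzfun_def by (auto intro: ratfun_cong elim: eventually_elim2)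

lemma nzfun_xc_minus: "nzfun (\<lambda>Q. xc Q - c)"
  using nzI[OF Infinity_in has_ord_xc_inf] .

lemma ord_cong:
  assumes "nzfun f" "\<forall>\<^sub>F Q in generic. f Q = g Q" "P \<in> ec_points E"
  shows "ord_at E P g = ord_at E P f"
  by (rule ord_at_has_ord[OF assms(3) has_ord_cong[OF nzfun_has_ord[OF assms(1,3)] assms(2)]])

lemma ord_mult:
  assumes "nzfun f" "nzfun g" "P \<in> ec_points E"
  shows "ord_at E P (\<lambda>Q. f Q * g Q) = ord_at E P f + ord_at E P g"
  by (intro ord_at_has_ord has_ord_mult nzfun_has_ord assms)

lemma ord_divide:
  assumes "nzfun f" "nzfun g" "P \<in> ec_points E"
  shows "ord_at E P (\<lambda>Q. f Q / g Q) = ord_at E P f - ord_at E P g"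
  by (intro ord_at_has_ord has_ord_divide nzfun_has_ord assms)

lemma ord_const: "c \<noteq> 0 \<Longrightarrow> P \<in> ec_points E \<Longrightarrow> ord_at E P (\<lambda>_. c) = 0"
  by (intro ord_at_has_ord has_ord_const)

lemma ord_prod:
  assumes "P \<in> ec_points E"
  shows "(\<And>i. i \<in> A \<Longrightarrow> nzfun (f i)) \<Longrightarrow> ord_at E P (\<lambda>Q. \<Prod>i\<in>A. f i Q) = (\<Sum>i\<in>A. ord_at E P (f i))"
  by (induction A rule: infinite_finite_induct) (auto simp: ord_const[OF _ assms] ord_mult[OF _ nzfun_prod assms])

lemma ord_xc_minus:
  assumes "P \<in> ec_points E" "A \<in> ec_points E" "A \<noteq> Infinity"
  shows "ord_at E P (\<lambda>Q. xc Q - xc A) = of_bool (P = A) + of_bool (P = ec_neg E A) - 2 * of_bool (P = Infinity)"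
  by (rule ord_at_has_ord[OF assms(1) has_ord_xc_minus[OF assms]])

lemma ord_nonneg_regular: "nzfun f \<Longrightarrow> P \<in> ec_points E \<Longrightarrow> ord_at E P f \<ge> 0 \<Longrightarrow> \<exists>a. regular P f a"
  using has_ord_nonneg_regular[OF _ nzfun_has_ord] by blast

text \<open>This lets a factor x - x(P) of a denominator be cancelled. If P and -P differ, a + b y
  vanishes at two points with equal x and different y. If P = -P, then x - x(P) has order 2, whereas
  b (y - y(P)) has order 1 unless b vanishes at x(P).\<close>

lemma regular_affine_numerator_vanishes:
  assumes P: "P \<in> ec_points E" "P \<noteq> Infinity" and f: "regular P f v" "regular (ec_neg E P) f v'"
    and eq: "\<forall>\<^sub>F Q in generic. coordfun a b Q = (xc Q - xc P) * f Q"
  shows "poly a (xc P) = 0 \<and> poly b (xc P) = 0"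
proof -
  have van: "coordfun a b R = 0" if R: "R \<in> ec_points E" "R \<noteq> Infinity" "xc R = xc P" "regular R f w" for R w
  proof -
    have "regular R (\<lambda>Q. (xc Q - xc P) * f Q) ((xc R - xc P) * w)"
      by (intro regular_mult regular_diff regular_xc regular_const R)
    moreover from eq have "\<forall>\<^sub>F Q in generic. (xc Q - xc P) * f Q = coordfun a b Q" by eventually_elim simp
    ultimately have "regular R (coordfun a b) 0" using regular_cong R(3) by fastforce
    thus ?thesis using regular_unique[OF R(1) regular_coordfun[OF R(1,2)]] by blast
  qed
  have 1: "coordfun a b P = 0" using van P f by blast
  have "poly b (xc P) = 0"
  proof (cases "ec_neg E P = P")
    case False
    have "coordfun a b (ec_neg E P) = 0" using van[of "ec_neg E P"] P f by simp
    hence "coordfun a b P - coordfun a b (ec_neg E P) = 0" using 1 by simp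
    hence "poly b (xc P) * (yc P - yc (ec_neg E P)) = 0"
      by (simp add: coordfun_def right_diff_distrib)
    moreover have "yc P \<noteq> yc (ec_neg E P)" using False P by (cases P) auto
    ultimately show ?thesis by simp
  next
    case True
    hence wy: "W\<^sub>y (xc P) (yc P) = 0" using neg_eq_self_iff P by blast
    show ?thesis
    proof (rule ccontr)
      assume b: "poly b (xc P) \<noteq> 0"
      obtain a' where a': "a - [:poly a (xc P):] = [:- xc P, 1:] * a'"
        using poly_eq_0_iff_dvd[of "a - [:poly a (xc P):]" "xc P"] by (auto elim: dvdE)
      obtain b' where b': "b - [:poly b (xc P):] = [:- xc P, 1:] * b'"
        using poly_eq_0_iff_dvd[of "b - [:poly b (xc P):]" "xc P"] by (auto elim: dvdE)
      have pa: "poly a x = poly a (xc P) + (x - xc P) * poly a' x" for x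
        using arg_cong[OF a', of "\<lambda>p. poly p x"] by (simp add: algebra_simps)
      have pb: "poly b x = poly b (xc P) + (x - xc P) * poly b' x" for x
        using arg_cong[OF b', of "\<lambda>p. poly p x"] by (simp add: algebra_simps)
      have "regular P (\<lambda>Q. f Q - coordfun a' b' Q) (v - coordfun a' b' P)" by (intro regular_diff f regular_coordfun P)
      \<comment> \<open>Both \<open>of_bool\<close> terms are 1 because P = -P, so this order is -1;
        yet the function will turn out to be a difference of regular functions.\<close>
      moreover have "has_ord P (\<lambda>Q. poly b (xc P) * unif P Q / (xc Q - xc P)) (0 + 1 - (of_bool (P = P) + of_bool (P = ec_neg E P)))"
        by (intro has_ord_divide has_ord_mult has_ord_const b has_ord_unif has_ord_xc_affine P)
      moreover have "\<forall>\<^sub>F Q in generic. poly b (xc P) * unif P Q / (xc Q - xc P) = f Q - coordfun a' b' Q"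
        using eq eventually_xc_neq[of "xc P"]
      proof eventually_elim
        case (elim Q)
        have "coordfun a b Q = coordfun a b P + poly b (xc P) * (yc Q - yc P) + (xc Q - xc P) * coordfun a' b' Q"
          by (simp add: coordfun_def pa[of "xc Q"] pb[of "xc Q"] algebra_simps)
        moreover have "unif P Q = yc Q - yc P" using wy P by (simp add: unif_def)
        ultimately have "poly b (xc P) * unif P Q = coordfun a b Q - (xc Q - xc P) * coordfun a' b' Q"
          using 1 by simp
        also have "\<dots> = (xc Q - xc P) * (f Q - coordfun a' b' Q)"
          using elim by (simp add: right_diff_distrib)
        finally have "poly b (xc P) * unif P Q = (xc Q - xc P) * (f Q - coordfun a' b' Q)" .
        thus ?case using elim by simp
      qed
      ultimately have "has_ord P (\<lambda>Q. f Q - coordfun a' b' Q) (- 1)" "regular P (\<lambda>Q. f Q - coordfun a' b' Q) (v - coordfun a' b' P)"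
        using has_ord_cong True by force+
      thus False using regular_has_ord[OF P(1)] by fastforce
    qed
  qed
  thus ?thesis using 1 by (simp add: coordfun_def)
qed

text \<open>Each root of the denominator also divides both parts of the numerator, by regularity at
  the two points above that root; the degree of the denominator thus drops to zero.\<close>

lemma regular_affine_imp_coordfun:
  assumes "ratfun f" and reg: "\<And>P. P \<in> ec_points E \<Longrightarrow> P \<noteq> Infinity \<Longrightarrow> \<exists>a. regular P f a"
  shows "\<exists>a b. \<forall>\<^sub>F Q in generic. f Q = coordfun a b Q"
proof -
  have "\<forall>\<^sub>F Q in generic. f Q = coordfun a b Q / poly c (xc Q) \<Longrightarrow> c \<noteq> 0 \<Longrightarrow> ?thesis" for a b c
  proof (induction "Polynomial.degree c" arbitrary: a b c)
    case 0
    then obtain k where k: "c = [:k:]" by (metis degree_eq_zeroE)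
    have "\<forall>\<^sub>F Q in generic. f Q = coordfun (Polynomial.smult (1 / k) a) (Polynomial.smult (1 / k) b) Q"
      using 0(2) by eventually_elim (simp add: k coordfun_def divide_simps)
    thus ?case by blast
  next
    case (Suc d)
    obtain r where "poly c r = 0" using alg_closed_imp_poly_has_root[of c] Suc(2) by auto
    then obtain q where q: "c = [:- r, 1:] * q" using poly_eq_0_iff_dvd by (metis dvdE)
    have q0: "q \<noteq> 0" using q Suc(4) by auto
    hence deg: "Polynomial.degree c = Suc (Polynomial.degree q)" unfolding q by (subst degree_mult_eq) auto
    have pc: "poly c x = (x - r) * poly q x" for x by (simp add: q algebra_simps)
    obtain y where y: "Affine r y \<in> ec_points E" using ex_point by blast
    let ?P = "Affine r y"
    obtain v where v: "regular ?P f v" using reg y by blast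
    obtain v' where v': "regular (ec_neg E ?P) f v'" using reg[OF ec_neg_in[OF y]] by auto
    have rq: "regular R (\<lambda>Q. poly q (xc Q)) (poly q (xc R))" if "R \<in> ec_points E" "R \<noteq> Infinity" for R
      by (intro regular_poly regular_xc that)
    have "poly a (xc ?P) = 0 \<and> poly b (xc ?P) = 0"
    proof (rule regular_affine_numerator_vanishes[OF y _ regular_mult[OF v rq[OF y]] regular_mult[OF v' rq]])
      show "\<forall>\<^sub>F Q in generic. coordfun a b Q = (xc Q - xc ?P) * (f Q * poly q (xc Q))"
        using Suc(3) eventually_poly_neq_0[OF Suc(4)] by eventually_elim (simp add: pc)
    qed (use ec_neg_in[OF y] in auto)
    hence ra: "poly a r = 0" and rb: "poly b r = 0" by auto
    obtain a' where a': "a = [:- r, 1:] * a'" using ra poly_eq_0_iff_dvd by (metis dvdE)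
    obtain b' where b': "b = [:- r, 1:] * b'" using rb poly_eq_0_iff_dvd by (metis dvdE)
    have "\<forall>\<^sub>F Q in generic. f Q = coordfun a' b' Q / poly q (xc Q)"
      using Suc(3) eventually_xc_neq[of r]
    proof eventually_elim
      case (elim Q)
      have "coordfun a b Q = (xc Q - r) * coordfun a' b' Q" "poly c (xc Q) = (xc Q - r) * poly q (xc Q)"
        by (simp_all add: coordfun_def a' b' q algebra_simps)
      thus ?case using elim by simp
    qed
    thus ?case using Suc(1)[of q a' b'] Suc(2) deg q0 by simp
  qed
  moreover obtain n g c where g: "polyfun n g" "c \<noteq> 0" "\<forall>\<^sub>F Q in generic. f Q = g Q / poly c (xc Q)"
    using assms(1) unfolding ratfun_def by blast
  moreover obtain a b where ab: "\<forall>Q\<in>ec_points E - {Infinity}. g Q = coordfun a b Q"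
    using g(1) unfolding polyfun_def by blast
  moreover have "\<forall>\<^sub>F Q in generic. f Q = coordfun a b Q / poly c (xc Q)"
    using g(3) eventually_affine by eventually_elim (use ab in simp)
  ultimately show ?thesis by blast
qed

lemma ord_affine_nonneg_imp_coordfun:
  assumes "nzfun f" "\<And>P. P \<in> ec_points E \<Longrightarrow> P \<noteq> Infinity \<Longrightarrow> ord_at E P f \<ge> 0"
  obtains a b where "\<forall>\<^sub>F Q in generic. f Q = coordfun a b Q" "a \<noteq> 0 \<or> b \<noteq> 0"
    "ord_at E Infinity f = - max (if a = 0 then 0 else 2 * int (Polynomial.degree a)) (if b = 0 then 0 else 2 * int (Polynomial.degree b) + 3)"
proof -
  obtain a b where ab: "\<forall>\<^sub>F Q in generic. f Q = coordfun a b Q"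
    using regular_affine_imp_coordfun[of f] ord_nonneg_regular[OF assms(1)] assms unfolding nzfun_def by blast
  have n: "a \<noteq> 0 \<or> b \<noteq> 0"
  proof (rule ccontr)
    assume "\<not> ?thesis"
    hence "\<forall>\<^sub>F Q in generic. f Q = 0" using ab by (auto simp: coordfun_def)
    thus False using assms(1) nzfun_iff by blast
  qed
  have ab': "\<forall>\<^sub>F Q in generic. coordfun a b Q = f Q" using ab by eventually_elim simp
  show ?thesis
    by (rule that[OF ab n]) (rule ord_at_has_ord[OF Infinity_in has_ord_cong[OF has_ord_coordfun_inf[OF n] ab']])
qed

text \<open>The pole orders 2 deg a and 2 deg b + 3 at infinity never take the value 1, so a
  function with at most a simple pole there has no pole at all. All later rigidity rests on this
  gap.\<close>

lemma ord_ge_imp_const: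
  assumes "nzfun f" "\<And>P. P \<in> ec_points E \<Longrightarrow> ord_at E P f \<ge> - of_bool (P = Infinity)"
  shows "\<exists>c. c \<noteq> 0 \<and> (\<forall>\<^sub>F Q in generic. f Q = c)"
proof -
  have "ord_at E P f \<ge> 0" if "P \<in> ec_points E" "P \<noteq> Infinity" for P using assms(2)[OF that(1)] that(2) by simp
  from ord_affine_nonneg_imp_coordfun[OF assms(1) this] obtain a b where ab: "\<forall>\<^sub>F Q in generic. f Q = coordfun a b Q" "a \<noteq> 0 \<or> b \<noteq> 0"
    "ord_at E Infinity f = - max (if a = 0 then 0 else 2 * int (Polynomial.degree a)) (if b = 0 then 0 else 2 * int (Polynomial.degree b) + 3)"
    by blast
  have "max (if a = 0 then 0 else 2 * int (Polynomial.degree a)) (if b = 0 then 0 else 2 * int (Polynomial.degree b) + 3) \<le> 1"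
    using assms(2)[OF Infinity_in] ab(3) by simp
  hence b: "b = 0" and "Polynomial.degree a = 0" by (auto split: if_splits)
  then obtain c where c: "a = [:c:]" by (metis degree_eq_zeroE)
  have "\<forall>\<^sub>F Q in generic. f Q = c" using ab(1) by eventually_elim (simp add: coordfun_def b c)
  thus ?thesis using ab(2) b c by auto
qed

lemma ord_eq_imp_const_mult:
  assumes "nzfun f" "nzfun g" "\<And>P. P \<in> ec_points E \<Longrightarrow> ord_at E P f = ord_at E P g"
  shows "\<exists>c. c \<noteq> 0 \<and> (\<forall>\<^sub>F Q in generic. f Q = c * g Q)"
proof -
  obtain c where c: "c \<noteq> 0" "\<forall>\<^sub>F Q in generic. f Q / g Q = c"
    using ord_ge_imp_const[OF nzfun_divide[OF assms(1,2)]] by (auto simp: ord_divide[OF assms(1,2)] assms(3))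
  have "\<forall>\<^sub>F Q in generic. g Q \<noteq> 0" using assms(2) by (simp add: nzfun_def)
  with c(2) have "\<forall>\<^sub>F Q in generic. f Q = c * g Q" by eventually_elim (auto simp: field_simps)
  thus ?thesis using c(1) by blast
qed

text \<open>Multiplication by x - x(B) moves the pole from B to infinity. The product has zeros A
  and -B and a double pole, hence is d (x - x(A)), whose zeros are A and -A. Comparison of the zeros
  gives A = B. If A or B is infinity, a simple pole at infinity remains, which
  \<open>ord_ge_imp_const\<close> excludes.\<close>

lemma principal_difference:
  assumes f: "nzfun f" and A: "A \<in> ec_points E" and B: "B \<in> ec_points E"
    and ord: "\<And>P. P \<in> ec_points E \<Longrightarrow> ord_at E P f = of_bool (P = A) - of_bool (P = B)"
  shows "A = B"
proof (rule ccontr)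
  assume AB: "A \<noteq> B"
  have contra: False if g: "nzfun g" "R \<in> ec_points E" "ord_at E R g \<noteq> 0" "\<And>P. P \<in> ec_points E \<Longrightarrow> ord_at E P g \<ge> - of_bool (P = Infinity)" for g R
  proof -
    obtain c where c: "c \<noteq> 0" "\<forall>\<^sub>F Q in generic. g Q = c" using ord_ge_imp_const[OF g(1,4)] by blast
    have "ord_at E R g = 0" using ord_cong[OF g(1) c(2) g(2)] ord_const[OF c(1) g(2)] by simp
    thus False using g(3) by simp
  qed
  show False
  proof (cases "B = Infinity")
    case True
    show False by (rule contra[OF f A]) (use ord A AB True in auto)
  next
    case Bfin: False
    define g where "g = (\<lambda>Q. f Q * (xc Q - xc B))"
    have g: "nzfun g" unfolding g_def by (intro nzfun_mult f nzfun_xc_minus)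
    have og: "ord_at E P g = of_bool (P = A) + of_bool (P = ec_neg E B) - 2 * of_bool (P = Infinity)" if "P \<in> ec_points E" for P
      unfolding g_def using ord_mult[OF f nzfun_xc_minus that] ord[OF that] ord_xc_minus[OF that B Bfin] by simp
    show False
    proof (cases "A = Infinity")
      case True
      have "ec_neg E B \<noteq> Infinity" using Bfin by simp
      show False by (rule contra[OF g Infinity_in]) (use og True Bfin in \<open>auto simp: eq_commute[of Infinity]\<close>)
    next
      case Afin: False
      have "ord_at E P g \<ge> 0" if "P \<in> ec_points E" "P \<noteq> Infinity" for P
        using og[OF that(1)] that(2) by simp
      from ord_affine_nonneg_imp_coordfun[OF g this] obtain a b where ab: "\<forall>\<^sub>F Q in generic. g Q = coordfun a b Q" "a \<noteq> 0 \<or> b \<noteq> 0"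
        "ord_at E Infinity g = - max (if a = 0 then 0 else 2 * int (Polynomial.degree a)) (if b = 0 then 0 else 2 * int (Polynomial.degree b) + 3)"
        by blast
      have "Infinity \<noteq> ec_neg E B" using Bfin by (metis ec_neg_eq_Infinity)
      hence "ord_at E Infinity g = - 2" using og[OF Infinity_in] Afin by auto
      hence b: "b = 0" and da: "Polynomial.degree a = 1" and a0: "a \<noteq> 0" using ab(2,3) by (auto simp: max_def split: if_splits)
      obtain c d where cd: "a = [:c, d:]" using degree1_coeffs[OF da] by blast
      have gA: "regular A g 0"
      proof -
        obtain v where v: "regular A g v" "v = 0 \<longleftrightarrow> ord_at E A g > 0"
          using has_ord_nonneg_regular[OF A nzfun_has_ord[OF g A]] og[OF A] Afin by auto
        have "(of_bool b :: int) \<ge> 0" for b by simp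
        hence "ord_at E A g > 0" using og[OF A] Afin by (simp add: add_pos_nonneg)
        thus ?thesis using v by simp
      qed
      have "regular A (coordfun a b) 0" using regular_cong[OF gA ab(1)] .
      hence "coordfun a b A = 0" using regular_unique[OF A regular_coordfun[OF A Afin]] by blast
      hence c: "c = - (xc A * d)" by (simp add: coordfun_def b cd eq_neg_iff_add_eq_0)
      have eq: "\<forall>\<^sub>F Q in generic. g Q = d * (xc Q - xc A)"
        using ab(1) by eventually_elim (simp add: coordfun_def b cd c algebra_simps)
      have d0: "d \<noteq> 0" using da cd by auto
      have "ord_at E P g = of_bool (P = A) + of_bool (P = ec_neg E A) - 2 * of_bool (P = Infinity)" if "P \<in> ec_points E" for P
        using ord_cong[OF g eq that] ord_mult[OF nzfun_const[OF d0] nzfun_xc_minus that] ord_const[OF d0 that] ord_xc_minus[OF that A Afin] by simp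
      from this[of "ec_neg E A"] og[of "ec_neg E A"] A AB show False by (auto split: if_splits)
    qed
  qed
qed

text \<open>The line through both points (the tangent if they coincide), substituted into the curve
  equation, leaves a cubic in x with the roots x1, x2 and the x-coordinate of the sum.\<close>

lemma ec_add_line:
  assumes P: "Affine x1 y1 \<in> ec_points E" and Q: "Affine x2 y2 \<in> ec_points E"
    and ni: "\<not> (x1 = x2 \<and> y1 + y2 + a\<^sub>1 E * x2 + a\<^sub>3 E = 0)"
  obtains l n x3 where "ec_add E (Affine x1 y1) (Affine x2 y2) = Affine x3 (- (l + a\<^sub>1 E) * x3 - n - a\<^sub>3 E)"
    "y1 = l * x1 + n" "y2 = l * x2 + n"
    "\<And>x. (l * x + n)\<^sup>2 + (a\<^sub>1 E * x + a\<^sub>3 E) * (l * x + n) - (x ^ 3 + a\<^sub>2 E * x\<^sup>2 + a\<^sub>4 E * x + a\<^sub>6 E) =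
        - ((x - x1) * (x - x2) * (x - x3))"
proof -
  define l where "l = (if x1 = x2
                 then (3 * x1\<^sup>2 + 2 * a\<^sub>2 E * x1 + a\<^sub>4 E - a\<^sub>1 E * y1) / (2 * y1 + a\<^sub>1 E * x1 + a\<^sub>3 E)
                 else (y2 - y1) / (x2 - x1))"
  define n where "n = y1 - l * x1"
  define x3 where "x3 = l\<^sup>2 + a\<^sub>1 E * l - a\<^sub>2 E - x1 - x2"
  have eq: "ec_add E (Affine x1 y1) (Affine x2 y2) = Affine x3 (- (l + a\<^sub>1 E) * x3 - n - a\<^sub>3 E)"
    using ni by (simp add: Let_def l_def n_def x3_def)
  have y1: "y1 = l * x1 + n" by (simp add: n_def)
  have same: "y2 = y1 \<and> 2 * y1 + a\<^sub>1 E * x1 + a\<^sub>3 E \<noteq> 0" if "x1 = x2"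
  proof -
    have "Affine x2 y2 = Affine x1 y1 \<or> Affine x2 y2 = ec_neg E (Affine x1 y1)"
      using same_xc[OF P Q] that by simp
    thus ?thesis using ni that by (auto simp: algebra_simps)
  qed
  have y2: "y2 = l * x2 + n"
  proof (cases "x1 = x2")
    case False
    hence "l * (x2 - x1) = y2 - y1" by (simp add: l_def)
    thus ?thesis by (simp add: n_def algebra_simps)
  qed (use same y1 in auto)
  define p where "p x = (l * x + n)\<^sup>2 + (a\<^sub>1 E * x + a\<^sub>3 E) * (l * x + n) - (x ^ 3 + a\<^sub>2 E * x\<^sup>2 + a\<^sub>4 E * x + a\<^sub>6 E)" for x
  \<comment> \<open>The choice of x3 cancels the quadratic terms, so the two cubics differ by a
    linear polynomial only; \<alpha> and \<beta> are its coefficients.\<close>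
  define \<alpha> where "\<alpha> = 2 * l * n + a\<^sub>1 E * n + a\<^sub>3 E * l - a\<^sub>4 E + x1 * x2 + (x1 + x2) * x3"
  define \<beta> where "\<beta> = n\<^sup>2 + a\<^sub>3 E * n - a\<^sub>6 E - x1 * x2 * x3"
  have q: "p x + (x - x1) * (x - x2) * (x - x3) = \<alpha> * x + \<beta>" for x
    unfolding p_def \<alpha>_def \<beta>_def x3_def by (simp add: power2_eq_square power3_eq_cube algebra_simps)
  have p1: "p x1 = 0" using P unfolding p_def y1[symmetric] Affine_in_iff by (simp add: algebra_simps)
  have p2: "p x2 = 0" using Q unfolding p_def y2[symmetric] Affine_in_iff by (simp add: algebra_simps)
  have z: "\<alpha> * x1 + \<beta> = 0" "\<alpha> * x2 + \<beta> = 0" using q[of x1] q[of x2] p1 p2 by simp_all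
  have "\<alpha> = 0"
  proof (cases "x1 = x2")
    case False
    have "(\<alpha> * x1 + \<beta>) - (\<alpha> * x2 + \<beta>) = 0" unfolding z by simp
    hence "\<alpha> * (x1 - x2) = 0" by (simp add: right_diff_distrib)
    thus ?thesis using False by simp
  next
    case True
    \<comment> \<open>For x1 = x2 the two roots give a single condition; the missing one, \<alpha> =
      0, is the equation that defines the slope of the tangent.\<close>
    have l: "l * (2 * y1 + a\<^sub>1 E * x1 + a\<^sub>3 E) = 3 * x1\<^sup>2 + 2 * a\<^sub>2 E * x1 + a\<^sub>4 E - a\<^sub>1 E * y1"
      using True same by (simp add: l_def)
    have "\<alpha> = l * (2 * y1 + a\<^sub>1 E * x1 + a\<^sub>3 E) - (3 * x1\<^sup>2 + 2 * a\<^sub>2 E * x1 + a\<^sub>4 E - a\<^sub>1 E * y1)"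
      unfolding \<alpha>_def x3_def n_def by (simp add: True[symmetric] power2_eq_square algebra_simps)
    thus ?thesis using l by simp
  qed
  moreover from this have "\<beta> = 0" using z by simp
  ultimately have "p x = - ((x - x1) * (x - x2) * (x - x3))" for x
    using q[of x] by (simp add: eq_neg_iff_add_eq_0)
  thus ?thesis using that[OF eq y1 y2] unfolding p_def by blast
qed

lemma ec_add_in [simp]:
  assumes "P \<in> ec_points E" "Q \<in> ec_points E"
  shows "ec_add E P Q \<in> ec_points E"
proof (cases P; cases Q)
  fix x1 y1 x2 y2 assume PQ: "P = Affine x1 y1" "Q = Affine x2 y2"
  show ?thesis
  proof (cases "x1 = x2 \<and> y1 + y2 + a\<^sub>1 E * x2 + a\<^sub>3 E = 0")
    case False
    obtain l n x3 where l: "ec_add E (Affine x1 y1) (Affine x2 y2) = Affine x3 (- (l + a\<^sub>1 E) * x3 - n - a\<^sub>3 E)"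
      "\<And>x. (l * x + n)\<^sup>2 + (a\<^sub>1 E * x + a\<^sub>3 E) * (l * x + n) - (x ^ 3 + a\<^sub>2 E * x\<^sup>2 + a\<^sub>4 E * x + a\<^sub>6 E) =
        - ((x - x1) * (x - x2) * (x - x3))"
      using ec_add_line[OF _ _ False] assms PQ by metis
    have "Affine x3 (l * x3 + n) \<in> ec_points E"
      using l(2)[of x3] by (simp add: Affine_in_iff algebra_simps)
    hence "ec_neg E (Affine x3 (l * x3 + n)) \<in> ec_points E" by (rule ec_neg_in)
    moreover have "- (l + a\<^sub>1 E) * x3 - n - a\<^sub>3 E = - (l * x3 + n) - a\<^sub>1 E * x3 - a\<^sub>3 E" by (simp add: algebra_simps)
    ultimately show ?thesis unfolding PQ l(1) by (simp only: ec_neg.simps)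
  qed (simp add: PQ)
qed (use assms in auto)

text \<open>
  The product of the line with its conjugate is \<open>-\<Prod>(x - x\<^sub>i)\<close>. A line that is not vertical passes through \<open>R\<close> and
  \<open>-R\<close> only if these coincide, so the divisor of the product determines that of the line.
\<close>
lemma ord_line:
  fixes x :: "nat \<Rightarrow> 'k"
  assumes A: "\<And>i. i \<in> {..<3} \<Longrightarrow> Affine (x i) (l * x i + n) \<in> ec_points E"
    and id: "\<And>z. (l * z + n)\<^sup>2 + (a\<^sub>1 E * z + a\<^sub>3 E) * (l * z + n) - (z ^ 3 + a\<^sub>2 E * z\<^sup>2 + a\<^sub>4 E * z + a\<^sub>6 E) =
        - (\<Prod>i<3. z - x i)"
    and R: "R \<in> ec_points E"
  shows "nzfun (\<lambda>Q. yc Q - l * xc Q - n) \<and>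
    ord_at E R (\<lambda>Q. yc Q - l * xc Q - n) = (\<Sum>i<3. of_bool (R = Affine (x i) (l * x i + n))) - 3 * of_bool (R = Infinity)"
proof -
  let ?L = "\<lambda>Q. yc Q - l * xc Q - n" and ?M = "\<lambda>Q. - yc Q - (a\<^sub>1 E + l) * xc Q - a\<^sub>3 E - n"
  let ?A = "\<lambda>i. Affine (x i) (l * x i + n)"
  have L: "?L = coordfun [:- n, - l:] 1" by (auto simp: coordfun_def algebra_simps)
  have M: "?M = coordfun [:- n - a\<^sub>3 E, - l - a\<^sub>1 E:] (-1)" by (auto simp: coordfun_def algebra_simps)
  have vL: "has_ord Infinity ?L (-3)" using has_ord_coordfun_inf[of "[:- n, - l:]" 1] unfolding L by simp
  have nzL: "nzfun ?L" using nzI[OF Infinity_in vL] .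
  have nzM: "nzfun ?M" unfolding M using nzI[OF Infinity_in has_ord_coordfun_inf[of _ "- 1"]] by auto
  show ?thesis
  proof (cases "R = Infinity")
    case True
    thus ?thesis using nzL ord_at_has_ord[OF Infinity_in vL] by simp
  next
    case Rfin: False
    have prod: "?L Q * ?M Q = - (\<Prod>i<3. xc Q - x i)" if "Q \<in> ec_points E" "Q \<noteq> Infinity" for Q
    proof -
      have "?L Q * ?M Q = (l * xc Q + n)\<^sup>2 + (a\<^sub>1 E * xc Q + a\<^sub>3 E) * (l * xc Q + n) - (yc Q * yc Q + poly lin (xc Q) * yc Q)"
        by (simp add: poly_lin power2_eq_square algebra_simps)
      also have "yc Q * yc Q + poly lin (xc Q) * yc Q = (xc Q) ^ 3 + a\<^sub>2 E * (xc Q)\<^sup>2 + a\<^sub>4 E * xc Q + a\<^sub>6 E"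
        using on_curve[OF that] by (simp add: poly_cubic)
      finally show ?thesis using id by simp
    qed
    have "nzfun (\<lambda>Q. xc Q - x i)" for i by (rule nzfun_xc_minus)
    note nzx = this nzfun_prod[of "{..<3}" "\<lambda>i Q. xc Q - x i", OF this]
    have "ord_at E R (\<lambda>Q. \<Prod>i<3. xc Q - x i) = (\<Sum>i<3. of_bool (R = ?A i) + of_bool (R = ec_neg E (?A i)))"
    proof -
      have "ord_at E R (\<lambda>Q. xc Q - x i) = of_bool (R = ?A i) + of_bool (R = ec_neg E (?A i))" if "i < 3" for i
        using ord_xc_minus[OF R A[of i]] that Rfin by (simp del: ec_neg.simps)
      thus ?thesis using ord_prod[OF R, of "{..<3}" "\<lambda>i Q. xc Q - x i"] nzx(1) by (simp del: ec_neg.simps)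
    qed
    moreover have "ord_at E R (\<lambda>Q. -1 * (\<Prod>i<3. xc Q - x i)) = ord_at E R (\<lambda>Q. \<Prod>i<3. xc Q - x i)"
      using ord_mult[OF nzfun_const[of "-1"] nzx(2) R] ord_const[of "-1", OF _ R] by simp
    moreover have "ord_at E R (\<lambda>Q. -1 * (\<Prod>i<3. xc Q - x i)) = ord_at E R (\<lambda>Q. ?L Q * ?M Q)"
    proof (rule ord_cong[OF nzfun_mult[OF nzL nzM] _ R])
      show "\<forall>\<^sub>F Q in generic. ?L Q * ?M Q = -1 * (\<Prod>i<3. xc Q - x i)"
        using eventually_affine by eventually_elim (use prod in simp)
    qed
    ultimately have sum: "ord_at E R ?L + ord_at E R ?M = (\<Sum>i<3. of_bool (R = ?A i) + of_bool (R = ec_neg E (?A i)))"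
      using ord_mult[OF nzL nzM R] by simp
    have rL: "regular R ?L (?L R)" and rM: "regular R ?M (?M R)" 
      using regular_coordfun[OF R Rfin, of "[:- n, - l:]" 1] regular_coordfun[OF R Rfin, of "[:- n - a\<^sub>3 E, - l - a\<^sub>1 E:]" "-1"]
      unfolding L[symmetric] M[symmetric] by auto
    have MR: "?M R = ?L (ec_neg E R)" using Rfin by (simp add: yc_neg poly_lin algebra_simps)
    have onL: "?L (?A i) = 0" for i by simp
    show ?thesis
    proof (cases "?L R = 0")
      case False
      hence "ord_at E R ?L = 0" using ord_at_has_ord[OF R has_ord_regular[OF rL False]] by simp
      moreover have "R \<noteq> ?A i" for i using False by auto
      ultimately show ?thesis using nzL Rfin by simp
    next
      case L0: True
      show ?thesis
      proof (cases "ec_neg E R = R")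
        case False
        have "?M R \<noteq> 0"
        proof
          assume "?M R = 0"
          hence "yc R = yc (ec_neg E R)" using MR L0 by (simp add: algebra_simps)
          thus False using False Rfin by (cases R) auto
        qed
        hence "ord_at E R ?M = 0" using ord_at_has_ord[OF R has_ord_regular[OF rM]] by simp
        moreover have "R \<noteq> ec_neg E (?A i)" for i
        proof
          assume "R = ec_neg E (?A i)"
          hence "ec_neg E R = ?A i" by (metis ec_neg_neg)
          hence "?M R = 0" using MR onL[of i] by simp
          thus False using \<open>?M R \<noteq> 0\<close> by simp
        qed
        ultimately show ?thesis using sum nzL Rfin by (simp del: ec_neg.simps)
      next
        case True
        hence wy: "W\<^sub>y (xc R) (yc R) = 0" using neg_eq_self_iff Rfin by blast
        hence u: "unif R = (\<lambda>Q. yc Q - yc R)" using Rfin by (simp add: unif_def[abs_def])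
        have x2: "has_ord R (\<lambda>Q. xc Q - xc R) 2" using has_ord_xc_affine[OF R Rfin R Rfin] True by simp
        \<comment> \<open>At R = -R the uniformizer is y - y(R) and x - x(R) has order 2. So the
          line and its conjugate both have order 1 here, while every index i with R = A_i counts
          twice in the product.\<close>
        have one: "has_ord R (\<lambda>Q. c * (yc Q - yc R) + d * (xc Q - xc R)) 1" if "c \<noteq> 0" for c d
        proof -
          have c: "has_ord R (\<lambda>Q. c * (yc Q - yc R)) (0 + 1)"
            using has_ord_mult[OF has_ord_const[OF that] has_ord_unif[of R]] unfolding u .
          show ?thesis
          proof (cases "d = 0")
            case False
            have "has_ord R (\<lambda>Q. d * (xc Q - xc R)) (0 + 2)" by (intro has_ord_mult has_ord_const False x2)
            thus ?thesis using has_ord_add_less[OF R c] by simp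
          qed (use c in simp)
        qed
        have "?L = (\<lambda>Q. 1 * (yc Q - yc R) + (- l) * (xc Q - xc R))"
          using L0 by (auto simp: algebra_simps)
        hence oL: "ord_at E R ?L = 1" using ord_at_has_ord[OF R one[of 1 "- l"]] by simp
        have "?M R = 0" using MR L0 True by simp
        hence "?M = (\<lambda>Q. (- 1) * (yc Q - yc R) + (- (a\<^sub>1 E + l)) * (xc Q - xc R))"
          by (auto simp: algebra_simps)
        hence oM: "ord_at E R ?M = 1" using ord_at_has_ord[OF R one[of "- 1" "- (a\<^sub>1 E + l)"]] by simp
        have "R = ec_neg E S \<longleftrightarrow> R = S" for S using True by (metis ec_neg_neg)
        hence "(\<Sum>i<3. of_bool (R = ?A i)) + (\<Sum>i<3. of_bool (R = ?A i)) = (2::int)"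
          using sum oL oM by (simp add: sum.distrib del: ec_neg.simps)
        hence "(\<Sum>i<3. of_bool (R = ?A i)) = (1::int)" by linarith
        thus ?thesis using nzL oL Rfin by simp
      qed
    qed
  qed
qed

text \<open>The line through P and Q divided by the vertical line through P + Q; for Q = -P the
  vertical line alone. Every function with a prescribed divisor below is assembled from
  these.\<close>

lemma ex_add_function:
  assumes P: "P \<in> ec_points E" and Q: "Q \<in> ec_points E"
  shows "\<exists>h. nzfun h \<and> (\<forall>R\<in>ec_points E. ord_at E R h =
     of_bool (R = P) + of_bool (R = Q) - of_bool (R = ec_add E P Q) - of_bool (R = Infinity))"
proof (cases "P = Infinity \<or> Q = Infinity")
  case True
  have "ec_add E P Q = (if P = Infinity then Q else P)" using True by (cases P; cases Q) auto
  thus ?thesis using True nzfun_const[of 1] ord_const[of 1] by (intro exI[of _ "\<lambda>_. 1"]) auto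
next
  case False
  then obtain x1 y1 x2 y2 where PQ: "P = Affine x1 y1" "Q = Affine x2 y2" by (cases P; cases Q) auto
  show ?thesis
  proof (cases "x1 = x2 \<and> y1 + y2 + a\<^sub>1 E * x2 + a\<^sub>3 E = 0")
    case True
    hence "y2 = - y1 - a\<^sub>1 E * x1 - a\<^sub>3 E" by (simp add: algebra_simps eq_neg_iff_add_eq_0)
    hence "Q = ec_neg E P" "ec_add E P Q = Infinity" using True PQ by auto
    thus ?thesis using nzfun_xc_minus[of "xc P"] ord_xc_minus[OF _ P] False
      by (intro exI[of _ "\<lambda>Q. xc Q - xc P"]) auto
  next
    case nf: False
    obtain l n x3 where l: "ec_add E P Q = Affine x3 (- (l + a\<^sub>1 E) * x3 - n - a\<^sub>3 E)"
      "y1 = l * x1 + n" "y2 = l * x2 + n"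
      "\<And>x. (l * x + n)\<^sup>2 + (a\<^sub>1 E * x + a\<^sub>3 E) * (l * x + n) - (x ^ 3 + a\<^sub>2 E * x\<^sup>2 + a\<^sub>4 E * x + a\<^sub>6 E) =
        - ((x - x1) * (x - x2) * (x - x3))"
      using ec_add_line[OF _ _ nf] P Q unfolding PQ by metis
    define S where "S = ec_add E P Q"
    have S: "S \<in> ec_points E" "S \<noteq> Infinity" using ec_add_in[OF P Q] l(1) by (auto simp: S_def)
    have nS: "ec_neg E S = Affine x3 (l * x3 + n)" unfolding S_def l(1) by (simp add: algebra_simps)
    define x where "x = (\<lambda>i::nat. if i = 0 then x1 else if i = 1 then x2 else x3)"
    have 3: "{..<3} = {0, 1, 2::nat}" by auto
    have "Affine (x i) (l * x i + n) \<in> ec_points E" if "i \<in> {..<3}" for i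
      using that P Q S ec_neg_in[OF S(1)] unfolding 3 by (auto simp: x_def PQ l(2,3) nS)
    moreover have "(l * z + n)\<^sup>2 + (a\<^sub>1 E * z + a\<^sub>3 E) * (l * z + n) - (z ^ 3 + a\<^sub>2 E * z\<^sup>2 + a\<^sub>4 E * z + a\<^sub>6 E) =
        - (\<Prod>i<3. z - x i)" for z
      using l(4)[of z] unfolding 3 by (simp add: x_def)
    ultimately have line: "nzfun (\<lambda>Q. yc Q - l * xc Q - n) \<and>
      ord_at E R (\<lambda>Q. yc Q - l * xc Q - n) = (\<Sum>i<3. of_bool (R = Affine (x i) (l * x i + n))) - 3 * of_bool (R = Infinity)"
      if "R \<in> ec_points E" for R using ord_line[of x l n R] that by blast
    have sum: "(\<Sum>i<3. of_bool (R = Affine (x i) (l * x i + n))) = (of_bool (R = P) + of_bool (R = Q) + of_bool (R = ec_neg E S) :: int)" for R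
      unfolding 3 by (simp add: x_def PQ l(2,3)[symmetric] nS)
    show ?thesis
    proof (intro exI[of _ "\<lambda>Q. (yc Q - l * xc Q - n) / (xc Q - xc S)"] conjI ballI)
      have L: "nzfun (\<lambda>Q. yc Q - l * xc Q - n)" using line[OF Infinity_in] by blast
      show "nzfun (\<lambda>Q. (yc Q - l * xc Q - n) / (xc Q - xc S))"
        by (intro nzfun_divide L nzfun_xc_minus)
      fix R assume R: "R \<in> ec_points E"
      show "ord_at E R (\<lambda>Q. (yc Q - l * xc Q - n) / (xc Q - xc S)) =
         of_bool (R = P) + of_bool (R = Q) - of_bool (R = ec_add E P Q) - of_bool (R = Infinity)"
        using ord_divide[OF L nzfun_xc_minus R, of "xc S"] line[OF R] sum[of R] ord_xc_minus[OF R S] unfolding S_def[symmetric] by simp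
    qed
  qed
qed

section \<open>Commutativity and associativity\<close>

lemma ec_add_commute:
  assumes "P \<in> ec_points E" "Q \<in> ec_points E"
  shows "ec_add E P Q = ec_add E Q P"
proof -
  obtain h where h: "nzfun h" "\<forall>R\<in>ec_points E. ord_at E R h =
     of_bool (R = P) + of_bool (R = Q) - of_bool (R = ec_add E P Q) - of_bool (R = Infinity)"
    using ex_add_function[OF assms] by blast
  obtain k where k: "nzfun k" "\<forall>R\<in>ec_points E. ord_at E R k =
     of_bool (R = Q) + of_bool (R = P) - of_bool (R = ec_add E Q P) - of_bool (R = Infinity)"
    using ex_add_function[OF assms(2,1)] by blast
  have "ec_add E Q P = ec_add E P Q"
    by (rule principal_difference[OF nzfun_divide[OF h(1) k(1)]]) (use assms h k ord_divide[OF h(1) k(1)] in auto)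
  thus ?thesis ..
qed

lemma ec_add_assoc:
  assumes "P \<in> ec_points E" "Q \<in> ec_points E" "R \<in> ec_points E"
  shows "ec_add E (ec_add E P Q) R = ec_add E P (ec_add E Q R)"
proof -
  obtain h where h: "nzfun h" "\<forall>S\<in>ec_points E. ord_at E S h =
     of_bool (S = P) + of_bool (S = Q) - of_bool (S = ec_add E P Q) - of_bool (S = Infinity)"
    using ex_add_function[OF assms(1,2)] by blast
  obtain h' where h': "nzfun h'" "\<forall>S\<in>ec_points E. ord_at E S h' =
     of_bool (S = ec_add E P Q) + of_bool (S = R) - of_bool (S = ec_add E (ec_add E P Q) R) - of_bool (S = Infinity)"
    using ex_add_function[OF ec_add_in[OF assms(1,2)] assms(3)] by blast
  obtain k where k: "nzfun k" "\<forall>S\<in>ec_points E. ord_at E S k =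
     of_bool (S = Q) + of_bool (S = R) - of_bool (S = ec_add E Q R) - of_bool (S = Infinity)"
    using ex_add_function[OF assms(2,3)] by blast
  obtain k' where k': "nzfun k'" "\<forall>S\<in>ec_points E. ord_at E S k' =
     of_bool (S = P) + of_bool (S = ec_add E Q R) - of_bool (S = ec_add E P (ec_add E Q R)) - of_bool (S = Infinity)"
    using ex_add_function[OF assms(1) ec_add_in[OF assms(2,3)]] by blast
  note n = nzfun_mult[OF h(1) h'(1)] nzfun_mult[OF k(1) k'(1)]
  show ?thesis
    \<comment> \<open>The quotient has divisor ((P + Q) + R) - (P + (Q + R)).\<close>
    by (rule principal_difference[OF nzfun_divide[OF n(2,1)]])
       (use assms h h' k k' ord_divide[OF n(2,1)] ord_mult[OF h(1) h'(1)] ord_mult[OF k(1) k'(1)] in auto)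
qed

end

section \<open>Translations\<close>

context elliptic
begin

definition EG :: "'k ec_point monoid" where
  "EG = \<lparr>carrier = ec_points E, monoid.mult = ec_add E, one = Infinity\<rparr>"

lemma EG_simps [simp]: "carrier EG = ec_points E" "monoid.mult EG = ec_add E" "\<one>\<^bsub>EG\<^esub> = Infinity"
  by (simp_all add: EG_def)

lemma ec_add_Infinity_right [simp]: "ec_add E P Infinity = P"
  by (cases P) auto

lemma ec_add_neg [simp]: "ec_add E P (ec_neg E P) = Infinity"
  by (cases P) auto

lemma ec_add_neg_left [simp]: "ec_add E (ec_neg E P) P = Infinity"
  by (cases P) auto

sublocale EG: comm_group EG
proof (rule comm_groupI)
  fix P assume "P \<in> carrier EG"
  thus "\<exists>Q\<in>carrier EG. Q \<otimes>\<^bsub>EG\<^esub> P = \<one>\<^bsub>EG\<^esub>"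
    by (auto intro!: bexI[of _ "ec_neg E P"])
qed (auto simp: ec_add_assoc intro: ec_add_commute)

lemma EG_inv: "P \<in> ec_points E \<Longrightarrow> inv\<^bsub>EG\<^esub> P = ec_neg E P"
  using EG.inv_equality[of "ec_neg E P" P] by simp

lemma ec_add_cancel_right [simp]:
  "P \<in> ec_points E \<Longrightarrow> Q \<in> ec_points E \<Longrightarrow> S \<in> ec_points E \<Longrightarrow> ec_add E P S = ec_add E Q S \<longleftrightarrow> P = Q"
  using EG.right_cancel[of S P Q] by simp

lemma ec_add_cancel_left [simp]:
  "P \<in> ec_points E \<Longrightarrow> Q \<in> ec_points E \<Longrightarrow> S \<in> ec_points E \<Longrightarrow> ec_add E S P = ec_add E S Q \<longleftrightarrow> P = Q"
  using EG.l_cancel[of S P Q] by auto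

lemma ec_neg_add:
  "P \<in> ec_points E \<Longrightarrow> Q \<in> ec_points E \<Longrightarrow> ec_neg E (ec_add E P Q) = ec_add E (ec_neg E P) (ec_neg E Q)"
  using EG.inv_mult[of P Q] by (simp add: EG_inv)

lemma ec_add_eq_Infinity_iff:
  "P \<in> ec_points E \<Longrightarrow> Q \<in> ec_points E \<Longrightarrow> ec_add E P Q = Infinity \<longleftrightarrow> P = ec_neg E Q"
  using EG.inv_equality[of P Q] by (auto simp: EG_inv)

lemma ec_add_neg_cancel [simp]:
  "P \<in> ec_points E \<Longrightarrow> S \<in> ec_points E \<Longrightarrow> ec_add E (ec_add E P S) (ec_neg E S) = P"
  "P \<in> ec_points E \<Longrightarrow> S \<in> ec_points E \<Longrightarrow> ec_add E (ec_add E P (ec_neg E S)) S = P"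
  by (simp_all add: ec_add_assoc)

lemma ec_mult_eq_pow: "P \<in> ec_points E \<Longrightarrow> ec_mult E n P = P [^]\<^bsub>EG\<^esub> n"
proof (induction n)
  case (Suc n)
  hence "ec_mult E (Suc n) P = ec_add E P (P [^]\<^bsub>EG\<^esub> n)"
    by (simp add: ec_mult_def)
  thus ?case using Suc(2) EG.nat_pow_closed[of P n] by (simp add: ec_add_commute)
qed (simp add: ec_mult_def)

lemma inj_on_add: "S \<in> ec_points E \<Longrightarrow> inj_on (\<lambda>Q. ec_add E Q S) (ec_points E)"
  by (auto simp: inj_on_def)

lemma eventually_translate:
  "S \<in> ec_points E \<Longrightarrow> eventually P generic \<Longrightarrow> \<forall>\<^sub>F Q in generic. P (ec_add E Q S)"
  by (rule eventually_generic_inj[OF inj_on_add]) auto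

lemma regular_pullback:
  assumes P: "P' \<in> ec_points E" "P \<in> ec_points E"
    and \<phi>: "inj_on \<phi> (ec_points E)" "\<And>Q. Q \<in> ec_points E \<Longrightarrow> \<phi> Q \<in> ec_points E"
    and c: "regular P (\<lambda>Q. chart1 P' (\<phi> Q)) (xc P')" "regular P (\<lambda>Q. chart2 P' (\<phi> Q)) (yc P')"
    and f: "regular P' f a"
  shows "regular P (\<lambda>Q. f (\<phi> Q)) a"
proof (rule regular_induct[OF P(1) f])
  fix f g a assume "regular P (\<lambda>Q. f (\<phi> Q)) a" "\<forall>\<^sub>F Q in generic. f Q = g Q"
  thus "regular P (\<lambda>Q. g (\<phi> Q)) a"
    using eventually_generic_inj[of \<phi> "\<lambda>Q. f Q = g Q"] \<phi> by (blast intro: regular_cong[of P "\<lambda>Q. f (\<phi> Q)" a "\<lambda>Q. g (\<phi> Q)"])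
qed (auto intro: regular_const regular_add[OF P(2)] regular_mult regular_inverse c)

lemma ratfun_pullback:
  assumes \<phi>: "inj_on \<phi> (ec_points E)" "\<And>Q. Q \<in> ec_points E \<Longrightarrow> \<phi> Q \<in> ec_points E"
    and c: "ratfun (\<lambda>Q. xc (\<phi> Q))" "ratfun (\<lambda>Q. yc (\<phi> Q))" and f: "ratfun f"
  shows "ratfun (\<lambda>Q. f (\<phi> Q))"
proof -
  obtain n g p where g: "polyfun n g" "p \<noteq> 0" "\<forall>\<^sub>F Q in generic. f Q = g Q / poly p (xc Q)"
    using f unfolding ratfun_def by blast
  obtain a b where ab: "\<forall>Q\<in>ec_points E - {Infinity}. g Q = coordfun a b Q"
    using g(1) unfolding polyfun_def by blast
  have "\<forall>\<^sub>F Q in generic. coordfun a b Q / poly p (xc Q) = f Q"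
    using g(3) eventually_affine by eventually_elim (use ab in simp)
  hence "\<forall>\<^sub>F Q in generic. coordfun a b (\<phi> Q) / poly p (xc (\<phi> Q)) = f (\<phi> Q)"
    by (rule eventually_generic_inj[rotated 2]) (use \<phi> in auto)
  moreover have "ratfun (\<lambda>Q. coordfun a b (\<phi> Q) / poly p (xc (\<phi> Q)))"
    unfolding coordfun_def by (intro ratfun_divide ratfun_add ratfun_mult ratfun_poly c)
  ultimately show ?thesis by (rule ratfun_cong[rotated])
qed

text \<open>Pullback along \<phi> multiplies orders by e, the order at P of the pulled back
  uniformizer. The rational inverse \<psi> provides a function h whose pullback is
  \<open>unif P\<close>, of order 1, so e divides 1.\<close>

lemma ord_pullback:
  assumes P: "P' \<in> ec_points E" "P \<in> ec_points E"
    and \<phi>: "inj_on \<phi> (ec_points E)" "\<And>Q. Q \<in> ec_points E \<Longrightarrow> \<phi> Q \<in> ec_points E"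
    and inv: "\<And>Q. Q \<in> ec_points E \<Longrightarrow> \<psi> (\<phi> Q) = Q"
    and ratfun: "\<And>f. ratfun f \<Longrightarrow> ratfun (\<lambda>Q. f (\<phi> Q))" "\<And>f. ratfun f \<Longrightarrow> ratfun (\<lambda>Q. f (\<psi> Q))"
    and regular: "\<And>f a. regular P' f a \<Longrightarrow> regular P (\<lambda>Q. f (\<phi> Q)) a"
    and f: "nzfun f"
  shows "nzfun (\<lambda>Q. f (\<phi> Q)) \<and> ord_at E P (\<lambda>Q. f (\<phi> Q)) = ord_at E P' f"
proof -
  have ev: "\<forall>\<^sub>F Q in generic. R (\<phi> Q)" if "eventually R generic" for R
    by (rule eventually_generic_inj[rotated 2, OF that]) (use \<phi> in auto)
  have nzfun: "nzfun (\<lambda>Q. g (\<phi> Q))" if "nzfun g" for g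
    using that ratfun(1) ev[of "\<lambda>Q. g Q \<noteq> 0"] by (simp add: nzfun_def)
  define e where "e = ord_at E P (\<lambda>Q. unif P' (\<phi> Q))"
  have u: "nzfun (unif P')" using nzI[OF P(1) has_ord_unif] .
  have ve: "has_ord P (\<lambda>Q. unif P' (\<phi> Q)) e" unfolding e_def by (rule nzfun_has_ord[OF nzfun[OF u] P(2)])
  have e: "e > 0" using regular_has_ord[OF P(2) ve regular[OF regular_unif[OF P(1)]]] by blast
  have ord: "ord_at E P (\<lambda>Q. g (\<phi> Q)) = ord_at E P' g * e" if g: "nzfun g" for g
  proof -
    obtain w a where w: "a \<noteq> 0" "regular P' w a" "\<forall>\<^sub>F Q in generic. g Q = unif P' Q powi ord_at E P' g * w Q"
      using nzfun_has_ord[OF g P(1)] unfolding has_ord_def by blast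
    have "has_ord P (\<lambda>Q. unif P' (\<phi> Q) powi ord_at E P' g * w (\<phi> Q)) (ord_at E P' g * e + 0)"
      by (intro has_ord_mult has_ord_power_int ve has_ord_regular[OF regular[OF w(2)] w(1)])
    moreover have "\<forall>\<^sub>F Q in generic. unif P' (\<phi> Q) powi ord_at E P' g * w (\<phi> Q) = g (\<phi> Q)"
      using ev[OF w(3)] by eventually_elim simp
    ultimately show ?thesis using ord_at_has_ord[OF P(2)] has_ord_cong by fastforce
  qed
  have "e = 1"
  proof -
    define h where "h = (\<lambda>Q. unif P (\<psi> Q))"
    have eq: "\<forall>\<^sub>F Q in generic. h (\<phi> Q) = unif P Q"
      using eventually_affine by eventually_elim (simp add: h_def inv)
    have "ratfun h" unfolding h_def by (rule ratfun(2)) (use has_ord_ratfun[OF has_ord_unif] in blast)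
    moreover have "\<not> (\<forall>\<^sub>F Q in generic. h Q = 0)"
    proof
      assume "\<forall>\<^sub>F Q in generic. h Q = 0"
      hence "\<forall>\<^sub>F Q in generic. h (\<phi> Q) = 0" by (rule ev)
      with eq eventually_unif_neq_0[of P] have "\<forall>\<^sub>F Q in generic. False" by eventually_elim simp
      thus False by simp
    qed
    ultimately have h: "nzfun h" by (simp add: nzfun_iff)
    have "ord_at E P (\<lambda>Q. h (\<phi> Q)) = 1"
      using ord_cong[OF nzfun[OF h] eq P(2)] ord_at_has_ord[OF P(2) has_ord_unif] by simp
    hence "ord_at E P' h * e = 1" using ord[OF h] by simp
    thus ?thesis using e by (simp add: pos_zmult_eq_1_iff mult.commute)
  qed
  thus ?thesis using ord[OF f] nzfun[OF f] by simp
qed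

section \<open>Translation by a point in coordinates\<close>

definition slope :: "'k ec_point \<Rightarrow> 'k ec_point \<Rightarrow> 'k" where
  "slope S Q = (yc Q - yc S) / (xc Q - xc S)"

definition addx :: "'k ec_point \<Rightarrow> 'k ec_point \<Rightarrow> 'k" where
  "addx S Q = (slope S Q)\<^sup>2 + a\<^sub>1 E * slope S Q - a\<^sub>2 E - xc Q - xc S"

definition addy :: "'k ec_point \<Rightarrow> 'k ec_point \<Rightarrow> 'k" where
  "addy S Q = - (slope S Q * (addx S Q - xc S)) - a\<^sub>1 E * addx S Q - yc S - a\<^sub>3 E"

lemma ec_add_formula:
  assumes "S \<noteq> Infinity" "Q \<noteq> Infinity" "xc Q \<noteq> xc S"
  shows "ec_add E Q S = Affine (addx S Q) (addy S Q)"
proof -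
  obtain x y where Q: "Q = Affine x y" using assms by (cases Q) auto
  obtain x' y' where S: "S = Affine x' y'" using assms by (cases S) auto
  have ne: "x' - x \<noteq> 0" "x - x' \<noteq> 0" using assms Q S by auto
  define l where "l = (y' - y) / (x' - x)"
  have l: "slope S Q = l" unfolding slope_def l_def Q S xc.simps yc.simps
    using minus_divide_divide[of "y - y'" "x - x'"] by simp
  have "l * (x' - x) = y' - y" using ne by (simp add: l_def)
  hence n: "y - l * x = y' - l * x'" by (simp add: algebra_simps)
  have "ec_add E Q S = Affine (l\<^sup>2 + a\<^sub>1 E * l - a\<^sub>2 E - x - x')
     (- (l + a\<^sub>1 E) * (l\<^sup>2 + a\<^sub>1 E * l - a\<^sub>2 E - x - x') - (y - l * x) - a\<^sub>3 E)"
    using assms Q S by (simp add: Let_def l_def)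
  thus ?thesis unfolding n addy_def addx_def l unfolding Q S xc.simps yc.simps
    by (simp add: algebra_simps)
qed

text \<open>In the definition of \<open>addx\<close> the poles of slope^2 and x(Q) at infinity
  cancel. In this form they are gone, and the value x(S) of x(Q + S) at Q = O is visible.\<close>

lemma addx_identity:
  assumes "S \<in> ec_points E" "S \<noteq> Infinity" "Q \<in> ec_points E" "Q \<noteq> Infinity" "xc Q \<noteq> xc S"
  shows "addx S Q = xc S + (W\<^sub>x (xc S) (yc S) - slope S Q * W\<^sub>y (xc S) (yc S)) / (xc Q - xc S)"
proof -
  define x y x' y' d where xy: "x = xc Q" "y = yc Q" "x' = xc S" "y' = yc S" "d = x - x'"
  have d: "d \<noteq> 0" using assms xy by simp
  define l where "l = slope S Q"
  have ly: "y = y' + l * d" using d by (simp add: l_def slope_def xy)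
  have xd: "x = x' + d" by (simp add: xy)
  have "(y - y') * (y + y' + a\<^sub>1 E * x + a\<^sub>3 E) = (x - x') * (x\<^sup>2 + x * x' + x'\<^sup>2 + a\<^sub>2 E * (x + x') + a\<^sub>4 E - a\<^sub>1 E * y')"
    using chord_identity[OF assms(1-4)] by (simp add: xy)
  hence "d * (l * (y + y' + a\<^sub>1 E * x + a\<^sub>3 E)) = d * (x\<^sup>2 + x * x' + x'\<^sup>2 + a\<^sub>2 E * (x + x') + a\<^sub>4 E - a\<^sub>1 E * y')"
    by (simp add: ly xd algebra_simps)
  hence "l * (y + y' + a\<^sub>1 E * x + a\<^sub>3 E) = x\<^sup>2 + x * x' + x'\<^sup>2 + a\<^sub>2 E * (x + x') + a\<^sub>4 E - a\<^sub>1 E * y'"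
    using d by simp
  hence "(l\<^sup>2 + a\<^sub>1 E * l - a\<^sub>2 E - x - x' - x') * d = W\<^sub>x x' y' - l * W\<^sub>y x' y'"
    unfolding ly xd W\<^sub>x_def W\<^sub>y_def by (simp add: power2_eq_square algebra_simps)
  hence "addx S Q - x' = (W\<^sub>x x' y' - l * W\<^sub>y x' y') / d"
    using d by (simp add: addx_def l_def xy eq_divide_eq)
  thus ?thesis by (simp add: l_def xy diff_eq_eq add.commute)
qed

lemma eventually_add_formula:
  assumes "S \<in> ec_points E" "S \<noteq> Infinity"
  shows "\<forall>\<^sub>F Q in generic. addx S Q = xc (ec_add E Q S) \<and> addy S Q = yc (ec_add E Q S)"
  using eventually_affine eventually_xc_neq[of "xc S"]
  by eventually_elim (use assms ec_add_formula in simp)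

lemma ratfun_translate:
  assumes S: "S \<in> ec_points E" and f: "ratfun f"
  shows "ratfun (\<lambda>Q. f (ec_add E Q S))"
proof (cases "S = Infinity")
  case False
  have sl: "ratfun (slope S)" unfolding slope_def[abs_def] by (intro ratfun_divide ratfun_diff ratfun_xc ratfun_yc ratfun_const)
  have ax: "ratfun (addx S)" unfolding addx_def[abs_def] by (intro ratfun_diff ratfun_add ratfun_mult ratfun_power sl ratfun_xc ratfun_const)
  have ay: "ratfun (addy S)" unfolding addy_def[abs_def] by (intro ratfun_diff ratfun_minus ratfun_mult sl ax ratfun_xc ratfun_const)
  have "\<forall>\<^sub>F Q in generic. addx S Q = xc (ec_add E Q S)" "\<forall>\<^sub>F Q in generic. addy S Q = yc (ec_add E Q S)"
    using eventually_add_formula[OF S False] by (auto elim: eventually_mono)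
  hence "ratfun (\<lambda>Q. xc (ec_add E Q S))" "ratfun (\<lambda>Q. yc (ec_add E Q S))"
    by (auto intro: ratfun_cong[OF ax] ratfun_cong[OF ay])
  from ratfun_pullback[OF inj_on_add[OF S] _ this f] show ?thesis using S by simp
qed (use f in simp)

lemma nzfun_translate:
  assumes "S \<in> ec_points E" "nzfun f"
  shows "nzfun (\<lambda>Q. f (ec_add E Q S))"
  using assms ratfun_translate eventually_translate[of S "\<lambda>Q. f Q \<noteq> 0"] by (simp add: nzfun_def)

lemma ord_translate_local:
  assumes S: "S \<in> ec_points E" "S \<noteq> Infinity" and P: "P \<in> ec_points E" and PS: "ec_add E P S \<noteq> Infinity"
    and c: "regular P (addx S) (xc (ec_add E P S))" "regular P (addy S) (yc (ec_add E P S))"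
    and f: "nzfun f"
  shows "ord_at E P (\<lambda>Q. f (ec_add E Q S)) = ord_at E (ec_add E P S) f"
proof -
  have ev: "\<forall>\<^sub>F Q in generic. addx S Q = xc (ec_add E Q S)" "\<forall>\<^sub>F Q in generic. addy S Q = yc (ec_add E Q S)"
    using eventually_add_formula[OF S] by (auto elim: eventually_mono)
  have c': "regular P (\<lambda>Q. chart1 (ec_add E P S) (ec_add E Q S)) (xc (ec_add E P S))"
    "regular P (\<lambda>Q. chart2 (ec_add E P S) (ec_add E Q S)) (yc (ec_add E P S))"
    using regular_cong[OF c(1) ev(1)] regular_cong[OF c(2) ev(2)] PS by (simp_all add: chart1_def chart2_def)
  have add: "ec_add E Q S \<in> ec_points E" if "Q \<in> ec_points E" for Q using S that by simp
  show ?thesis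
    by (rule conjunct2[OF ord_pullback[where \<psi> = "\<lambda>Q. ec_add E Q (ec_neg E S)", OF _ P inj_on_add[OF S(1)] add]])
       (use S P f ratfun_translate[OF S(1)] ratfun_translate[OF ec_neg_in[OF S(1)]] regular_pullback[OF _ P inj_on_add[OF S(1)] add c'] in auto)
qed

lemma ord_translate_generic:
  assumes S: "S \<in> ec_points E" "S \<noteq> Infinity" and P: "P \<in> ec_points E" "P \<noteq> Infinity" and ne: "xc P \<noteq> xc S"
    and f: "nzfun f"
  shows "ord_at E P (\<lambda>Q. f (ec_add E Q S)) = ord_at E (ec_add E P S) f"
proof -
  have sl: "regular P (slope S) (slope S P)"
    unfolding slope_def[abs_def] by (intro regular_divide regular_diff regular_xc regular_yc regular_const P) (use ne in simp)
  have ax: "regular P (addx S) (addx S P)"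
    unfolding addx_def[abs_def] by (intro regular_diff regular_add regular_mult regular_power sl regular_xc regular_const P)
  have ay: "regular P (addy S) (addy S P)"
    unfolding addy_def[abs_def] by (intro regular_diff regular_minus regular_mult sl ax regular_xc regular_const P)
  show ?thesis
    using ord_translate_local[OF S P(1) _ _ _ f] ax ay ec_add_formula[OF S(2) P(2) ne] by simp
qed

lemma ord_translate_Infinity:
  assumes S: "S \<in> ec_points E" "S \<noteq> Infinity" and f: "nzfun f"
  shows "ord_at E Infinity (\<lambda>Q. f (ec_add E Q S)) = ord_at E S f"
proof -
  let ?x = "\<lambda>Q. xc Q - xc S"
  have y: "has_ord Infinity (\<lambda>Q. yc Q - yc S) (-3)"
    using has_ord_coordfun_inf[of "[:- yc S:]" 1] by (simp add: coordfun_def[abs_def])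
  have pos: "regular Infinity g 0" if "has_ord Infinity g n" "n > 0" for g n
    using has_ord_nonneg_regular[OF Infinity_in that(1)] that(2) by auto
  have ix: "regular Infinity (\<lambda>Q. 1 / ?x Q) 0"
    by (rule pos[OF has_ord_divide[OF has_ord_const[OF one_neq_zero] has_ord_xc_inf]]) simp
  have sx: "regular Infinity (\<lambda>Q. slope S Q / ?x Q) 0"
    unfolding slope_def by (rule pos[OF has_ord_divide[OF has_ord_divide[OF y has_ord_xc_inf] has_ord_xc_inf]]) simp
  have ax: "regular Infinity (addx S) (xc S)"
  proof (rule regular_cong)
    show "regular Infinity (\<lambda>Q. xc S + (W\<^sub>x (xc S) (yc S) * (1 / ?x Q) - W\<^sub>y (xc S) (yc S) * (slope S Q / ?x Q))) (xc S)"
      using regular_add[OF Infinity_in regular_const[of _ "xc S"] regular_diff[OF Infinity_in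
        regular_mult[OF regular_const[of _ "W\<^sub>x (xc S) (yc S)"] ix] regular_mult[OF regular_const[of _ "W\<^sub>y (xc S) (yc S)"] sx]]] by simp
    show "\<forall>\<^sub>F Q in generic. xc S + (W\<^sub>x (xc S) (yc S) * (1 / ?x Q) - W\<^sub>y (xc S) (yc S) * (slope S Q / ?x Q)) = addx S Q"
      using eventually_affine eventually_xc_neq[of "xc S"]
      by eventually_elim (use addx_identity[OF S] in \<open>simp add: diff_divide_distrib mult.commute\<close>)
  qed
  \<comment> \<open>Solve the definition of \<open>addx\<close> for slope^2: one term is x - x(S)
    itself and gives the value 1, the others vanish at infinity after division by x - x(S).\<close>
  have s2: "regular Infinity (\<lambda>Q. (slope S Q)\<^sup>2 / ?x Q) 1"
  proof (rule regular_cong)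
    show "regular Infinity (\<lambda>Q. (addx S Q + a\<^sub>2 E + 2 * xc S) * (1 / ?x Q) - a\<^sub>1 E * (slope S Q / ?x Q) + 1) 1"
      using regular_add[OF Infinity_in regular_diff[OF Infinity_in
        regular_mult[OF regular_add[OF Infinity_in regular_add[OF Infinity_in ax regular_const[of _ "a\<^sub>2 E"]] regular_const[of _ "2 * xc S"]] ix]
        regular_mult[OF regular_const[of _ "a\<^sub>1 E"] sx]] regular_const[of _ 1]] by simp
    show "\<forall>\<^sub>F Q in generic. (addx S Q + a\<^sub>2 E + 2 * xc S) * (1 / ?x Q) - a\<^sub>1 E * (slope S Q / ?x Q) + 1 = (slope S Q)\<^sup>2 / ?x Q"
      using eventually_xc_neq[of "xc S"]
    proof eventually_elim
      case (elim Q)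
      have A: "(slope S Q)\<^sup>2 = (addx S Q + a\<^sub>2 E + 2 * xc S) - a\<^sub>1 E * slope S Q + ?x Q" by (simp add: addx_def)
      have B: "(u - a\<^sub>1 E * v + d) / d = u * (1 / d) - a\<^sub>1 E * (v / d) + 1" if "d \<noteq> 0" for u v d :: 'k
        using that by (simp add: add_divide_distrib diff_divide_distrib)
      show ?case unfolding A by (rule B[symmetric]) (use elim in simp)
    qed
  qed
  have ay: "regular Infinity (addy S) (yc S)"
  proof (rule regular_cong)
    let ?g = "\<lambda>Q. - (W\<^sub>x (xc S) (yc S) * (slope S Q / ?x Q) - W\<^sub>y (xc S) (yc S) * ((slope S Q)\<^sup>2 / ?x Q)) - a\<^sub>1 E * addx S Q - yc S - a\<^sub>3 E"
    have "regular Infinity ?g (- (W\<^sub>x (xc S) (yc S) * 0 - W\<^sub>y (xc S) (yc S) * 1) - a\<^sub>1 E * xc S - yc S - a\<^sub>3 E)"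
      by (intro regular_diff regular_minus regular_mult regular_const sx s2 ax Infinity_in)
    moreover have "- (W\<^sub>x (xc S) (yc S) * 0 - W\<^sub>y (xc S) (yc S) * 1) - a\<^sub>1 E * xc S - yc S - a\<^sub>3 E = yc S"
      by (simp add: W\<^sub>y_def)
    ultimately show "regular Infinity ?g (yc S)" by (simp only:)
    show "\<forall>\<^sub>F Q in generic. ?g Q = addy S Q"
      using eventually_affine eventually_xc_neq[of "xc S"]
    proof eventually_elim
      case (elim Q)
      have "slope S Q * (addx S Q - xc S) = slope S Q * (W\<^sub>x (xc S) (yc S) - slope S Q * W\<^sub>y (xc S) (yc S)) / ?x Q"
        using addx_identity[OF S, of Q] elim by simp
      also have "\<dots> = W\<^sub>x (xc S) (yc S) * (slope S Q / ?x Q) - W\<^sub>y (xc S) (yc S) * ((slope S Q)\<^sup>2 / ?x Q)"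
        by (simp add: right_diff_distrib diff_divide_distrib power2_eq_square mult_ac)
      finally show ?case by (simp add: addy_def)
    qed
  qed
  show ?thesis using ord_translate_local[OF S Infinity_in _ _ _ f] ax ay S by simp
qed

text \<open>The chord formula applies where x(P) and x(S) differ, and P = O is treated separately.
  The case P = -S is that of infinity for the inverse translation. For P = S, where the chord
  degenerates to a tangent, the translation is split into those by T and by S - T for a generic
  T.\<close>

lemma ord_translate:
  assumes S: "S \<in> ec_points E" and P: "P \<in> ec_points E" and f: "nzfun f"
  shows "ord_at E P (\<lambda>Q. f (ec_add E Q S)) = ord_at E (ec_add E P S) f"
proof -
  consider "S = Infinity" | "S \<noteq> Infinity" "P = Infinity" | "S \<noteq> Infinity" "P = ec_neg E S"
    | "S \<noteq> Infinity" "P = S" "ec_neg E S \<noteq> S" | "S \<noteq> Infinity" "P \<noteq> Infinity" "xc P \<noteq> xc S"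
    using same_xc[OF S P] by metis
  thus ?thesis
  proof cases
    case 3
    let ?g = "\<lambda>Q. f (ec_add E Q S)"
    have g: "nzfun ?g" by (rule nzfun_translate[OF S f])
    have "ord_at E Infinity (\<lambda>Q. ?g (ec_add E Q (ec_neg E S))) = ord_at E (ec_neg E S) ?g"
      using ord_translate_Infinity[OF ec_neg_in[OF S] _ g] 3 by simp
    moreover have "ord_at E Infinity (\<lambda>Q. ?g (ec_add E Q (ec_neg E S))) = ord_at E Infinity f"
    proof (rule ord_cong[OF f _ Infinity_in])
      show "\<forall>\<^sub>F Q in generic. f Q = ?g (ec_add E Q (ec_neg E S))"
        using eventually_affine by eventually_elim (use S in simp)
    qed
    ultimately show ?thesis using 3 by simp
  next
    case 4
    \<comment> \<open>T different from S and -S keeps x(S) and x(T) apart. T \<noteq> -T, from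
      \<open>W\<^sub>y\<close> \<noteq> 0, together with S \<noteq> -S keeps S + T apart from S - T
      and its negative.\<close>
    have "\<exists>T. (T \<in> ec_points E \<and> T \<noteq> Infinity) \<and> T \<noteq> S \<and> T \<noteq> ec_neg E S \<and> W\<^sub>y (xc T) (yc T) \<noteq> 0"
      by (intro eventually_generic_ex eventually_conj eventually_affine eventually_neq eventually_Wy_neq_0)
    then obtain T where T: "T \<in> ec_points E" "T \<noteq> Infinity" "T \<noteq> S" "T \<noteq> ec_neg E S" "ec_neg E T \<noteq> T"
      using neg_eq_self_iff by blast
    let ?D = "ec_add E S (ec_neg E T)"
    have D: "?D \<in> ec_points E" "?D \<noteq> Infinity"
      using S T ec_add_eq_Infinity_iff[of S "ec_neg E T"] by auto
    have ST: "ec_add E S T \<in> ec_points E" "ec_add E S T \<noteq> Infinity"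
      using S T ec_add_eq_Infinity_iff[of S T] by (auto simp: ec_add_commute)
    have x1: "xc S \<noteq> xc T" using same_xc[OF S T(1) 4(1) T(2)] T by auto
    have x2: "xc (ec_add E S T) \<noteq> xc ?D"
    proof
      assume "xc (ec_add E S T) = xc ?D"
      hence "ec_add E S T = ?D \<or> ec_add E S T = ec_neg E ?D"
        using same_xc[OF D(1) ST(1) D(2) ST(2)] by simp
      moreover have "ec_add E S T \<noteq> ?D" using S T by auto
      moreover have "ec_add E S T \<noteq> ec_neg E ?D" using S T 4 by (auto simp: ec_neg_add)
      ultimately show False by blast
    qed
    let ?g = "\<lambda>Q. f (ec_add E Q ?D)"
    have g: "nzfun ?g" by (rule nzfun_translate[OF D(1) f])
    have s: "ec_add E (ec_add E R T) ?D = ec_add E R S" if "R \<in> ec_points E" for R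
    proof -
      have "ec_add E T ?D = S" using S T by (simp add: ec_add_commute[of S] ec_add_assoc[symmetric])
      thus ?thesis using that S T D by (simp add: ec_add_assoc)
    qed
    have "ord_at E S (\<lambda>Q. ?g (ec_add E Q T)) = ord_at E (ec_add E S T) ?g"
      by (rule ord_translate_generic[OF T(1,2) S 4(1) x1 g])
    also have "\<dots> = ord_at E (ec_add E (ec_add E S T) ?D) f"
      by (rule ord_translate_generic[OF D ST x2 f])
    also have "ec_add E (ec_add E S T) ?D = ec_add E S S" by (rule s[OF S])
    finally have "ord_at E S (\<lambda>Q. ?g (ec_add E Q T)) = ord_at E (ec_add E S S) f" .
    moreover have "ord_at E S (\<lambda>Q. ?g (ec_add E Q T)) = ord_at E S (\<lambda>Q. f (ec_add E Q S))"
    proof (rule ord_cong[OF nzfun_translate[OF S f] _ S])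
      show "\<forall>\<^sub>F Q in generic. f (ec_add E Q S) = ?g (ec_add E Q T)"
        using eventually_affine by eventually_elim (use s in simp)
    qed
    ultimately show ?thesis using 4 by simp
  qed (use ord_translate_Infinity[OF S _ f] ord_translate_generic[OF S _ P _ _ f] in auto)
qed

end

section \<open>Surjectivity of multiplication\<close>

context elliptic
begin

text \<open>The coordinates return 0 at infinity, so a map that is generically O has to be a case of
  its own.\<close>

definition ratmap :: "('k ec_point \<Rightarrow> 'k ec_point) \<Rightarrow> bool" where
  "ratmap \<phi> \<longleftrightarrow> (\<forall>\<^sub>F Q in generic. \<phi> Q = Infinity) \<or>
     ((\<forall>\<^sub>F Q in generic. \<phi> Q \<noteq> Infinity) \<and> ratfun (\<lambda>Q. xc (\<phi> Q)) \<and> ratfun (\<lambda>Q. yc (\<phi> Q)))"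

lemma ratmap_cong:
  assumes "ratmap \<phi>" "\<forall>\<^sub>F Q in generic. \<phi> Q = \<psi> Q"
  shows "ratmap \<psi>"
proof (cases "\<forall>\<^sub>F Q in generic. \<phi> Q = Infinity")
  case True
  with assms(2) have "\<forall>\<^sub>F Q in generic. \<psi> Q = Infinity" by eventually_elim simp
  thus ?thesis by (simp add: ratmap_def)
next
  case False
  hence \<phi>: "\<forall>\<^sub>F Q in generic. \<phi> Q \<noteq> Infinity" "ratfun (\<lambda>Q. xc (\<phi> Q))" "ratfun (\<lambda>Q. yc (\<phi> Q))"
    using assms(1) by (auto simp: ratmap_def)
  have "\<forall>\<^sub>F Q in generic. \<psi> Q \<noteq> Infinity" using \<phi>(1) assms(2) by eventually_elim simp
  moreover have "ratfun (\<lambda>Q. xc (\<psi> Q))" by (rule ratfun_cong[OF \<phi>(2)]) (use assms(2) in eventually_elim, simp)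
  moreover have "ratfun (\<lambda>Q. yc (\<psi> Q))" by (rule ratfun_cong[OF \<phi>(3)]) (use assms(2) in eventually_elim, simp)
  ultimately show ?thesis by (simp add: ratmap_def)
qed

lemma ratmap_affineI:
  assumes "ratfun f" "ratfun g" "\<forall>\<^sub>F Q in generic. Affine (f Q) (g Q) = \<phi> Q"
  shows "ratmap \<phi>"
  using assms by (intro ratmap_cong[OF _ assms(3)]) (simp add: ratmap_def)

text \<open>Each test in the addition law compares rational functions, so by
  \<open>ratfun_cases\<close> it holds generically or fails generically, and a single branch of the
  formula describes the sum.\<close>

lemma ratmap_add:
  assumes \<phi>: "ratmap \<phi>" "\<forall>\<^sub>F Q in generic. \<phi> Q \<in> ec_points E" and \<psi>: "ratmap \<psi>" "\<forall>\<^sub>F Q in generic. \<psi> Q \<in> ec_points E"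
  shows "ratmap (\<lambda>Q. ec_add E (\<phi> Q) (\<psi> Q))"
proof -
  consider "\<forall>\<^sub>F Q in generic. \<phi> Q = Infinity" | "\<forall>\<^sub>F Q in generic. \<psi> Q = Infinity"
    | "\<forall>\<^sub>F Q in generic. \<phi> Q \<noteq> Infinity" "ratfun (\<lambda>Q. xc (\<phi> Q))" "ratfun (\<lambda>Q. yc (\<phi> Q))"
      "\<forall>\<^sub>F Q in generic. \<psi> Q \<noteq> Infinity" "ratfun (\<lambda>Q. xc (\<psi> Q))" "ratfun (\<lambda>Q. yc (\<psi> Q))"
    using \<phi>(1) \<psi>(1) unfolding ratmap_def by blast
  thus ?thesis
  proof cases
    case 1
    have "\<forall>\<^sub>F Q in generic. \<psi> Q = ec_add E (\<phi> Q) (\<psi> Q)" using 1 by eventually_elim simp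
    thus ?thesis by (rule ratmap_cong[OF \<psi>(1)])
  next
    case 2
    have "\<forall>\<^sub>F Q in generic. \<phi> Q = ec_add E (\<phi> Q) (\<psi> Q)" using 2 by eventually_elim simp
    thus ?thesis by (rule ratmap_cong[OF \<phi>(1)])
  next
    case 3
    note ffs = ratfun_divide ratfun_diff ratfun_add ratfun_mult ratfun_power ratfun_minus 3(2,3,5,6) ratfun_const
    have "ratfun (\<lambda>Q. xc (\<phi> Q) - xc (\<psi> Q))" by (intro ffs)
    from ratfun_cases[OF this] show ?thesis
    proof
      assume ne: "\<forall>\<^sub>F Q in generic. xc (\<phi> Q) - xc (\<psi> Q) \<noteq> 0"
      show ?thesis
      proof (rule ratmap_affineI)
        show "\<forall>\<^sub>F Q in generic. Affine (addx (\<psi> Q) (\<phi> Q)) (addy (\<psi> Q) (\<phi> Q)) = ec_add E (\<phi> Q) (\<psi> Q)"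
          using 3(1,4) ne by eventually_elim (simp add: ec_add_formula)
        show "ratfun (\<lambda>Q. addx (\<psi> Q) (\<phi> Q))" "ratfun (\<lambda>Q. addy (\<psi> Q) (\<phi> Q))"
          unfolding addy_def addx_def slope_def by (intro ffs)+
      qed
    next
      assume eq: "\<forall>\<^sub>F Q in generic. xc (\<phi> Q) - xc (\<psi> Q) = 0"
      have "ratfun (\<lambda>Q. yc (\<phi> Q) + yc (\<psi> Q) + a\<^sub>1 E * xc (\<psi> Q) + a\<^sub>3 E)" by (intro ffs)
      from ratfun_cases[OF this] show ?thesis
      proof
        assume "\<forall>\<^sub>F Q in generic. yc (\<phi> Q) + yc (\<psi> Q) + a\<^sub>1 E * xc (\<psi> Q) + a\<^sub>3 E = 0"
        with eq 3(1,4) have "\<forall>\<^sub>F Q in generic. ec_add E (\<phi> Q) (\<psi> Q) = Infinity"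
        proof eventually_elim
          case (elim Q)
          thus ?case by (cases "\<phi> Q"; cases "\<psi> Q") auto
        qed
        thus ?thesis by (simp add: ratmap_def)
      next
        assume ne: "\<forall>\<^sub>F Q in generic. yc (\<phi> Q) + yc (\<psi> Q) + a\<^sub>1 E * xc (\<psi> Q) + a\<^sub>3 E \<noteq> 0"
        define l where "l = (\<lambda>Q. (3 * (xc (\<phi> Q))\<^sup>2 + 2 * a\<^sub>2 E * xc (\<phi> Q) + a\<^sub>4 E - a\<^sub>1 E * yc (\<phi> Q)) / (2 * yc (\<phi> Q) + a\<^sub>1 E * xc (\<phi> Q) + a\<^sub>3 E))"
        define x3 where "x3 = (\<lambda>Q. (l Q)\<^sup>2 + a\<^sub>1 E * l Q - a\<^sub>2 E - xc (\<phi> Q) - xc (\<psi> Q))"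
        have l: "ratfun l" unfolding l_def by (intro ffs)
        have x3: "ratfun x3" unfolding x3_def by (intro ffs l)
        show ?thesis
        proof (rule ratmap_affineI[OF x3])
          show "ratfun (\<lambda>Q. - (l Q + a\<^sub>1 E) * x3 Q - (yc (\<phi> Q) - l Q * xc (\<phi> Q)) - a\<^sub>3 E)"
            by (intro ffs l x3)
          show "\<forall>\<^sub>F Q in generic. Affine (x3 Q) (- (l Q + a\<^sub>1 E) * x3 Q - (yc (\<phi> Q) - l Q * xc (\<phi> Q)) - a\<^sub>3 E) = ec_add E (\<phi> Q) (\<psi> Q)"
            using eq ne 3(1,4)
          proof eventually_elim
            case (elim Q)
            obtain x y where P: "\<phi> Q = Affine x y" using elim by (cases "\<phi> Q") auto
            obtain x' y' where R: "\<psi> Q = Affine x' y'" using elim by (cases "\<psi> Q") auto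
            show ?case using elim unfolding x3_def l_def P R xc.simps yc.simps by (simp add: Let_def)
          qed
        qed
      qed
    qed
  qed
qed

section \<open>Multiplication by an integer\<close>

lemma ec_mult_0 [simp]: "ec_mult E 0 P = Infinity"
  by (simp add: ec_mult_def)

lemma ec_mult_Suc: "ec_mult E (Suc n) P = ec_add E P (ec_mult E n P)"
  by (simp add: ec_mult_def)

lemma ec_mult_in [simp]: "P \<in> ec_points E \<Longrightarrow> ec_mult E n P \<in> ec_points E"
  by (induction n) (auto simp: ec_mult_Suc)

lemma ec_mult_Infinity [simp]: "ec_mult E n Infinity = Infinity"
  by (induction n) (auto simp: ec_mult_Suc)

lemma ec_mult_add_point:
  "P \<in> ec_points E \<Longrightarrow> Q \<in> ec_points E \<Longrightarrow> ec_mult E n (ec_add E P Q) = ec_add E (ec_mult E n P) (ec_mult E n Q)"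
  using EG.nat_pow_distrib[of P Q n] by (simp add: ec_mult_eq_pow)

lemma ec_mult_neg: "P \<in> ec_points E \<Longrightarrow> ec_mult E n (ec_neg E P) = ec_neg E (ec_mult E n P)"
  using EG.nat_pow_inv[of P n] EG.nat_pow_closed[of P n] by (simp add: ec_mult_eq_pow EG_inv)

lemma ec_mult_mult: "P \<in> ec_points E \<Longrightarrow> ec_mult E a (ec_mult E b P) = ec_mult E (b * a) P"
  using EG.nat_pow_pow[of P b a] EG.nat_pow_closed[of P b] by (simp add: ec_mult_eq_pow)

lemma ratmap_ec_mult: "ratmap (ec_mult E n)"
proof (induction n)
  case 0
  show ?case by (simp add: ratmap_def)
next
  case (Suc n)
  have "ratmap (\<lambda>Q. Q)" using eventually_neq[of Infinity] ratfun_xc ratfun_yc by (simp add: ratmap_def)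
  moreover have "\<forall>\<^sub>F Q in generic. Q \<in> ec_points E" "\<forall>\<^sub>F Q in generic. ec_mult E n Q \<in> ec_points E"
    using eventually_affine by (auto elim: eventually_mono)
  ultimately have "ratmap (\<lambda>Q. ec_add E Q (ec_mult E n Q))" using ratmap_add[OF _ _ Suc] by blast
  thus ?case by (simp add: ec_mult_Suc[abs_def])
qed

text \<open>
  The function \<open>x \<circ> [m]\<close> is even and not constant, hence a nonconstant rational function of \<open>x\<close>, so the image
  of \<open>[m]\<close> has finite complement. A subgroup of finite complement in an infinite group is the whole group.
\<close>
lemma ec_mult_surj:
  assumes fin: "finite (torsion E m)" and P: "P \<in> ec_points E"
  shows "\<exists>Q\<in>ec_points E. ec_mult E m Q = P"
proof -
  let ?M = "ec_mult E m"
  have fibre: "finite {Q \<in> ec_points E. ?M Q = C}" for C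
  proof (cases "{Q \<in> ec_points E. ?M Q = C} = {}")
    case False
    then obtain Q0 where Q0: "Q0 \<in> ec_points E" "?M Q0 = C" by blast
    have "{Q \<in> ec_points E. ?M Q = C} \<subseteq> (\<lambda>R. ec_add E R Q0) ` torsion E m"
    proof
      fix Q assume "Q \<in> {Q \<in> ec_points E. ?M Q = C}"
      hence Q: "Q \<in> ec_points E" "?M Q = C" by auto
      have "ec_add E Q (ec_neg E Q0) \<in> torsion E m"
        using Q Q0 by (simp add: torsion_def ec_mult_add_point ec_mult_neg)
      thus "Q \<in> (\<lambda>R. ec_add E R Q0) ` torsion E m"
        using Q Q0 by (intro image_eqI[of _ _ "ec_add E Q (ec_neg E Q0)"]) auto
    qed
    thus ?thesis using fin finite_subset by blast
  qed (use finite.emptyI in metis)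
  have ev: "\<forall>\<^sub>F Q in generic. ?M Q \<noteq> C" for C using fibre[of C] by (simp add: eventually_generic)
  define f where "f = (\<lambda>Q. xc (?M Q))"
  have "\<not> (\<forall>\<^sub>F Q in generic. ?M Q = Infinity)"
  proof
    assume "\<forall>\<^sub>F Q in generic. ?M Q = Infinity"
    with ev[of Infinity] have "\<forall>\<^sub>F Q in generic. False" by eventually_elim simp
    thus False by simp
  qed
  hence f: "ratfun f" using ratmap_ec_mult[of m] by (auto simp: ratmap_def f_def)
  have nonconst: "\<not> (\<forall>\<^sub>F Q in generic. f Q = s)" for s
  proof
    assume s: "\<forall>\<^sub>F Q in generic. f Q = s"
    obtain y where y: "Affine s y \<in> ec_points E" using ex_point by blast
    have "\<forall>\<^sub>F Q in generic. False"
      using s ev[of "Affine s y"] ev[of "ec_neg E (Affine s y)"] ev[of Infinity] eventually_affine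
    proof eventually_elim
      case (elim Q)
      thus ?case using same_xc[OF y, of "?M Q"] by (simp add: f_def)
    qed
    thus False by simp
  qed
  obtain n g c where g: "polyfun n g" "c \<noteq> 0" "\<forall>\<^sub>F Q in generic. f Q = g Q / poly c (xc Q)"
    using f unfolding ratfun_def by blast
  obtain a b where ab: "\<forall>Q\<in>ec_points E - {Infinity}. g Q = coordfun a b Q"
    using g(1) unfolding polyfun_def by blast
  have fpf: "\<forall>\<^sub>F Q in generic. f Q = coordfun a b Q / poly c (xc Q)"
    using g(3) eventually_affine by eventually_elim (use ab in simp)
  \<comment> \<open>Evenness of f, applied to Q and -Q, leaves b(x) * \<open>W\<^sub>y\<close> = 0,
    and \<open>W\<^sub>y\<close> is generically nonzero.\<close>
  have "\<forall>\<^sub>F Q in generic. poly b (xc Q) = 0"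
    using fpf eventually_neg[OF fpf] eventually_affine eventually_poly_neq_0[OF g(2)] eventually_Wy_neq_0
  proof eventually_elim
    case (elim Q)
    have "f (ec_neg E Q) = f Q" using elim by (simp add: f_def ec_mult_neg)
    hence "coordfun a b Q - coordfun a b (ec_neg E Q) = 0" using elim by simp
    hence "poly b (xc Q) * (yc Q - yc (ec_neg E Q)) = 0" by (simp add: coordfun_def right_diff_distrib)
    moreover have "yc Q - yc (ec_neg E Q) = W\<^sub>y (xc Q) (yc Q)"
      using elim by (simp add: yc_neg poly_lin W\<^sub>y_def)
    ultimately show ?case using elim by simp
  qed
  hence b: "b = 0" by (rule eventually_poly_eq_0)
  have "\<exists>d a c. Polynomial.degree c = d \<and> c \<noteq> 0 \<and> (\<forall>\<^sub>F Q in generic. f Q = poly a (xc Q) / poly c (xc Q))"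
    using fpf g(2) by (auto simp: b coordfun_def)
  \<comment> \<open>A denominator of least degree, so that a and c have no common root.\<close>
  then obtain d where d: "\<exists>a c. Polynomial.degree c = d \<and> c \<noteq> 0 \<and> (\<forall>\<^sub>F Q in generic. f Q = poly a (xc Q) / poly c (xc Q))"
     and dmin: "\<And>e. e < d \<Longrightarrow> \<not> (\<exists>a c. Polynomial.degree c = e \<and> c \<noteq> 0 \<and> (\<forall>\<^sub>F Q in generic. f Q = poly a (xc Q) / poly c (xc Q)))"
    using exists_least_iff[of "\<lambda>d. \<exists>a c. Polynomial.degree c = d \<and> c \<noteq> 0 \<and> (\<forall>\<^sub>F Q in generic. f Q = poly a (xc Q) / poly c (xc Q))"] by blast
  then obtain a c where ac: "Polynomial.degree c = d" "c \<noteq> 0" "\<forall>\<^sub>F Q in generic. f Q = poly a (xc Q) / poly c (xc Q)" by blast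
  have nocommon: "poly a r \<noteq> 0" if cr: "poly c r = 0" for r
  proof
    assume "poly a r = 0"
    then obtain a' where a': "a = [:- r, 1:] * a'" using poly_eq_0_iff_dvd[of a r] by (auto elim: dvdE)
    obtain c' where c': "c = [:- r, 1:] * c'" using poly_eq_0_iff_dvd[of c r] cr by (auto elim: dvdE)
    have c0: "c' \<noteq> 0" using ac(2) c' by auto
    have "Polynomial.degree c = Suc (Polynomial.degree c')" using c0 unfolding c' by (subst degree_mult_eq) auto
    moreover have "\<forall>\<^sub>F Q in generic. f Q = poly a' (xc Q) / poly c' (xc Q)"
      using ac(3) eventually_xc_neq[of r]
    proof eventually_elim
      case (elim Q)
      have "poly a (xc Q) = (xc Q - r) * poly a' (xc Q)" "poly c (xc Q) = (xc Q - r) * poly c' (xc Q)"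
        by (simp_all add: a' c' algebra_simps)
      thus ?case using elim by simp
    qed
    ultimately show False using dmin[of "Polynomial.degree c'"] ac(1) c0 by auto
  qed
  define F where "F = {Q \<in> ec_points E. \<not> (f Q = poly a (xc Q) / poly c (xc Q) \<and> ?M Q \<noteq> Infinity)}"
  have "\<forall>\<^sub>F Q in generic. f Q = poly a (xc Q) / poly c (xc Q) \<and> ?M Q \<noteq> Infinity"
    using ac(3) ev[of Infinity] by eventually_elim simp
  hence F: "finite F" by (simp add: F_def eventually_generic)
  \<comment> \<open>For these s the polynomial a - s c is constant and may lack a root. Two such
    values would make c constant, then a, and then f.\<close>
  define Z where "Z = {s. Polynomial.degree (a - Polynomial.smult s c) = 0}"
  have Z: "finite Z"
  proof (cases "Z = {}")
    case False
    then obtain s where s: "s \<in> Z" by blast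
    have "Z \<subseteq> {s}"
    proof
      fix t assume t: "t \<in> Z"
      show "t \<in> {s}"
      proof (rule ccontr)
        assume "t \<notin> {s}"
        hence st: "s - t \<noteq> 0" by auto
        have "Polynomial.degree ((a - Polynomial.smult t c) - (a - Polynomial.smult s c)) \<le> 0"
          by (rule degree_diff_le) (use s t in \<open>simp_all add: Z_def\<close>)
        moreover have "(a - Polynomial.smult t c) - (a - Polynomial.smult s c) = Polynomial.smult (s - t) c"
          by (simp add: smult_diff_left)
        ultimately have "Polynomial.degree c = 0" using st by simp
        then obtain k where k: "c = [:k:]" by (metis degree_eq_zeroE)
        obtain j where j: "a - Polynomial.smult s c = [:j:]" using s by (auto simp: Z_def elim: degree_eq_zeroE)
        have "\<forall>\<^sub>F Q in generic. f Q = s + j / k"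
          using ac(3)
        proof eventually_elim
          case (elim Q)
          have "poly a (xc Q) - s * k = j" using arg_cong[OF j, of "\<lambda>p. poly p (xc Q)"] k by simp
          moreover have "k \<noteq> 0" using k ac(2) by auto
          ultimately show ?case using elim k by (simp add: field_simps)
        qed
        thus False using nonconst by blast
      qed
    qed
    thus ?thesis using finite_subset by blast
  qed simp
  \<comment> \<open>The x-coordinates to be avoided: values of a / c on the exceptional set
    \<open>F\<close>, and the values in \<open>Z\<close>.\<close>
  define B where "B = (\<lambda>Q. poly a (xc Q) / poly c (xc Q)) ` F \<union> Z"
  have B: "finite B" using F Z by (simp add: B_def)
  have hit: "R \<in> ?M ` ec_points E" if R: "R \<in> ec_points E" "R \<noteq> Infinity" "xc R \<notin> B" for R
  proof -
    let ?s = "xc R"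
    have "Polynomial.degree (a - Polynomial.smult ?s c) > 0" using R(3) by (auto simp: B_def Z_def)
    then obtain r where r: "poly (a - Polynomial.smult ?s c) r = 0" using alg_closed_imp_poly_has_root by blast
    hence cr: "poly c r \<noteq> 0" using nocommon by fastforce
    obtain y where y: "Affine r y \<in> ec_points E" using ex_point by blast
    have s: "poly a r / poly c r = ?s" using r cr by (simp add: field_simps)
    have "Affine r y \<notin> F"
    proof
      assume "Affine r y \<in> F"
      hence "poly a (xc (Affine r y)) / poly c (xc (Affine r y)) \<in> B" unfolding B_def by blast
      thus False using s R(3) by simp
    qed
    hence M: "xc (?M (Affine r y)) = ?s" "?M (Affine r y) \<noteq> Infinity" using y s by (auto simp: F_def f_def)
    from same_xc[OF _ R(1) M(2) R(2) M(1)] y have "R = ?M (Affine r y) \<or> R = ec_neg E (?M (Affine r y))" by simp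
    thus ?thesis using y ec_mult_neg[OF y, of m] ec_neg_in[OF y] by (metis imageI)
  qed
  have compl: "finite (ec_points E - ?M ` ec_points E)"
  proof (rule finite_subset)
    show "ec_points E - ?M ` ec_points E \<subseteq> {R \<in> ec_points E. xc R \<in> B} \<union> {Infinity}" using hit by blast
    show "finite ({R \<in> ec_points E. xc R \<in> B} \<union> {Infinity})" using finite_xc_fibre[OF B] by simp
  qed
  show ?thesis
  proof (rule ccontr)
    assume not: "\<not> ?thesis"
    have "infinite (?M ` ec_points E)"
      using compl infinite_points finite_Diff2 by (metis finite_Un Un_Diff_cancel2 Un_upper1 finite_subset)
    moreover have "inj_on (\<lambda>R. ec_add E R P) (?M ` ec_points E)"
      by (rule inj_on_subset[OF inj_on_add[OF P]]) auto
    ultimately have "infinite ((\<lambda>R. ec_add E R P) ` ?M ` ec_points E)" using finite_imageD by blast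
    \<comment> \<open>For P outside the image, the translate of the infinite image by P is disjoint
      from the image, hence would lie in its finite complement.\<close>
    moreover have "(\<lambda>R. ec_add E R P) ` ?M ` ec_points E \<subseteq> ec_points E - ?M ` ec_points E"
    proof safe
      fix Q Q' assume Q: "Q \<in> ec_points E" "Q' \<in> ec_points E" "ec_add E (?M Q) P = ?M Q'"
      have "P = ec_add E (ec_add E P (?M Q)) (ec_neg E (?M Q))" using P Q by simp
      also have "\<dots> = ?M (ec_add E Q' (ec_neg E Q))"
        using P Q by (simp add: ec_add_commute[of P] ec_mult_add_point ec_mult_neg)
      finally show False using not Q by (metis ec_add_in ec_neg_in)
    qed (use P in auto)
    ultimately show False using compl finite_subset by blast
  qed
qed

end

section \<open>The Weil pairing\<close>

context elliptic
begin

abbreviation ec_sum :: "'k ec_point set \<Rightarrow> 'k ec_point" where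
  "ec_sum A \<equiv> finprod EG (\<lambda>P. P) A"

lemma ec_sum_in: "A \<subseteq> ec_points E \<Longrightarrow> ec_sum A \<in> ec_points E"
  using EG.finprod_closed[of "\<lambda>P. P" A] by auto

text \<open>The points of A are added one at a time with \<open>ex_add_function\<close>; each step
  merges a point with the running sum and releases one O.\<close>

lemma ex_set_function:
  assumes "finite A" "A \<subseteq> ec_points E"
  shows "\<exists>h. nzfun h \<and> (\<forall>R\<in>ec_points E. ord_at E R h =
     of_bool (R \<in> A) - of_bool (R = ec_sum A) - (int (card A) - 1) * of_bool (R = Infinity))"
  using assms
proof (induction A rule: finite_induct)
  case empty
  show ?case using nzfun_const[of 1] ord_const[of 1] by (intro exI[of _ "\<lambda>_. 1"]) auto
next
  case (insert P A)
  then obtain h where h: "nzfun h" "\<forall>R\<in>ec_points E. ord_at E R h =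
     of_bool (R \<in> A) - of_bool (R = ec_sum A) - (int (card A) - 1) * of_bool (R = Infinity)" by auto
  have P: "P \<in> ec_points E" and A: "ec_sum A \<in> ec_points E" using insert ec_sum_in by auto
  have sum: "ec_sum (insert P A) = ec_add E P (ec_sum A)"
    using insert by (subst EG.finprod_insert) auto
  obtain k where k: "nzfun k" "\<forall>R\<in>ec_points E. ord_at E R k =
     of_bool (R = P) + of_bool (R = ec_sum A) - of_bool (R = ec_add E P (ec_sum A)) - of_bool (R = Infinity)"
    using ex_add_function[OF P A] by blast
  show ?case
  proof (intro exI conjI ballI)
    show "nzfun (\<lambda>Q. h Q * k Q)" by (rule nzfun_mult[OF h(1) k(1)])
    fix R assume R: "R \<in> ec_points E"
    show "ord_at E R (\<lambda>Q. h Q * k Q) = of_bool (R \<in> insert P A) - of_bool (R = ec_sum (insert P A)) -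
       (int (card (insert P A)) - 1) * of_bool (R = Infinity)"
    proof -
      have "of_bool (R \<in> insert P A) = (of_bool (R \<in> A) + of_bool (R = P) :: int)" using insert(2) by auto
      moreover have "int (card (insert P A)) = int (card A) + 1" using insert(1,2) by simp
      ultimately show ?thesis
        unfolding ord_mult[OF h(1) k(1) R] sum bspec[OF h(2) R] bspec[OF k(2) R] by (simp add: left_diff_distrib)
    qed
  qed
qed

lemma weil_function_iff:
  "weil_function E m T g \<longleftrightarrow> nzfun g \<and> (\<forall>P\<in>ec_points E.
     ord_at E P g = of_bool (ec_mult E m P = T) - of_bool (ec_mult E m P = Infinity))"
  unfolding weil_function_def function_field_iff ae_eq_iff nzfun_iff by blast

lemma ord_minus_const:
  assumes "nzfun g" "nzfun (\<lambda>Q. g Q - c)" and R: "R \<in> ec_points E"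
  shows "ord_at E R (\<lambda>Q. g Q - c) \<ge> min (ord_at E R g) 0"
proof (cases "ord_at E R g \<ge> 0")
  case True
  then obtain a where "regular R g a" using ord_nonneg_regular[OF assms(1) R] by blast
  hence "regular R (\<lambda>Q. g Q - c) (a - c)" by (intro regular_diff regular_const R)
  thus ?thesis using regular_has_ord[OF R nzfun_has_ord[OF assms(2) R]] by force
next
  case False
  show ?thesis
  proof (cases "c = 0")
    case c: False
    have "has_ord R (\<lambda>Q. g Q + - c) (ord_at E R g)"
      by (rule has_ord_add_less[OF R nzfun_has_ord[OF assms(1) R] has_ord_const]) (use c False in auto)
    thus ?thesis using ord_at_has_ord[OF R] by fastforce
  qed simp
qed

end

locale elliptic_torsion = elliptic +
  fixes m :: nat
  assumes m_pos: "m > 0"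
    and card_torsion: "card (torsion E m) = m * m"
begin

lemma finite_torsion: "finite (torsion E m)"
  using card_torsion m_pos by (metis card.infinite mult_is_0 not_gr_zero)

lemma torsion_iff: "P \<in> torsion E m \<longleftrightarrow> P \<in> ec_points E \<and> ec_mult E m P = Infinity"
  by (simp add: torsion_def)

lemma torsion_in: "P \<in> torsion E m \<Longrightarrow> P \<in> ec_points E"
  by (simp add: torsion_def)

lemma torsion_add: "P \<in> torsion E m \<Longrightarrow> Q \<in> torsion E m \<Longrightarrow> ec_add E P Q \<in> torsion E m"
  by (simp add: torsion_iff ec_mult_add_point)

lemma torsion_neg: "P \<in> torsion E m \<Longrightarrow> ec_neg E P \<in> torsion E m"
  by (simp add: torsion_iff ec_mult_neg)

lemma torsion_Infinity: "Infinity \<in> torsion E m"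
  by (simp add: torsion_iff)

lemma divide_point: "P \<in> ec_points E \<Longrightarrow> \<exists>Q\<in>ec_points E. ec_mult E m Q = P"
  by (rule ec_mult_surj[OF finite_torsion])

lemma mem_coset_iff:
  assumes "A \<in> ec_points E" "R \<in> ec_points E"
  shows "R \<in> (\<lambda>S. ec_add E S A) ` torsion E m \<longleftrightarrow> ec_mult E m R = ec_mult E m A"
proof
  assume "ec_mult E m R = ec_mult E m A"
  hence "ec_add E R (ec_neg E A) \<in> torsion E m"
    using assms by (simp add: torsion_iff ec_mult_add_point ec_mult_neg)
  thus "R \<in> (\<lambda>S. ec_add E S A) ` torsion E m"
    using assms by (intro image_eqI[of _ _ "ec_add E R (ec_neg E A)"]) auto
qed (use assms in \<open>auto simp: torsion_iff ec_mult_add_point\<close>)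

text \<open>The functions of \<open>ex_set_function\<close> for A + E[m] and for E[m] have equally
  many points, so the multiples of O cancel in the quotient and only the sums s + B and s remain,
  with s the sum of E[m]. The function for s + B from \<open>ex_add_function\<close> trades these
  for (B) - (O).\<close>

lemma ex_coset_function:
  assumes A: "A \<in> ec_points E"
  defines "B \<equiv> ec_mult E (m * m) A"
  shows "\<exists>h. nzfun h \<and> (\<forall>R\<in>ec_points E. ord_at E R h = of_bool (ec_mult E m R = ec_mult E m A)
     - of_bool (ec_mult E m R = Infinity) - of_bool (R = B) + of_bool (R = Infinity))"
proof -
  let ?T = "torsion E m" and ?C = "(\<lambda>S. ec_add E S A) ` torsion E m"
  have T: "?T \<subseteq> ec_points E" and C: "?C \<subseteq> ec_points E" using A torsion_in by auto
  have B: "B \<in> ec_points E" using A by (simp add: B_def)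
  have inj: "inj_on (\<lambda>S. ec_add E S A) ?T" using inj_on_add[OF A] T by (rule inj_on_subset)
  have cardC: "card ?C = card ?T" by (rule card_image[OF inj])
  have "ec_sum ?C = finprod EG (\<lambda>S. ec_add E S A) ?T"
    using C by (subst EG.finprod_reindex[OF _ inj]) auto
  also have "\<dots> = ec_add E (ec_sum ?T) (finprod EG (\<lambda>S. A) ?T)"
    using EG.finprod_multf[of "\<lambda>S. S" ?T "\<lambda>S. A"] T A by auto
  also have "finprod EG (\<lambda>S. A) ?T = B"
    using EG.finprod_const[of A ?T] A card_torsion by (simp add: B_def ec_mult_eq_pow)
  finally have sum: "ec_sum ?C = ec_add E (ec_sum ?T) B" .
  have S: "ec_sum ?T \<in> ec_points E" by (rule ec_sum_in[OF T])
  obtain h where h: "nzfun h" "\<forall>R\<in>ec_points E. ord_at E R h =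
     of_bool (R \<in> ?C) - of_bool (R = ec_sum ?C) - (int (card ?C) - 1) * of_bool (R = Infinity)"
    using ex_set_function[OF _ C] finite_torsion by blast
  obtain k where k: "nzfun k" "\<forall>R\<in>ec_points E. ord_at E R k =
     of_bool (R \<in> ?T) - of_bool (R = ec_sum ?T) - (int (card ?T) - 1) * of_bool (R = Infinity)"
    using ex_set_function[OF _ T] finite_torsion by blast
  obtain l where l: "nzfun l" "\<forall>R\<in>ec_points E. ord_at E R l =
     of_bool (R = ec_sum ?T) + of_bool (R = B) - of_bool (R = ec_add E (ec_sum ?T) B) - of_bool (R = Infinity)"
    using ex_add_function[OF S B] by blast
  have hk: "nzfun (\<lambda>Q. h Q / k Q)" by (rule nzfun_divide[OF h(1) k(1)])
  show ?thesis
  proof (intro exI conjI ballI)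
    show "nzfun (\<lambda>Q. h Q / k Q / l Q)" by (rule nzfun_divide[OF hk l(1)])
    fix R assume R: "R \<in> ec_points E"
    have "ord_at E R (\<lambda>Q. h Q / k Q / l Q) = of_bool (R \<in> ?C) - of_bool (R \<in> ?T) - of_bool (R = B) + of_bool (R = Infinity)"
      unfolding ord_divide[OF hk l(1) R] ord_divide[OF h(1) k(1) R]
      using bspec[OF h(2) R] bspec[OF k(2) R] bspec[OF l(2) R] by (simp add: sum cardC)
    thus "ord_at E R (\<lambda>Q. h Q / k Q / l Q) = of_bool (ec_mult E m R = ec_mult E m A)
       - of_bool (ec_mult E m R = Infinity) - of_bool (R = B) + of_bool (R = Infinity)"
      using mem_coset_iff[OF A R] R by (simp add: torsion_iff)
  qed
qed

section \<open>Weil functions and the pairing\<close>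

lemma ex_weil_function:
  assumes T: "T \<in> torsion E m"
  shows "\<exists>g. weil_function E m T g"
proof -
  obtain A where A: "A \<in> ec_points E" "ec_mult E m A = T" using divide_point[OF torsion_in[OF T]] by blast
  have "ec_mult E (m * m) A = Infinity"
    using ec_mult_mult[OF A(1), of m m] A(2) T by (simp add: torsion_iff)
  thus ?thesis using ex_coset_function[OF A(1)] A(2) unfolding weil_function_iff by auto
qed

lemma weil_function_unique:
  assumes "weil_function E m T g" "weil_function E m T h"
  shows "\<exists>c. c \<noteq> 0 \<and> (\<forall>\<^sub>F Q in generic. h Q = c * g Q)"
  using assms ord_eq_imp_const_mult[of h g] unfolding weil_function_iff by auto

lemma weil_function_translate:
  assumes g: "weil_function E m T g" and S: "S \<in> torsion E m"
  shows "weil_function E m T (\<lambda>Q. g (ec_add E Q S))"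
  using g S nzfun_translate[OF torsion_in[OF S]] ord_translate[OF torsion_in[OF S]]
  unfolding weil_function_iff by (auto simp: torsion_iff ec_mult_add_point)

lemma weil_pairingI:
  assumes g: "weil_function E m T g" and S: "S \<in> torsion E m"
    and c: "\<forall>\<^sub>F Q in generic. g (ec_add E Q S) = c * g Q"
  shows "weil_pairing E m S T = c"
  unfolding weil_pairing_def
proof (rule the_equality)
  show "\<exists>g. weil_function E m T g \<and> ae_eq E (\<lambda>Q. g (ec_add E Q S)) (\<lambda>Q. c * g Q)"
    using g c by (auto simp: ae_eq_iff)
  fix d assume "\<exists>g. weil_function E m T g \<and> ae_eq E (\<lambda>Q. g (ec_add E Q S)) (\<lambda>Q. d * g Q)"
  then obtain h where h: "weil_function E m T h" "\<forall>\<^sub>F Q in generic. h (ec_add E Q S) = d * h Q"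
    by (auto simp: ae_eq_iff)
  obtain k where k: "k \<noteq> 0" "\<forall>\<^sub>F Q in generic. h Q = k * g Q" using weil_function_unique[OF g h(1)] by blast
  have "\<forall>\<^sub>F Q in generic. g Q \<noteq> 0" using g by (simp add: weil_function_iff nzfun_def)
  with c h(2) k(2) eventually_translate[OF torsion_in[OF S] k(2)] have "\<forall>\<^sub>F Q in generic. d = c"
    by eventually_elim (use k(1) in auto)
  thus "d = c" by simp
qed

lemma weil_pairing:
  assumes g: "weil_function E m T g" and S: "S \<in> torsion E m"
  shows "\<forall>\<^sub>F Q in generic. g (ec_add E Q S) = weil_pairing E m S T * g Q" "weil_pairing E m S T \<noteq> 0"
proof -
  obtain c where c: "c \<noteq> 0" "\<forall>\<^sub>F Q in generic. g (ec_add E Q S) = c * g Q"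
    using weil_function_unique[OF g weil_function_translate[OF g S]] by blast
  show "\<forall>\<^sub>F Q in generic. g (ec_add E Q S) = weil_pairing E m S T * g Q" "weil_pairing E m S T \<noteq> 0"
    using weil_pairingI[OF g S c(2)] c by auto
qed

lemma weil_pairing_add_left:
  assumes S: "S \<in> torsion E m" and S': "S' \<in> torsion E m" and T: "T \<in> torsion E m"
  shows "weil_pairing E m (ec_add E S S') T = weil_pairing E m S T * weil_pairing E m S' T"
proof -
  obtain g where g: "weil_function E m T g" using ex_weil_function[OF T] by blast
  show ?thesis
  proof (rule weil_pairingI[OF g torsion_add[OF S S']])
    show "\<forall>\<^sub>F Q in generic. g (ec_add E Q (ec_add E S S')) = weil_pairing E m S T * weil_pairing E m S' T * g Q"
      using weil_pairing(1)[OF g S] eventually_translate[OF torsion_in[OF S] weil_pairing(1)[OF g S']] eventually_affine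
      by eventually_elim (use S S' torsion_in in \<open>simp add: ec_add_assoc\<close>)
  qed
qed

lemma weil_pairing_add_right:
  assumes S: "S \<in> torsion E m" and T: "T1 \<in> torsion E m" "T2 \<in> torsion E m"
  shows "weil_pairing E m S (ec_add E T1 T2) = weil_pairing E m S T1 * weil_pairing E m S T2"
proof -
  let ?T = "torsion E m"
  obtain A1 where A1: "A1 \<in> ec_points E" "ec_mult E m A1 = T1" using divide_point[OF torsion_in[OF T(1)]] by blast
  obtain A2 where A2: "A2 \<in> ec_points E" "ec_mult E m A2 = T2" using divide_point[OF torsion_in[OF T(2)]] by blast
  obtain g1 where g1: "weil_function E m T1 g1" using ex_weil_function[OF T(1)] by blast
  obtain g2 where g2: "weil_function E m T2 g2" using ex_weil_function[OF T(2)] by blast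
  obtain h where h: "nzfun h" "\<forall>R\<in>ec_points E. ord_at E R h =
     of_bool (R = A1) + of_bool (R = A2) - of_bool (R = ec_add E A1 A2) - of_bool (R = Infinity)"
    using ex_add_function[OF A1(1) A2(1)] by blast
  \<comment> \<open>The translates of A1 by E[m] are exactly the points R with m R = T1. So H has
    divisor [m]^*((T1) + (T2) - (T1 + T2) - (O)), and g1 g2 / H is a Weil function for T1 +
    T2.\<close>
  define H where "H Q = (\<Prod>R\<in>?T. h (ec_add E Q R))" for Q
  have nzh: "nzfun (\<lambda>Q. h (ec_add E Q R))" if "R \<in> ?T" for R by (rule nzfun_translate[OF torsion_in[OF that] h(1)])
  have nzH: "nzfun H" unfolding H_def[abs_def] by (rule nzfun_prod[OF nzh])
  have count: "(\<Sum>R\<in>?T. of_bool (ec_add E P R = A)) = (of_bool (ec_mult E m P = ec_mult E m A) :: int)"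
    if P: "P \<in> ec_points E" and A: "A \<in> ec_points E" for P A
  proof -
    let ?R = "ec_add E A (ec_neg E P)"
    have R: "?R \<in> ec_points E" using P A by simp
    have eq: "ec_add E P R = A \<longleftrightarrow> R = ?R" if "R \<in> ?T" for R
      using torsion_in[OF that] P A by (metis ec_add_commute ec_add_neg_cancel)
    have "(\<Sum>R\<in>?T. of_bool (ec_add E P R = A)) = (\<Sum>R\<in>?T. if R = ?R then 1 else 0 :: int)"
      by (rule sum.cong) (use eq in auto)
    also have "\<dots> = of_bool (?R \<in> ?T)" using finite_torsion by simp
    also have "?R \<in> ?T \<longleftrightarrow> ec_mult E m P = ec_mult E m A"
      using P A by (auto simp: torsion_iff ec_mult_add_point ec_mult_neg ec_add_eq_Infinity_iff)
    finally show ?thesis .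
  qed
  have ordH: "ord_at E P H = of_bool (ec_mult E m P = T1) + of_bool (ec_mult E m P = T2)
     - of_bool (ec_mult E m P = ec_add E T1 T2) - of_bool (ec_mult E m P = Infinity)" if P: "P \<in> ec_points E" for P
  proof -
    have "ord_at E P H = (\<Sum>R\<in>?T. ord_at E P (\<lambda>Q. h (ec_add E Q R)))"
      unfolding H_def[abs_def] by (rule ord_prod[OF P nzh])
    also have "\<dots> = (\<Sum>R\<in>?T. of_bool (ec_add E P R = A1) + of_bool (ec_add E P R = A2)
       - of_bool (ec_add E P R = ec_add E A1 A2) - of_bool (ec_add E P R = Infinity))"
      by (rule sum.cong) (use h ord_translate torsion_in P in auto)
    also have "\<dots> = of_bool (ec_mult E m P = T1) + of_bool (ec_mult E m P = T2)
     - of_bool (ec_mult E m P = ec_add E T1 T2) - of_bool (ec_mult E m P = Infinity)"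
      using P A1 A2 by (simp add: sum.distrib sum_subtractf count ec_mult_add_point)
    finally show ?thesis .
  qed
  define g where "g = (\<lambda>Q. g1 Q * g2 Q / H Q)"
  have n12: "nzfun g1" "nzfun g2" using g1 g2 by (auto simp: weil_function_iff)
  have g: "weil_function E m (ec_add E T1 T2) g"
    unfolding weil_function_iff g_def
  proof (intro conjI ballI)
    show "nzfun (\<lambda>Q. g1 Q * g2 Q / H Q)" by (intro nzfun_divide nzfun_mult n12 nzH)
    fix P assume P: "P \<in> ec_points E"
    show "ord_at E P (\<lambda>Q. g1 Q * g2 Q / H Q) = of_bool (ec_mult E m P = ec_add E T1 T2) - of_bool (ec_mult E m P = Infinity)"
      unfolding ord_divide[OF nzfun_mult[OF n12] nzH P] ord_mult[OF n12 P] ordH[OF P]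
      using g1 g2 P by (simp add: weil_function_iff)
  qed
  show ?thesis
  proof (rule weil_pairingI[OF g S])
    show "\<forall>\<^sub>F Q in generic. g (ec_add E Q S) = weil_pairing E m S T1 * weil_pairing E m S T2 * g Q"
      using weil_pairing(1)[OF g1 S] weil_pairing(1)[OF g2 S] eventually_affine
    proof eventually_elim
      case (elim Q)
      have "H (ec_add E Q S) = (\<Prod>R\<in>?T. h (ec_add E Q (ec_add E R S)))"
        unfolding H_def
      proof (rule prod.cong[OF refl])
        fix R assume R: "R \<in> ?T"
        show "h (ec_add E (ec_add E Q S) R) = h (ec_add E Q (ec_add E R S))"
          using elim torsion_in[OF S] torsion_in[OF R] by (simp add: ec_add_assoc ec_add_commute[of S R])
      qed
      also have "\<dots> = H Q"
        unfolding H_def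
        by (rule prod.reindex_bij_witness[of _ "\<lambda>R. ec_add E R (ec_neg E S)" "\<lambda>R. ec_add E R S"])
           (use S torsion_in torsion_add torsion_neg in auto)
      finally show ?case using elim by (simp add: g_def)
    qed
  qed
qed

text \<open>
  For \<open>m A = T\<close> the divisor of \<open>\<Prod>\<^bsub>i<m\<^esub> g(Q + i A)\<close> telescopes to zero, so this product does not change under translation by \<open>A\<close>.
\<close>
lemma weil_pairing_self:
  assumes T: "T \<in> torsion E m"
  shows "weil_pairing E m T T = 1"
proof -
  obtain A where A: "A \<in> ec_points E" "ec_mult E m A = T" using divide_point[OF torsion_in[OF T]] by blast
  obtain g where g: "weil_function E m T g" using ex_weil_function[OF T] by blast
  have nzg: "nzfun g" using g by (simp add: weil_function_iff)
  have nzi: "nzfun (\<lambda>Q. g (ec_add E Q (ec_mult E i A)))" for i using nzfun_translate[OF _ nzg] A by simp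
  define H where "H Q = (\<Prod>i<m. g (ec_add E Q (ec_mult E i A)))" for Q
  have nzH: "nzfun H" unfolding H_def[abs_def] by (rule nzfun_prod[OF nzi])
  have "ord_at E P H = 0" if P: "P \<in> ec_points E" for P
  proof -
    \<comment> \<open>The pole condition m P + i T = O of the i-th factor is rewritten as m P + (i +
      1) T = T, the zero condition of the next one. The two ends of the sum agree because m T =
      O.\<close>
    let ?c = "\<lambda>i. of_bool (ec_add E (ec_mult E m P) (ec_mult E i T) = T) :: int"
    have "ord_at E P H = (\<Sum>i<m. ord_at E P (\<lambda>Q. g (ec_add E Q (ec_mult E i A))))"
      unfolding H_def[abs_def] by (rule ord_prod[OF P nzi])
    also have "\<dots> = (\<Sum>i<m. ?c i - ?c (Suc i))"
    proof (rule sum.cong[OF refl])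
      fix i
      have mi: "ec_mult E m (ec_mult E i A) = ec_mult E i T"
        using A ec_mult_mult[of A m i] ec_mult_mult[of A i m] by (simp add: mult.commute)
      have "ec_add E (ec_mult E m P) (ec_mult E i T) = Infinity \<longleftrightarrow> ec_add E (ec_mult E m P) (ec_mult E (Suc i) T) = T"
      proof -
        have "ec_add E (ec_mult E m P) (ec_mult E (Suc i) T) = ec_add E (ec_add E (ec_mult E m P) (ec_mult E i T)) T"
          using torsion_in[OF T] P by (simp add: ec_mult_Suc ec_add_commute[of T] ec_add_assoc)
        moreover have "ec_add E (ec_add E (ec_mult E m P) (ec_mult E i T)) T = T \<longleftrightarrow> ec_add E (ec_mult E m P) (ec_mult E i T) = Infinity"
          using ec_add_cancel_right[of "ec_add E (ec_mult E m P) (ec_mult E i T)" Infinity T] torsion_in[OF T] P by simp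
        ultimately show ?thesis by simp
      qed
      thus "ord_at E P (\<lambda>Q. g (ec_add E Q (ec_mult E i A))) = ?c i - ?c (Suc i)"
        using ord_translate[OF _ P nzg, of "ec_mult E i A"] g A P by (simp add: weil_function_iff ec_mult_add_point mi)
    qed
    also have "\<dots> = ?c 0 - ?c m" by (rule sum_lessThan_telescope')
    also have "\<dots> = 0" using T by (simp add: torsion_iff)
    finally show ?thesis .
  qed
  then obtain k where k: "\<forall>\<^sub>F Q in generic. H Q = k" using ord_ge_imp_const[OF nzH] by auto
  have "\<forall>\<^sub>F Q in generic. \<forall>i\<in>{..<m}. g (ec_add E Q (ec_mult E i A)) \<noteq> 0"
    by (rule eventually_ball_finite) (use nzi in \<open>auto simp: nzfun_def\<close>)
  moreover have "\<forall>\<^sub>F Q in generic. H (ec_add E Q A) = k" by (rule eventually_translate[OF A(1) k])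
  ultimately have "\<forall>\<^sub>F Q in generic. g (ec_add E Q T) = 1 * g Q" using k eventually_affine
  proof eventually_elim
    case (elim Q)
    obtain n where n: "m = Suc n" using m_pos by (cases m) auto
    let ?f = "\<lambda>i. g (ec_add E Q (ec_mult E i A))"
    have "H (ec_add E Q A) = (\<Prod>i<m. ?f (Suc i))"
      unfolding H_def using A elim by (intro prod.cong refl) (simp add: ec_mult_Suc ec_add_assoc)
    hence "(\<Prod>i<m. ?f i) = (\<Prod>i<m. ?f (Suc i))" using elim by (simp add: H_def)
    \<comment> \<open>Equality of the products at Q and at Q + A equates the first factor g(Q) with
      the last one, g(Q + m A) = g(Q + T).\<close>
    hence "?f 0 * (\<Prod>i<n. ?f (Suc i)) = (\<Prod>i<n. ?f (Suc i)) * ?f m"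
      unfolding n by (simp only: prod.lessThan_Suc_shift[of ?f] prod.lessThan_Suc[of "\<lambda>i. ?f (Suc i)"])
    moreover have "(\<Prod>i<n. ?f (Suc i)) \<noteq> 0" using elim n by auto
    ultimately show ?case using A(2) by simp
  qed
  thus ?thesis by (rule weil_pairingI[OF g T])
qed

lemma weil_pairing_swap:
  assumes S: "S \<in> torsion E m" and T: "T \<in> torsion E m"
  shows "weil_pairing E m S T * weil_pairing E m T S = 1"
proof -
  have "1 = weil_pairing E m (ec_add E S T) (ec_add E S T)"
    using weil_pairing_self[OF torsion_add[OF S T]] by simp
  also have "\<dots> = weil_pairing E m S T * weil_pairing E m T S"
    unfolding weil_pairing_add_left[OF S T torsion_add[OF S T]] weil_pairing_add_right[OF S S T]
      weil_pairing_add_right[OF T S T] weil_pairing_self[OF S] weil_pairing_self[OF T] by simp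
  finally show ?thesis by simp
qed

lemma weil_pairing_neg_right:
  assumes "S \<in> torsion E m" "T \<in> torsion E m"
  shows "weil_pairing E m S T * weil_pairing E m S (ec_neg E T) = 1"
proof -
  have "weil_function E m Infinity (\<lambda>_. 1)" using nzfun_const[of 1] ord_const[of 1] by (simp add: weil_function_iff)
  from weil_pairingI[OF this assms(1), of 1] have "weil_pairing E m S Infinity = 1" by simp
  thus ?thesis using weil_pairing_add_right[OF assms torsion_neg[OF assms(2)]] by simp
qed

lemma weil_pairing_Infinity_left:
  assumes "T \<in> torsion E m"
  shows "weil_pairing E m Infinity T = 1"
proof -
  obtain g where g: "weil_function E m T g" using ex_weil_function[OF assms] by blast
  show ?thesis by (rule weil_pairingI[OF g torsion_Infinity]) simp
qed

lemma weil_pairing_mult_left: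
  assumes "S \<in> torsion E m" "T \<in> torsion E m"
  shows "ec_mult E n S \<in> torsion E m \<and> weil_pairing E m (ec_mult E n S) T = weil_pairing E m S T ^ n"
  using assms by (induction n) (auto simp: ec_mult_Suc weil_pairing_add_left torsion_add torsion_Infinity weil_pairing_Infinity_left)

lemma weil_pairing_power:
  assumes "S \<in> torsion E m" "T \<in> torsion E m"
  shows "weil_pairing E m S T ^ m = 1"
  using weil_pairing_mult_left[OF assms, of m] weil_pairing_Infinity_left[OF assms(2)] assms(1) by (simp add: torsion_iff)

text \<open>Some A has m^2 A \<noteq> O: otherwise the image of [m], which is the whole curve, would
  lie in the finite set E[m]. By invariance f = g - g(A) vanishes on all of A + E[m], and its poles
  are at most simple and lie in E[m]. Division by the function of \<open>ex_coset_function\<close>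
  leaves a divisor of at least (m^2 A) - (O): a constant with a zero.\<close>

lemma weil_pairing_nondegenerate:
  assumes T: "T \<in> torsion E m" and triv: "\<And>S. S \<in> torsion E m \<Longrightarrow> weil_pairing E m S T = 1"
  shows "T = Infinity"
proof (rule ccontr)
  assume T0: "T \<noteq> Infinity"
  have "\<exists>A\<in>ec_points E. ec_mult E (m * m) A \<noteq> Infinity"
  proof (rule ccontr)
    assume "\<not> ?thesis"
    hence "ec_mult E m A \<in> torsion E m" if "A \<in> ec_points E" for A
      using that ec_mult_mult[of A m m] by (simp add: torsion_iff)
    hence "ec_points E \<subseteq> torsion E m" using divide_point by force
    thus False using finite_torsion infinite_points finite_subset by blast
  qed
  then obtain A where A: "A \<in> ec_points E" "ec_mult E (m * m) A \<noteq> Infinity" by blast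
  define B where "B = ec_mult E (m * m) A"
  have B: "B \<in> ec_points E" "B \<noteq> Infinity" using A by (auto simp: B_def)
  have mA: "ec_mult E m A \<noteq> Infinity" using A(2) ec_mult_mult[OF A(1), of m m] by force
  obtain g where g: "weil_function E m T g" using ex_weil_function[OF T] by blast
  have nzg: "nzfun g" and og: "\<And>P. P \<in> ec_points E \<Longrightarrow> ord_at E P g = of_bool (ec_mult E m P = T) - of_bool (ec_mult E m P = Infinity)"
    using g by (auto simp: weil_function_iff)
  obtain \<alpha> where \<alpha>: "regular A g \<alpha>" using ord_nonneg_regular[OF nzg A(1)] og[OF A(1)] mA by auto
  define f where "f = (\<lambda>Q. g Q - \<alpha>)"
  have nzf: "nzfun f"
  proof -
    \<comment> \<open>If g were constant it would have order 0 at O, but T \<noteq> O gives it a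
      pole there.\<close>
    have "\<not> (\<forall>\<^sub>F Q in generic. f Q = 0)"
    proof
      assume "\<forall>\<^sub>F Q in generic. f Q = 0"
      hence c: "\<forall>\<^sub>F Q in generic. g Q = \<alpha>" by eventually_elim (simp add: f_def)
      have "\<alpha> \<noteq> 0" using nzfun_cong[OF nzg c] by (auto simp: nzfun_def)
      hence "ord_at E Infinity g = 0" using ord_cong[OF nzg c Infinity_in] ord_const[of \<alpha> Infinity] by simp
      moreover have "Infinity \<noteq> T" using T0 by blast
      ultimately show False using og[OF Infinity_in] by simp
    qed
    moreover have "ratfun f" unfolding f_def using nzg by (intro ratfun_diff ratfun_const) (simp add: nzfun_def)
    ultimately show ?thesis by (simp add: nzfun_iff)
  qed
  have fA: "ord_at E A f > 0"
  proof -
    have "regular A f (\<alpha> - \<alpha>)" unfolding f_def by (intro regular_diff regular_const A \<alpha>)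
    hence "regular A f 0" by simp
    thus ?thesis using regular_has_ord[OF A(1) nzfun_has_ord[OF nzf A(1)]] by blast
  qed
  have of: "ord_at E R f \<ge> of_bool (ec_mult E m R = ec_mult E m A) - of_bool (ec_mult E m R = Infinity)" if R: "R \<in> ec_points E" for R
  proof (cases "ec_mult E m R = ec_mult E m A")
    case True
    define S where "S = ec_add E R (ec_neg E A)"
    have S: "S \<in> torsion E m" using True R A by (simp add: S_def torsion_iff ec_mult_add_point ec_mult_neg)
    have inv: "\<forall>\<^sub>F Q in generic. f Q = f (ec_add E Q S)"
      using weil_pairing(1)[OF g S] by eventually_elim (simp add: f_def triv[OF S])
    have "ord_at E A f = ord_at E A (\<lambda>Q. f (ec_add E Q S))" by (rule ord_cong[OF nzf inv A(1), symmetric])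
    also have "\<dots> = ord_at E (ec_add E A S) f" by (rule ord_translate[OF torsion_in[OF S] A(1) nzf])
    also have "ec_add E A S = R" using A R by (simp add: S_def ec_add_commute[of A])
    finally show ?thesis using fA True mA by simp
  next
    case False
    have "ord_at E R f \<ge> min (ord_at E R g) 0" unfolding f_def by (rule ord_minus_const[OF nzg _ R]) (use nzf in \<open>simp add: f_def\<close>)
    thus ?thesis using og[OF R] False by (cases "Infinity = T") auto
  qed
  obtain h where h: "nzfun h" "\<forall>R\<in>ec_points E. ord_at E R h = of_bool (ec_mult E m R = ec_mult E m A)
     - of_bool (ec_mult E m R = Infinity) - of_bool (R = B) + of_bool (R = Infinity)"
    using ex_coset_function[OF A(1)] unfolding B_def by blast
  have ok: "ord_at E R (\<lambda>Q. f Q / h Q) \<ge> of_bool (R = B) - of_bool (R = Infinity)" if "R \<in> ec_points E" for R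
    unfolding ord_divide[OF nzf h(1) that] using of[OF that] bspec[OF h(2) that] by linarith
  have nzk: "nzfun (\<lambda>Q. f Q / h Q)" by (rule nzfun_divide[OF nzf h(1)])
  have "ord_at E R (\<lambda>Q. f Q / h Q) \<ge> - of_bool (R = Infinity)" if "R \<in> ec_points E" for R
    using ok[OF that] by (cases "R = B") auto
  from ord_ge_imp_const[OF nzk this] obtain c where c: "c \<noteq> 0" "\<forall>\<^sub>F Q in generic. f Q / h Q = c" by blast
  have "ord_at E B (\<lambda>Q. f Q / h Q) = 0" using ord_cong[OF nzk c(2) B(1)] ord_const[OF c(1) B(1)] by simp
  thus False using ok[OF B(1)] B(2) by simp
qed

end

section \<open>Automorphisms of the algebraic closure\<close>

text \<open>
  Partial automorphisms are represented by their graphs, so that the inverse of a maximal one is again maximal.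
\<close>
definition ring_rel :: "('a::field alg_closure \<times> 'a alg_closure) set \<Rightarrow> bool" where
  "ring_rel G \<longleftrightarrow> (\<forall>a. (to_ac a, to_ac a) \<in> G) \<and>
     (\<forall>x y x' y'. (x, y) \<in> G \<longrightarrow> (x', y') \<in> G \<longrightarrow> (x + x', y + y') \<in> G \<and> (x * x', y * y') \<in> G)"

definition partial_auto :: "('a::field alg_closure \<times> 'a alg_closure) set \<Rightarrow> bool" where
  "partial_auto G \<longleftrightarrow> ring_rel G \<and> (\<forall>y. (0, y) \<in> G \<longrightarrow> y = 0)"

lemma ring_rel_to_ac: "ring_rel G \<Longrightarrow> (to_ac a, to_ac a) \<in> G"
  by (simp add: ring_rel_def)

lemma ring_rel_0: "ring_rel G \<Longrightarrow> (0, 0) \<in> G"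
  using ring_rel_to_ac[of G 0] by simp

lemma ring_rel_1: "ring_rel G \<Longrightarrow> (1, 1) \<in> G"
  using ring_rel_to_ac[of G 1] by simp

lemma ring_rel_add: "ring_rel G \<Longrightarrow> (x, y) \<in> G \<Longrightarrow> (x', y') \<in> G \<Longrightarrow> (x + x', y + y') \<in> G"
  by (simp add: ring_rel_def)

lemma ring_rel_mult: "ring_rel G \<Longrightarrow> (x, y) \<in> G \<Longrightarrow> (x', y') \<in> G \<Longrightarrow> (x * x', y * y') \<in> G"
  by (simp add: ring_rel_def)

lemma ring_rel_minus: "ring_rel G \<Longrightarrow> (x, y) \<in> G \<Longrightarrow> (- x, - y) \<in> G"
  using ring_rel_mult[of G "-1" "-1" x y] ring_rel_to_ac[of G "-1"] by simp

lemma ring_rel_diff: "ring_rel G \<Longrightarrow> (x, y) \<in> G \<Longrightarrow> (x', y') \<in> G \<Longrightarrow> (x - x', y - y') \<in> G"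
  using ring_rel_add[of G x y "- x'" "- y'"] ring_rel_minus[of G x' y'] by simp

lemma ring_rel_sum:
  assumes "ring_rel G"
  shows "(\<And>i. i \<in> A \<Longrightarrow> (f i, g i) \<in> G) \<Longrightarrow> ((\<Sum>i\<in>A. f i), (\<Sum>i\<in>A. g i)) \<in> G"
  by (induction A rule: infinite_finite_induct) (auto intro: ring_rel_0[OF assms] ring_rel_add[OF assms])

lemma ring_rel_power: "ring_rel G \<Longrightarrow> (x, y) \<in> G \<Longrightarrow> (x ^ n, y ^ n) \<in> G"
  by (induction n) (auto intro: ring_rel_1 ring_rel_mult)

text \<open>Powers of x are stripped from an algebraic relation until its constant term is nonzero,
  which is then solved for 1. So a ring between K and its algebraic closure is a field, and
  \<open>ring_rel\<close> can do with sums and products.\<close>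

lemma inverse_eq_poly:
  fixes x :: "'a::field alg_closure"
  assumes "x \<noteq> 0"
  shows "\<exists>r :: 'a poly. x * poly (map_poly to_ac r) x = 1"
proof -
  obtain p :: "'a poly" where "p \<noteq> 0" "poly (map_poly to_ac p) x = 0" using alg_closure_algebraic by blast
  thus ?thesis
  proof (induction p)
    case (pCons c p)
    have e: "poly (map_poly to_ac (pCons c p)) x = to_ac c + x * poly (map_poly to_ac p) x"
      by (simp add: map_poly_pCons)
    show ?case
    proof (cases "c = 0")
      case True
      thus ?thesis using pCons e assms by auto
    next
      case False
      have "x * poly (map_poly to_ac (Polynomial.smult (- 1 / c) p)) x = to_ac (- 1 / c) * (x * poly (map_poly to_ac p) x)"
        by (subst map_poly_smult) auto
      also have "x * poly (map_poly to_ac p) x = - to_ac c" using e pCons.prems(2) by (simp add: eq_neg_iff_add_eq_0 add.commute)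
      also have "to_ac (- 1 / c) * - to_ac c = 1" using False by simp
      finally show ?thesis by blast
    qed
  qed simp
qed

definition poly_rel :: "('a::field alg_closure \<times> 'a alg_closure) set \<Rightarrow> 'a alg_closure poly \<Rightarrow> 'a alg_closure poly \<Rightarrow> bool" where
  "poly_rel G p q \<longleftrightarrow> (\<forall>i. (Polynomial.coeff p i, Polynomial.coeff q i) \<in> G)"

lemma poly_rel_diff: "ring_rel G \<Longrightarrow> poly_rel G p q \<Longrightarrow> poly_rel G p' q' \<Longrightarrow> poly_rel G (p - p') (q - q')"
  by (simp add: poly_rel_def ring_rel_diff)

lemma poly_rel_add: "ring_rel G \<Longrightarrow> poly_rel G p q \<Longrightarrow> poly_rel G p' q' \<Longrightarrow> poly_rel G (p + p') (q + q')"
  by (simp add: poly_rel_def ring_rel_add)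

lemma poly_rel_mult: "ring_rel G \<Longrightarrow> poly_rel G p q \<Longrightarrow> poly_rel G p' q' \<Longrightarrow> poly_rel G (p * p') (q * q')"
  unfolding poly_rel_def coeff_mult by (auto intro!: ring_rel_sum ring_rel_mult)

lemma poly_rel_smult: "ring_rel G \<Longrightarrow> (c, d) \<in> G \<Longrightarrow> poly_rel G p q \<Longrightarrow> poly_rel G (Polynomial.smult c p) (Polynomial.smult d q)"
  by (simp add: poly_rel_def ring_rel_mult)

lemma poly_rel_monom: "ring_rel G \<Longrightarrow> (c, d) \<in> G \<Longrightarrow> poly_rel G (Polynomial.monom c n) (Polynomial.monom d n)"
  by (simp add: poly_rel_def ring_rel_0)

lemma poly_rel_const: "ring_rel G \<Longrightarrow> (c, d) \<in> G \<Longrightarrow> poly_rel G [:c:] [:d:]"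
  using poly_rel_monom[of G c d 0] by (simp add: monom_0)

lemma poly_rel_to_ac: "ring_rel G \<Longrightarrow> poly_rel G (map_poly to_ac p) (map_poly to_ac p)"
  by (simp add: poly_rel_def coeff_map_poly ring_rel_to_ac)

lemma poly_rel_eval:
  assumes G: "ring_rel G" and "poly_rel G p q" "(x, y) \<in> G"
  shows "(poly p x, poly q y) \<in> G"
proof -
  let ?n = "max (Polynomial.degree p) (Polynomial.degree q)"
  have "poly p x = (\<Sum>i\<le>?n. Polynomial.coeff p i * x ^ i)" "poly q y = (\<Sum>i\<le>?n. Polynomial.coeff q i * y ^ i)"
    by (rule poly_eq_sum_degree_le, simp)+
  thus ?thesis using assms by (auto simp: poly_rel_def intro!: ring_rel_sum ring_rel_mult ring_rel_power)
qed

lemma partial_auto_ring_rel: "partial_auto G \<Longrightarrow> ring_rel G"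
  by (simp add: partial_auto_def)

text \<open>A nonzero x has a multiple 1 inside the domain, so (x, 0) in G would yield (1, 0) and,
  after subtraction of (1, 1), the pair (0, -1).\<close>

lemma partial_auto_inj:
  assumes G: "partial_auto G" and x: "(x, 0) \<in> G"
  shows "x = 0"
proof (rule ccontr)
  assume "x \<noteq> 0"
  then obtain r :: "'a poly" where r: "x * poly (map_poly to_ac r) x = 1" using inverse_eq_poly by blast
  note R = partial_auto_ring_rel[OF G]
  have "(x * poly (map_poly to_ac r) x, 0 * poly (map_poly to_ac r) 0) \<in> G"
    by (intro ring_rel_mult[OF R] x poly_rel_eval[OF R] poly_rel_to_ac[OF R])
  hence "(1, 0) \<in> G" using r by simp
  hence "(1 - 1, 0 - 1) \<in> G" using ring_rel_diff[OF R _ ring_rel_1[OF R]] by blast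
  hence "(0, - 1) \<in> G" by simp
  hence "- 1 = (0 :: 'a alg_closure)" using G unfolding partial_auto_def by blast
  thus False by simp
qed

lemma partial_auto_left_unique: "partial_auto G \<Longrightarrow> (x, y) \<in> G \<Longrightarrow> (x, y') \<in> G \<Longrightarrow> y = y'"
  using ring_rel_diff[of G x y x y'] by (auto simp: partial_auto_def)

lemma partial_auto_right_unique: "partial_auto G \<Longrightarrow> (x, y) \<in> G \<Longrightarrow> (x', y) \<in> G \<Longrightarrow> x = x'"
  using ring_rel_diff[of G x y x' y] partial_auto_inj[of G "x - x'"] by (auto simp: partial_auto_def)

lemma partial_auto_converse: "partial_auto G \<Longrightarrow> partial_auto (G\<inverse>)"
  using partial_auto_inj by (auto simp: partial_auto_def ring_rel_def)

lemma poly_rel_eq_0: "partial_auto G \<Longrightarrow> poly_rel G p q \<Longrightarrow> p = 0 \<longleftrightarrow> q = 0"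
  unfolding poly_rel_def poly_eq_iff using partial_auto_inj by (fastforce simp: partial_auto_def)

lemma poly_rel_degree:
  assumes "partial_auto G" "poly_rel G p q"
  shows "Polynomial.degree q = Polynomial.degree p"
proof -
  have "Polynomial.coeff p i = 0 \<longleftrightarrow> Polynomial.coeff q i = 0" for i
    using assms partial_auto_inj unfolding poly_rel_def partial_auto_def by metis
  thus ?thesis by (simp add: degree_def)
qed

text \<open>Here \<open>p0\<close> is a minimal polynomial of \<open>x\<close>, up to a constant factor, and \<open>q0\<close> is its image under \<open>G\<close>.\<close>
lemma minimal_poly_dvd:
  assumes G: "partial_auto G" and p0: "poly_rel G p0 q0" "p0 \<noteq> 0" "poly p0 x = 0"
    and min: "\<And>p q. poly_rel G p q \<Longrightarrow> p \<noteq> 0 \<Longrightarrow> poly p x = 0 \<Longrightarrow> Polynomial.degree p0 \<le> Polynomial.degree p"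
  shows "poly_rel G p q \<Longrightarrow> poly p x = 0 \<Longrightarrow> q0 dvd q"
proof (induction "Polynomial.degree p" arbitrary: p q rule: less_induct)
  case less
  note R = partial_auto_ring_rel[OF G]
  show ?case
  proof (cases "p = 0")
    case True
    thus ?thesis using poly_rel_eq_0[OF G less(2)] by simp
  next
    case False
    have q0: "q0 \<noteq> 0" using poly_rel_eq_0[OF G p0(1)] p0(2) by simp
    have d: "Polynomial.degree q0 = Polynomial.degree p0" "Polynomial.degree q = Polynomial.degree p"
      using poly_rel_degree[OF G] p0(1) less(2) by auto
    have le: "Polynomial.degree p0 \<le> Polynomial.degree p" using min[OF less(2) False less(3)] .
    define k where "k = Polynomial.degree p - Polynomial.degree p0"
    let ?a = "Polynomial.lead_coeff p0" and ?b = "Polynomial.lead_coeff p"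
    let ?a' = "Polynomial.lead_coeff q0" and ?b' = "Polynomial.lead_coeff q"
    have aa: "(?a, ?a') \<in> G" "(?b, ?b') \<in> G" using p0(1) less(2) d by (auto simp: poly_rel_def)
    \<comment> \<open>One step of pseudo-division, carried out in parallel on p and on its image q.
      Multiplying by leading coefficients instead of dividing keeps everything within the
      relation.\<close>
    define p1 where "p1 = Polynomial.smult ?a p - Polynomial.monom ?b k * p0"
    define q1 where "q1 = Polynomial.smult ?a' q - Polynomial.monom ?b' k * q0"
    have rel: "poly_rel G p1 q1"
      unfolding p1_def q1_def
      by (intro poly_rel_diff[OF R] poly_rel_smult[OF R] poly_rel_mult[OF R] poly_rel_monom[OF R] aa less p0)
    have root: "poly p1 x = 0" using less(3) p0(3) by (simp add: p1_def)
    have "q0 dvd q1"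
    proof (cases "Polynomial.degree p = 0")
      case True
      then obtain c where "p = [:c:]" by (metis degree_eq_zeroE)
      hence "p = 0" using less(3) by simp
      thus ?thesis using False by simp
    next
      case nzfun: False
      have "Polynomial.degree (Polynomial.monom ?b k * p0) = Polynomial.degree p"
        using False p0(2) le by (subst degree_mult_eq) (auto simp: degree_monom_eq k_def)
      moreover have "Polynomial.coeff (Polynomial.monom ?b k * p0) (Polynomial.degree p) = ?b * ?a"
        using coeff_monom_mult[of ?b k p0 "Polynomial.degree p"] le by (simp add: k_def)
      ultimately have "Polynomial.degree p1 \<le> Polynomial.degree p" and c0: "Polynomial.coeff p1 (Polynomial.degree p) = 0"
        unfolding p1_def by (auto intro!: degree_diff_le degree_smult_le simp: mult.commute)
      moreover have "Polynomial.degree p1 \<noteq> Polynomial.degree p"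
      proof
        assume eq: "Polynomial.degree p1 = Polynomial.degree p"
        hence "p1 = 0" using c0 by (metis leading_coeff_0_iff)
        thus False using eq nzfun by simp
      qed
      ultimately have "Polynomial.degree p1 < Polynomial.degree p" by simp
      thus ?thesis using less(1)[OF _ rel root] by blast
    qed
    hence "q0 dvd q1 + Polynomial.monom ?b' k * q0" by (intro dvd_add) auto
    hence "q0 dvd Polynomial.smult ?a' q" by (simp add: q1_def)
    thus ?thesis using q0 by (simp add: dvd_smult_iff)
  qed
qed

text \<open>The extension sends p(x) to q(y) for corresponding p and q. If p(x) = 0 then q0 divides
  q by \<open>minimal_poly_dvd\<close>, hence q(y) = 0, which is all that
  \<open>partial_auto\<close> asks beyond the ring operations.\<close>

lemma partial_auto_extend:
  assumes G: "partial_auto G" and p0: "poly_rel G p0 q0" "p0 \<noteq> 0" "poly p0 x = 0" "poly q0 y = 0"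
    and min: "\<And>p q. poly_rel G p q \<Longrightarrow> p \<noteq> 0 \<Longrightarrow> poly p x = 0 \<Longrightarrow> Polynomial.degree p0 \<le> Polynomial.degree p"
  shows "\<exists>H. partial_auto H \<and> G \<subseteq> H \<and> (x, y) \<in> H"
proof -
  define H where "H = {(poly p x, poly q y) | p q. poly_rel G p q}"
  note R = partial_auto_ring_rel[OF G]
  have HI: "(a, b) \<in> H" if "poly_rel G p q" "a = poly p x" "b = poly q y" for a b p q
    using that unfolding H_def by blast
  have sub: "G \<subseteq> H"
  proof
    fix s assume "s \<in> G"
    then obtain c d where s: "s = (c, d)" "(c, d) \<in> G" by (cases s) auto
    show "s \<in> H" unfolding s(1) by (rule HI[OF poly_rel_const[OF R s(2)]]) auto
  qed
  moreover have "(x, y) \<in> H"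
    by (rule HI[OF poly_rel_monom[OF R ring_rel_1[OF R], of 1]]) (simp_all add: poly_monom)
  moreover have "ring_rel H"
    unfolding ring_rel_def
  proof (intro conjI allI impI)
    show "(to_ac a, to_ac a) \<in> H" for a using sub ring_rel_to_ac[OF R] by blast
    fix a b a' b' assume "(a, b) \<in> H" "(a', b') \<in> H"
    then obtain p q p' q' where *: "poly_rel G p q" "a = poly p x" "b = poly q y" "poly_rel G p' q'" "a' = poly p' x" "b' = poly q' y"
      unfolding H_def by blast
    show "(a + a', b + b') \<in> H" by (rule HI[OF poly_rel_add[OF R *(1,4)]]) (use * in auto)
    show "(a * a', b * b') \<in> H" by (rule HI[OF poly_rel_mult[OF R *(1,4)]]) (use * in auto)
  qed
  moreover have "\<forall>b. (0, b) \<in> H \<longrightarrow> b = 0"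
  proof (intro allI impI)
    fix b assume "(0, b) \<in> H"
    then obtain p q where *: "poly_rel G p q" "0 = poly p x" "b = poly q y" unfolding H_def by blast
    have "q0 dvd q" using minimal_poly_dvd[OF G p0(1-3) min *(1)] *(2) by simp
    thus "b = 0" using p0(4) *(3) by (auto elim!: dvdE)
  qed
  ultimately show ?thesis unfolding partial_auto_def by blast
qed

lemma ex_minimal_poly:
  assumes G: "partial_auto G"
  obtains p0 q0 where "poly_rel G p0 q0" "p0 \<noteq> 0" "poly p0 x = 0"
    "\<And>p q. poly_rel G p q \<Longrightarrow> p \<noteq> 0 \<Longrightarrow> poly p x = 0 \<Longrightarrow> Polynomial.degree p0 \<le> Polynomial.degree p"
proof -
  let ?P = "\<lambda>s. poly_rel G (fst s) (snd s) \<and> fst s \<noteq> 0 \<and> poly (fst s) x = 0"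
  obtain p :: "'a poly" where p: "p \<noteq> 0" "poly (map_poly to_ac p) x = 0" using alg_closure_algebraic by blast
  have "map_poly to_ac p \<noteq> 0" using p(1) by (simp add: map_poly_eq_0_iff)
  hence "?P (map_poly to_ac p, map_poly to_ac p)"
    using p poly_rel_to_ac[OF partial_auto_ring_rel[OF G]] by simp
  from ex_has_least_nat[of ?P, OF this, of "\<lambda>s. Polynomial.degree (fst s)"]
  obtain s where "?P s" "\<forall>t. ?P t \<longrightarrow> Polynomial.degree (fst s) \<le> Polynomial.degree (fst t)" by blast
  thus ?thesis using that[of "fst s" "snd s"] by fastforce
qed

lemma partial_auto_maximal_total:
  assumes G: "partial_auto G" and max: "\<And>H. partial_auto H \<Longrightarrow> G \<subseteq> H \<Longrightarrow> H = G"
  shows "\<exists>y. (x, y) \<in> G"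
proof -
  obtain p0 q0 where p0: "poly_rel G p0 q0" "p0 \<noteq> 0" "poly p0 x = 0"
    "\<And>p q. poly_rel G p q \<Longrightarrow> p \<noteq> 0 \<Longrightarrow> poly p x = 0 \<Longrightarrow> Polynomial.degree p0 \<le> Polynomial.degree p"
    using ex_minimal_poly[OF G] by blast
  have "Polynomial.degree p0 > 0"
  proof (rule ccontr)
    assume "\<not> ?thesis"
    then obtain c where "p0 = [:c:]" by (auto elim: degree_eq_zeroE)
    thus False using p0(2,3) by simp
  qed
  hence "Polynomial.degree q0 > 0" using poly_rel_degree[OF G p0(1)] by simp
  then obtain y where y: "poly q0 y = 0" using alg_closed_imp_poly_has_root by blast
  obtain H where "partial_auto H" "G \<subseteq> H" "(x, y) \<in> H"
    using partial_auto_extend[OF G p0(1-3) y] p0(4) by blast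
  thus ?thesis using max by blast
qed

definition field_auto :: "('a::field alg_closure \<Rightarrow> 'a alg_closure) \<Rightarrow> bool" where
  "field_auto \<sigma> \<longleftrightarrow> bij \<sigma> \<and> (\<forall>x y. \<sigma> (x + y) = \<sigma> x + \<sigma> y) \<and> (\<forall>x y. \<sigma> (x * y) = \<sigma> x * \<sigma> y) \<and> (\<forall>a. \<sigma> (to_ac a) = to_ac a)"

lemma partial_auto_imp_field_auto:
  assumes G: "partial_auto G"
  shows "\<exists>\<sigma>. field_auto \<sigma> \<and> (\<forall>x y. (x, y) \<in> G \<longrightarrow> \<sigma> x = y)"
proof -
  let ?A = "{H. partial_auto H \<and> G \<subseteq> H}"
  have "\<exists>N\<in>?A. \<forall>L\<in>?A. N \<subseteq> L \<longrightarrow> L = N"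
  proof (rule subset_Zorn_nonempty)
    show "?A \<noteq> {}" using G by auto
    fix C assume C: "C \<noteq> {}" "subset.chain ?A C"
    have CA: "C \<subseteq> ?A" and lin: "\<And>L L'. L \<in> C \<Longrightarrow> L' \<in> C \<Longrightarrow> L \<subseteq> L' \<or> L' \<subseteq> L"
      using C(2) unfolding subset_chain_def by blast+
    have "ring_rel (\<Union>C)"
      unfolding ring_rel_def
    proof (intro conjI allI impI)
      fix a
      obtain L where L: "L \<in> C" using C(1) by blast
      hence "(to_ac a, to_ac a) \<in> L" using CA by (intro ring_rel_to_ac) (auto simp: partial_auto_def)
      thus "(to_ac a, to_ac a) \<in> \<Union>C" using L by blast
    next
      fix x y x' y' assume "(x, y) \<in> \<Union>C" "(x', y') \<in> \<Union>C"
      then obtain L where L: "L \<in> C" "(x, y) \<in> L" "(x', y') \<in> L" using lin by blast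
      hence "ring_rel L" using CA by (auto simp: partial_auto_def)
      thus "(x + x', y + y') \<in> \<Union>C" "(x * x', y * y') \<in> \<Union>C"
        using ring_rel_add ring_rel_mult L by blast+
    qed
    moreover have "\<forall>y. (0, y) \<in> \<Union>C \<longrightarrow> y = 0" using CA by (auto simp: partial_auto_def)
    moreover have "G \<subseteq> \<Union>C" using C(1) CA by blast
    ultimately show "\<Union>C \<in> ?A" by (simp add: partial_auto_def)
  qed
  then obtain N where "N \<in> ?A" and maxA: "\<forall>L\<in>?A. N \<subseteq> L \<longrightarrow> L = N" by (rule bexE)
  hence N: "partial_auto N" "G \<subseteq> N" by simp_all
  have maxN: "L = N" if "partial_auto L" "N \<subseteq> L" for L
  proof -
    have "L \<in> ?A" using that N(2) by auto
    thus ?thesis using maxA that(2) by simp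
  qed
  have tot: "\<exists>y. (x, y) \<in> N" for x by (rule partial_auto_maximal_total[OF N(1)]) (rule maxN)
  \<comment> \<open>The converse of N is maximal too, and its totality is the surjectivity of
    \<sigma>.\<close>
  have "L = N\<inverse>" if "partial_auto L" "N\<inverse> \<subseteq> L" for L
  proof -
    have "N \<subseteq> L\<inverse>" using that(2) by (simp add: converse_subset_swap)
    hence "L\<inverse> = N" by (rule maxN[OF partial_auto_converse[OF that(1)]])
    thus ?thesis by (metis converse_converse)
  qed
  hence "\<exists>y. (x, y) \<in> N\<inverse>" for x by (rule partial_auto_maximal_total[OF partial_auto_converse[OF N(1)]])
  hence sur: "\<exists>x. (x, y) \<in> N" for y by auto
  define \<sigma> where "\<sigma> x = (THE y. (x, y) \<in> N)" for x
  have \<sigma>: "\<sigma> x = y \<longleftrightarrow> (x, y) \<in> N" for x y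
  proof -
    obtain z where z: "(x, z) \<in> N" using tot by blast
    hence "\<sigma> x = z" unfolding \<sigma>_def using partial_auto_left_unique[OF N(1)] by blast
    thus ?thesis using z partial_auto_left_unique[OF N(1)] by blast
  qed
  note R = partial_auto_ring_rel[OF N(1)]
  have \<sigma>': "(x, \<sigma> x) \<in> N" for x using \<sigma> by blast
  have "inj \<sigma>" using partial_auto_right_unique[OF N(1)] \<sigma>' by (metis injI)
  moreover have "surj \<sigma>" using sur \<sigma> by (metis surjI)
  ultimately have "field_auto \<sigma>"
    unfolding field_auto_def bij_def using ring_rel_add[OF R \<sigma>' \<sigma>'] ring_rel_mult[OF R \<sigma>' \<sigma>'] ring_rel_to_ac[OF R] by (simp add: \<sigma>)
  moreover have "\<forall>x y. (x, y) \<in> G \<longrightarrow> \<sigma> x = y" using N(2) \<sigma> by blast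
  ultimately show ?thesis by blast
qed

section \<open>Intermediate fields and conjugates over them\<close>

definition ac_subfield :: "'a::field alg_closure set \<Rightarrow> bool" where
  "ac_subfield F \<longleftrightarrow> range to_ac \<subseteq> F \<and> (\<forall>x\<in>F. \<forall>y\<in>F. x + y \<in> F \<and> x * y \<in> F) \<and> (\<forall>x\<in>F. inverse x \<in> F)"

lemma ac_subfield_closed:
  assumes "ac_subfield F" "x \<in> F" "y \<in> F"
  shows "x + y \<in> F" "x * y \<in> F" "inverse x \<in> F" "- x \<in> F" "x - y \<in> F" "x / y \<in> F"
proof -
  note F = assms(1)[unfolded ac_subfield_def]
  show 1: "x + y \<in> F" "x * y \<in> F" "inverse x \<in> F" using F assms by auto
  have m: "- z \<in> F" if "z \<in> F" for z
  proof -
    have "to_ac (- 1) * z \<in> F" using F that by blast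
    thus ?thesis by simp
  qed
  show "- x \<in> F" using m assms by blast
  have "x + - y \<in> F" using F m assms by blast
  thus "x - y \<in> F" by simp
  have "x * inverse y \<in> F" using F assms by blast
  thus "x / y \<in> F" by (simp add: divide_inverse)
qed

lemma ac_subfield_to_ac: "ac_subfield F \<Longrightarrow> to_ac a \<in> F"
  by (auto simp: ac_subfield_def)

lemma ac_subfield_numeral: "ac_subfield F \<Longrightarrow> numeral n \<in> F"
  using ac_subfield_to_ac[of F "numeral n"] by simp

lemma partial_auto_Id_on: "ac_subfield F \<Longrightarrow> partial_auto (Id_on F)"
  by (auto simp: partial_auto_def ring_rel_def ac_subfield_def)

lemma poly_rel_Id_on: "poly_rel (Id_on F) p q \<longleftrightarrow> p = q \<and> (\<forall>i. Polynomial.coeff p i \<in> F)"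
  by (auto simp: poly_rel_def poly_eq_iff Id_on_iff)

lemma ex_conjugation:
  assumes F: "ac_subfield F" and p0: "\<And>i. Polynomial.coeff p0 i \<in> F" "p0 \<noteq> 0" "poly p0 x = 0" "poly p0 y = 0"
    and min: "\<And>p. (\<And>i. Polynomial.coeff p i \<in> F) \<Longrightarrow> p \<noteq> 0 \<Longrightarrow> poly p x = 0 \<Longrightarrow> Polynomial.degree p0 \<le> Polynomial.degree p"
  shows "\<exists>\<sigma>. field_auto \<sigma> \<and> (\<forall>z\<in>F. \<sigma> z = z) \<and> \<sigma> x = y"
proof -
  have "poly_rel (Id_on F) p0 p0" using p0(1) by (simp add: poly_rel_Id_on)
  from partial_auto_extend[OF partial_auto_Id_on[OF F] this p0(2-4)] min
  obtain H where H: "partial_auto H" "Id_on F \<subseteq> H" "(x, y) \<in> H" unfolding poly_rel_Id_on by blast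
  from partial_auto_imp_field_auto[OF H(1)] obtain \<sigma> where "field_auto \<sigma>" "\<forall>x y. (x, y) \<in> H \<longrightarrow> \<sigma> x = y" by blast
  thus ?thesis using H(2,3) by blast
qed

lemma linear_poly_root_in:
  assumes F: "ac_subfield F" and p: "\<And>i. Polynomial.coeff p i \<in> F" "p \<noteq> 0" "poly p x = 0" and deg: "Polynomial.degree p < 2"
  shows "x \<in> F"
proof -
  have "Polynomial.degree p \<noteq> 0"
  proof
    assume "Polynomial.degree p = 0"
    then obtain c where "p = [:c:]" by (metis degree_eq_zeroE)
    thus False using p(2,3) by simp
  qed
  hence "Polynomial.degree p = 1" using deg by simp
  then obtain c d where cd: "p = [:c, d:]" "d \<noteq> 0" using degree1_coeffs by blast
  have "c \<in> F" "d \<in> F" using p(1)[of 0] p(1)[of 1] cd by auto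
  moreover have "x = - c / d" using p(3) cd by (simp add: field_simps eq_neg_iff_add_eq_0)
  ultimately show ?thesis using ac_subfield_closed[OF F] by metis
qed

text \<open>Both x and y are roots of X^2 - (x + y) X + x y over F, whose degree is minimal for x
  because a linear polynomial would put x into F.\<close>

lemma ex_conjugation_quadratic:
  assumes F: "ac_subfield F" and x: "x \<notin> F" and "x + y \<in> F" "x * y \<in> F"
  shows "\<exists>\<sigma>. field_auto \<sigma> \<and> (\<forall>z\<in>F. \<sigma> z = z) \<and> \<sigma> x = y"
proof (rule ex_conjugation[OF F])
  let ?p = "[:x * y, - (x + y), 1:]"
  show "Polynomial.coeff ?p i \<in> F" for i
    using assms ac_subfield_closed[OF F] ac_subfield_to_ac[OF F, of 0] ac_subfield_to_ac[OF F, of 1]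
    by (auto simp: coeff_pCons split: nat.splits simp del: minus_add_distrib)
  show "poly ?p x = 0" "poly ?p y = 0" "?p \<noteq> 0" by (simp_all add: algebra_simps)
  fix p assume "\<And>i. Polynomial.coeff p i \<in> F" "p \<noteq> 0" "poly p x = 0"
  hence "\<not> Polynomial.degree p < 2" using linear_poly_root_in[OF F] x by blast
  thus "Polynomial.degree ?p \<le> Polynomial.degree p" by simp
qed

text \<open>The minimal polynomial of z has degree at least 2 and divides X^m - 1. Once X - z is
  split off, a root y remains; y = z would make z a double root of X^m - 1, against m z^(m-1)
  \<noteq> 0.\<close>

lemma ex_conjugation_root_of_unity:
  fixes z :: "'a::field alg_closure"
  assumes F: "ac_subfield F" and z: "z \<notin> F" "z ^ m = 1" and m: "of_nat m \<noteq> (0 :: 'a alg_closure)"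
  shows "\<exists>\<sigma>. field_auto \<sigma> \<and> (\<forall>z\<in>F. \<sigma> z = z) \<and> \<sigma> z \<noteq> z"
proof -
  note G = partial_auto_Id_on[OF F]
  obtain p0 q0 where p0: "poly_rel (Id_on F) p0 q0" "p0 \<noteq> 0" "poly p0 z = 0"
    "\<And>p q. poly_rel (Id_on F) p q \<Longrightarrow> p \<noteq> 0 \<Longrightarrow> poly p z = 0 \<Longrightarrow> Polynomial.degree p0 \<le> Polynomial.degree p"
    using ex_minimal_poly[OF G] by blast
  have q0: "q0 = p0" and p0F: "\<And>i. Polynomial.coeff p0 i \<in> F" using p0(1) by (auto simp: poly_rel_Id_on)
  obtain p1 where p1: "p0 = [:- z, 1:] * p1" using p0(3) poly_eq_0_iff_dvd by (metis dvdE)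
  have p1n: "p1 \<noteq> 0" using p1 p0(2) by auto
  have "\<not> Polynomial.degree p0 < 2" using linear_poly_root_in[OF F p0F p0(2,3)] z by blast
  moreover have "Polynomial.degree p0 = Suc (Polynomial.degree p1)" unfolding p1 using p1n by (subst degree_mult_eq) auto
  ultimately have "Polynomial.degree p1 > 0" by simp
  then obtain y where y: "poly p1 y = 0" using alg_closed_imp_poly_has_root by blast
  have "y \<noteq> z"
  proof
    assume "y = z"
    then obtain p2 where p2: "p1 = [:- z, 1:] * p2" using y poly_eq_0_iff_dvd by (metis dvdE)
    let ?u = "Polynomial.monom 1 m - 1 :: 'a alg_closure poly"
    have uF: "Polynomial.coeff ?u i \<in> F" for i
      using ac_subfield_closed[OF F] ac_subfield_to_ac[OF F, of 0] ac_subfield_to_ac[OF F, of 1] by auto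
    have rel: "poly_rel (Id_on F) ?u ?u" and root: "poly ?u z = 0"
      using uF z(2) by (simp_all add: poly_rel_Id_on poly_monom)
    have "p0 dvd ?u" using minimal_poly_dvd[OF G p0(1-3) _ rel root] p0(4) q0 by blast
    then obtain r where r: "?u = p0 * r" by (elim dvdE)
    have double: "poly (pderiv (a * (a * w))) z = 0" if "poly a z = 0" for a w :: "'a alg_closure poly"
      using that by (simp add: pderiv_mult)
    have u: "?u = [:- z, 1:] * ([:- z, 1:] * (p2 * r))" using r by (simp only: p1 p2 mult.assoc)
    have "poly (pderiv ?u) z = 0" unfolding u by (rule double) simp
    hence "of_nat m * z ^ (m - 1) = 0" by (simp add: pderiv_diff pderiv_monom poly_monom)
    moreover have "z \<noteq> 0" using z ac_subfield_to_ac[OF F, of 0] by auto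
    ultimately show False using m by simp
  qed
  moreover have "poly p0 y = 0" using y p1 by simp
  ultimately show ?thesis
    using ex_conjugation[OF F p0F p0(2,3), of y] p0(4) by (auto simp: poly_rel_Id_on)
qed

lemma ac_subfield_adjoin: "ac_subfield (adjoin S)"
  and adjoin_incl: "S \<subseteq> adjoin S"
  and adjoin_least: "ac_subfield F \<Longrightarrow> S \<subseteq> F \<Longrightarrow> adjoin S \<subseteq> F"
proof -
  let ?R = "ring_of_type_algebra :: 'a alg_closure ring"
  interpret R: field ?R by (rule field_from_type_algebra)
  have R: "carrier ?R = UNIV" "\<one>\<^bsub>?R\<^esub> = 1" "\<zero>\<^bsub>?R\<^esub> = 0" "\<And>x y. x \<oplus>\<^bsub>?R\<^esub> y = x + y" "\<And>x y. x \<otimes>\<^bsub>?R\<^esub> y = x * y"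
    by (simp_all add: ring_of_type_algebra_def)
  have neg: "\<ominus>\<^bsub>?R\<^esub> x = - x" for x
    by (rule R.minus_equality) (simp_all add: R)
  have inv: "inv\<^bsub>?R\<^esub> x = inverse x" if "x \<noteq> 0" for x
    using R.comm_inv_char[of x "inverse x"] that by (simp add: R)
  show "S \<subseteq> adjoin S" unfolding adjoin_def by (auto intro: generate_field.incl)
  have 0: "0 \<in> adjoin S"
    unfolding adjoin_def by (rule generate_field.incl) (auto intro: image_eqI[of _ _ 0])
  show "ac_subfield (adjoin S)"
    unfolding ac_subfield_def
  proof (intro conjI ballI)
    show "range to_ac \<subseteq> adjoin S" unfolding adjoin_def by (auto intro: generate_field.incl)
    fix x assume x: "x \<in> adjoin S"
    show "inverse x \<in> adjoin S"
      using generate_field.m_inv[of x ?R] x inv 0 unfolding adjoin_def by (cases "x = 0") (auto simp: R)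
    fix y assume y: "y \<in> adjoin S"
    show "x + y \<in> adjoin S" "x * y \<in> adjoin S"
      using generate_field.eng_add[of x ?R _ y] generate_field.eng_mult[of x ?R _ y] x y unfolding adjoin_def by (simp_all add: R)
  qed
  show "adjoin S \<subseteq> F" if F: "ac_subfield F" "S \<subseteq> F"
  proof
    fix x assume "x \<in> adjoin S"
    thus "x \<in> F" unfolding adjoin_def
    proof (induction rule: generate_field.induct)
      case one
      show ?case using ac_subfield_to_ac[OF F(1), of 1] by (simp add: R)
    qed (use F ac_subfield_to_ac[OF F(1)] ac_subfield_closed[OF F(1)] in \<open>auto simp: R neg inv\<close>)
  qed
qed

section \<open>Galois equivariance of the Weil pairing\<close>

locale elliptic_auto = elliptic E for E :: "'k::alg_closed_field weierstrass" +
  fixes \<sigma> :: "'k \<Rightarrow> 'k"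
  assumes bij_auto: "bij \<sigma>"
    and auto_add: "\<sigma> (x + y) = \<sigma> x + \<sigma> y"
    and auto_mult: "\<sigma> (x * y) = \<sigma> x * \<sigma> y"
    and auto_curve: "\<sigma> (a\<^sub>1 E) = a\<^sub>1 E" "\<sigma> (a\<^sub>2 E) = a\<^sub>2 E" "\<sigma> (a\<^sub>3 E) = a\<^sub>3 E" "\<sigma> (a\<^sub>4 E) = a\<^sub>4 E" "\<sigma> (a\<^sub>6 E) = a\<^sub>6 E"
begin

lemma auto_0 [simp]: "\<sigma> 0 = 0"
  using auto_add[of 0 0] by (metis add.right_neutral add_left_cancel)

lemma auto_eq_iff [simp]: "\<sigma> x = \<sigma> y \<longleftrightarrow> x = y"
  using bij_auto by (auto simp: bij_def inj_def)

lemma auto_eq_0_iff [simp]: "\<sigma> x = 0 \<longleftrightarrow> x = 0"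
  using auto_eq_iff[of x 0] by simp

lemma auto_1 [simp]: "\<sigma> 1 = 1"
  using auto_mult[of 1 1] by simp

lemma auto_minus: "\<sigma> (- x) = - \<sigma> x"
  using auto_add[of x "- x"] by (simp add: eq_neg_iff_add_eq_0 add.commute)

lemma auto_diff: "\<sigma> (x - y) = \<sigma> x - \<sigma> y"
  using auto_add[of x "- y"] by (simp add: auto_minus)

lemma auto_inverse: "\<sigma> (inverse x) = inverse (\<sigma> x)"
proof (cases "x = 0")
  case False
  hence "\<sigma> x * \<sigma> (inverse x) = 1" by (simp flip: auto_mult)
  thus ?thesis by (metis inverse_unique)
qed simp

lemma auto_divide: "\<sigma> (x / y) = \<sigma> x / \<sigma> y"
  by (simp add: divide_inverse auto_mult auto_inverse)

lemma auto_power: "\<sigma> (x ^ n) = \<sigma> x ^ n"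
  by (induction n) (auto simp: auto_mult)

lemma auto_power_int: "\<sigma> (x powi n) = \<sigma> x powi n"
  by (simp add: power_int_def auto_power auto_inverse)

lemma auto_numeral: "\<sigma> (numeral n) = numeral n"
proof -
  have "\<sigma> (of_nat k) = of_nat k" for k by (induction k) (auto simp: auto_add)
  from this[of "numeral n"] show ?thesis by simp
qed

lemmas auto_simps = auto_add auto_mult auto_minus auto_diff auto_divide auto_power auto_numeral auto_curve

definition autopt :: "'k ec_point \<Rightarrow> 'k ec_point" where
  "autopt = map_ec_point \<sigma>"

definition autopt_inv :: "'k ec_point \<Rightarrow> 'k ec_point" where
  "autopt_inv = map_ec_point (inv_into UNIV \<sigma>)"

lemma autopt_simps [simp]: "autopt Infinity = Infinity" "autopt (Affine x y) = Affine (\<sigma> x) (\<sigma> y)"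
  by (simp_all add: autopt_def)

lemma autopt_inv_autopt [simp]: "autopt_inv (autopt P) = P" "autopt (autopt_inv P) = P"
  using bij_auto by (cases P; simp add: autopt_def autopt_inv_def bij_is_inj bij_is_surj surj_f_inv_f)+

lemma autopt_eq_iff [simp]: "autopt P = autopt Q \<longleftrightarrow> P = Q"
  by (metis autopt_inv_autopt(1))

lemma autopt_eq_Infinity_iff [simp]: "autopt P = Infinity \<longleftrightarrow> P = Infinity"
  using autopt_eq_iff[of P Infinity] by simp

lemma xc_autopt: "xc (autopt P) = \<sigma> (xc P)" and yc_autopt: "yc (autopt P) = \<sigma> (yc P)"
  by (cases P; simp)+

lemma autopt_in_iff [simp]: "autopt P \<in> ec_points E \<longleftrightarrow> P \<in> ec_points E"
proof (cases P)
  case (Affine x y)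
  have "autopt P \<in> ec_points E \<longleftrightarrow> \<sigma> (y\<^sup>2 + a\<^sub>1 E * x * y + a\<^sub>3 E * y) = \<sigma> (x ^ 3 + a\<^sub>2 E * x\<^sup>2 + a\<^sub>4 E * x + a\<^sub>6 E)"
    unfolding Affine autopt_simps Affine_in_iff by (simp only: auto_simps)
  thus ?thesis by (simp add: Affine Affine_in_iff)
qed simp

lemma autopt_inv_in [simp]: "P \<in> ec_points E \<Longrightarrow> autopt_inv P \<in> ec_points E"
  using autopt_in_iff[of "autopt_inv P"] by simp

lemma autopt_add: "autopt (ec_add E P Q) = ec_add E (autopt P) (autopt Q)"
proof (cases P; cases Q)
  fix x1 y1 x2 y2 assume PQ: "P = Affine x1 y1" "Q = Affine x2 y2"
  have "\<sigma> y1 + \<sigma> y2 + a\<^sub>1 E * \<sigma> x2 + a\<^sub>3 E = \<sigma> (y1 + y2 + a\<^sub>1 E * x2 + a\<^sub>3 E)"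
    by (simp only: auto_simps)
  hence c: "\<sigma> y1 + \<sigma> y2 + a\<^sub>1 E * \<sigma> x2 + a\<^sub>3 E = 0 \<longleftrightarrow> y1 + y2 + a\<^sub>1 E * x2 + a\<^sub>3 E = 0"
    using auto_eq_0_iff by metis
  show ?thesis
    unfolding PQ by (simp add: Let_def c auto_simps)
qed auto

lemma autopt_mult: "autopt (ec_mult E n P) = ec_mult E n (autopt P)"
  by (induction n) (auto simp: ec_mult_Suc autopt_add)

text \<open>This applies \<sigma> to the coefficients of a rational function: precomposition with
  the inverse makes the coordinate functions x and y fixed.\<close>

definition autofun :: "('k ec_point \<Rightarrow> 'k) \<Rightarrow> 'k ec_point \<Rightarrow> 'k" where
  "autofun f Q = \<sigma> (f (autopt_inv Q))"

lemma eventually_autopt_inv: "eventually R generic \<Longrightarrow> \<forall>\<^sub>F Q in generic. R (autopt_inv Q)"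
proof (rule eventually_generic_inj)
  show "inj_on autopt_inv (ec_points E)" by (rule inj_onI) (metis autopt_inv_autopt(2))
qed auto

lemma xc_autopt_inv: "\<sigma> (xc (autopt_inv Q)) = xc Q" and yc_autopt_inv: "\<sigma> (yc (autopt_inv Q)) = yc Q"
  using xc_autopt[of "autopt_inv Q"] yc_autopt[of "autopt_inv Q"] by simp_all

lemma regular_autofun:
  assumes P: "P \<in> ec_points E" and f: "regular P f a"
  shows "regular (autopt P) (autofun f) (\<sigma> a)"
proof (rule regular_induct[OF P f])
  have P': "autopt P \<in> ec_points E" using P by simp
  fix f g a assume f: "regular (autopt P) (autofun f) (\<sigma> a)"
  {
    assume "\<forall>\<^sub>F Q in generic. f Q = g Q"
    from eventually_autopt_inv[OF this] have "\<forall>\<^sub>F Q in generic. autofun f Q = autofun g Q"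
      by eventually_elim (simp add: autofun_def)
    thus "regular (autopt P) (autofun g) (\<sigma> a)" by (rule regular_cong[OF f])
  }
  {
    assume "a \<noteq> 0"
    thus "regular (autopt P) (autofun (\<lambda>Q. inverse (f Q))) (\<sigma> (inverse a))"
      using regular_inverse[OF f] by (simp add: autofun_def[abs_def] auto_inverse)
  }
  fix b assume g: "regular (autopt P) (autofun g) (\<sigma> b)"
  show "regular (autopt P) (autofun (\<lambda>Q. f Q + g Q)) (\<sigma> (a + b))" "regular (autopt P) (autofun (\<lambda>Q. f Q * g Q)) (\<sigma> (a * b))"
    using regular_add[OF P' f g] regular_mult[OF f g] by (simp_all add: autofun_def[abs_def] auto_add auto_mult)
next
  show "regular (autopt P) (autofun (\<lambda>_. c)) (\<sigma> c)" for c
    using regular_const[of "autopt P" "\<sigma> c"] by (simp add: autofun_def[abs_def])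
  have "autofun (chart1 P) = chart1 (autopt P)" "autofun (chart2 P) = chart2 (autopt P)"
    by (auto simp: autofun_def chart1_def chart2_def auto_divide xc_autopt_inv yc_autopt_inv)
  thus "regular (autopt P) (autofun (chart1 P)) (\<sigma> (xc P))" "regular (autopt P) (autofun (chart2 P)) (\<sigma> (yc P))"
    using regular_chart1[of "autopt P"] regular_chart2[of "autopt P"] by (simp_all add: xc_autopt yc_autopt)
qed

text \<open>The choice made in \<open>unif\<close> depends on whether \<open>W\<^sub>y\<close>
  vanishes, which \<sigma> respects; so the uniformizer at P is carried to the one at \<sigma>
  P.\<close>

lemma has_ord_autofun:
  assumes P: "P \<in> ec_points E" and f: "has_ord P f n"
  shows "has_ord (autopt P) (autofun f) n"
proof -
  obtain u a where u: "a \<noteq> 0" "regular P u a" "\<forall>\<^sub>F Q in generic. f Q = unif P Q powi n * u Q"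
    using f unfolding has_ord_def by blast
  have W: "W\<^sub>y (xc (autopt P)) (yc (autopt P)) = \<sigma> (W\<^sub>y (xc P) (yc P))"
    by (simp add: W\<^sub>y_def xc_autopt yc_autopt auto_simps)
  have unif: "\<sigma> (unif P (autopt_inv Q)) = unif (autopt P) Q" for Q
    unfolding unif_def W by (auto simp: auto_diff auto_divide xc_autopt_inv yc_autopt_inv xc_autopt yc_autopt)
  show ?thesis
  proof (rule valI[OF regular_autofun[OF P u(2)]])
    show "\<forall>\<^sub>F Q in generic. autofun f Q = unif (autopt P) Q powi n * autofun u Q"
      using eventually_autopt_inv[OF u(3)] by eventually_elim (simp add: autofun_def auto_mult auto_power_int unif)
  qed (use u(1) in simp)
qed

lemma weil_function_autofun:
  assumes g: "weil_function E m T g"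
  shows "weil_function E m (autopt T) (autofun g)"
proof -
  have nzfun: "nzfun g" using g by (simp add: weil_function_iff)
  have v: "has_ord P (autofun g) (ord_at E (autopt_inv P) g)" if "P \<in> ec_points E" for P
    using has_ord_autofun[OF autopt_inv_in[OF that] nzfun_has_ord[OF nzfun autopt_inv_in[OF that]]] by simp
  have "nzfun (autofun g)" using nzI[OF Infinity_in v] by simp
  moreover have "ord_at E P (autofun g) = of_bool (ec_mult E m P = autopt T) - of_bool (ec_mult E m P = Infinity)"
    if P: "P \<in> ec_points E" for P
  proof -
    have "ec_mult E m P = autopt (ec_mult E m (autopt_inv P))" by (simp add: autopt_mult)
    thus ?thesis using ord_at_has_ord[OF P v[OF P]] g autopt_inv_in[OF P] by (simp add: weil_function_iff)
  qed
  ultimately show ?thesis by (simp add: weil_function_iff)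
qed

end

text \<open>The conjugate of a Weil function for T is one for \<sigma> T, and \<sigma> applied to
  the relation g(Q + S) = c g(Q) yields the constant \<sigma> c.\<close>

lemma (in elliptic_torsion) weil_pairing_auto:
  assumes "elliptic_auto E \<sigma>" and S: "S \<in> torsion E m" and T: "T \<in> torsion E m"
  shows "weil_pairing E m (map_ec_point \<sigma> S) (map_ec_point \<sigma> T) = \<sigma> (weil_pairing E m S T)"
proof -
  interpret A: elliptic_auto E \<sigma> by fact
  obtain g where g: "weil_function E m T g" using ex_weil_function[OF T] by blast
  have S': "A.autopt S \<in> torsion E m" using S by (simp add: torsion_iff flip: A.autopt_mult)
  have "weil_pairing E m (A.autopt S) (A.autopt T) = \<sigma> (weil_pairing E m S T)"
  proof (rule weil_pairingI[OF A.weil_function_autofun[OF g] S'])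
    show "\<forall>\<^sub>F Q in generic. A.autofun g (ec_add E Q (A.autopt S)) = \<sigma> (weil_pairing E m S T) * A.autofun g Q"
      using A.eventually_autopt_inv[OF weil_pairing(1)[OF g S]]
    proof eventually_elim
      case (elim Q)
      have "A.autopt_inv (ec_add E Q (A.autopt S)) = ec_add E (A.autopt_inv Q) S"
        using A.autopt_add[of "A.autopt_inv Q" S] by (metis A.autopt_inv_autopt)
      thus ?case using elim by (simp add: A.autofun_def A.auto_mult)
    qed
  qed
  thus ?thesis by (simp add: A.autopt_def)
qed

section \<open>The field of torsion coordinates\<close>

lemma elliptic_curve_base_change:
  assumes "elliptic_curve E"
  shows "elliptic_curve (base_change E)"
proof -
  have "discriminant (base_change E) = to_ac (discriminant E)"
    by (cases E) (simp add: discriminant_def Let_def)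
  thus ?thesis using assms by (simp add: elliptic_curve_def)
qed

lemma field_auto_elliptic_auto:
  assumes "elliptic_curve E" "field_auto \<sigma>"
  shows "elliptic_auto (base_change E) \<sigma>"
proof unfold_locales
  show "elliptic_curve (base_change E)" by (rule elliptic_curve_base_change[OF assms(1)])
qed (use assms(2) in \<open>cases E; simp add: field_auto_def\<close>)+

fun pt_over :: "'a set \<Rightarrow> 'a ec_point \<Rightarrow> bool" where
  "pt_over F Infinity \<longleftrightarrow> True"
| "pt_over F (Affine x y) \<longleftrightarrow> x \<in> F \<and> y \<in> F"

lemma pt_over_add:
  assumes F: "ac_subfield F" and "pt_over F P" "pt_over F Q"
  shows "pt_over F (ec_add (base_change E) P Q)"
proof (cases P; cases Q)
  fix x1 y1 x2 y2 assume PQ: "P = Affine x1 y1" "Q = Affine x2 y2"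
  have xy: "x1 \<in> F" "y1 \<in> F" "x2 \<in> F" "y2 \<in> F" using assms PQ by auto
  note cl = ac_subfield_closed[OF F]
  have E: "a\<^sub>1 (base_change E) \<in> F" "a\<^sub>2 (base_change E) \<in> F" "a\<^sub>3 (base_change E) \<in> F" "a\<^sub>4 (base_change E) \<in> F"
    by (cases E; simp add: ac_subfield_to_ac[OF F])+
  note num = ac_subfield_numeral[OF F]
  define l where "l = (if x1 = x2
       then (3 * x1\<^sup>2 + 2 * a\<^sub>2 (base_change E) * x1 + a\<^sub>4 (base_change E) - a\<^sub>1 (base_change E) * y1) / (2 * y1 + a\<^sub>1 (base_change E) * x1 + a\<^sub>3 (base_change E))
       else (y2 - y1) / (x2 - x1))"
  have l: "l \<in> F" unfolding l_def power2_eq_square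
    by (cases "x1 = x2") (simp_all only: if_True if_False refl, (intro cl(1,2,5,6) xy E num)+)
  define x3 where "x3 = l\<^sup>2 + a\<^sub>1 (base_change E) * l - a\<^sub>2 (base_change E) - x1 - x2"
  have x3: "x3 \<in> F" unfolding x3_def power2_eq_square by (intro cl(1,2,5) xy E l)
  have y3: "- (l + a\<^sub>1 (base_change E)) * x3 - (y1 - l * x1) - a\<^sub>3 (base_change E) \<in> F"
    by (intro cl(1,2,5) cl(4)[OF _ l] xy E l x3)
  have "ec_add (base_change E) P Q = Infinity \<or> ec_add (base_change E) P Q = Affine x3 (- (l + a\<^sub>1 (base_change E)) * x3 - (y1 - l * x1) - a\<^sub>3 (base_change E))"
    unfolding PQ by (simp add: Let_def l_def x3_def)
  thus ?thesis using x3 y3 by (metis pt_over.simps)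
qed (use assms in auto)

lemma pt_over_mult:
  assumes "ac_subfield F" "pt_over F P"
  shows "pt_over F (ec_mult (base_change E) n P)"
  unfolding ec_mult_def by (induction n) (auto intro: pt_over_add[OF assms])

lemma pt_over_torsion_field:
  "P \<in> torsion (base_change E) m \<Longrightarrow> pt_over (torsion_field E m) P"
  unfolding torsion_field_def
  using adjoin_incl[of "\<Union>{{x, y} |x y. Affine x y \<in> torsion (base_change E) m}"] by (cases P) auto

text \<open>The first facts compare two index pairs; m \<ge> 3 is what makes 2 an admissible index.
  If the pairing of P and Q squared to 1, then 2 Q would pair trivially with P, and it does so with
  Q by \<open>weil_pairing_self\<close>; nondegeneracy would give 2 Q = O.\<close>

lemma (in elliptic_torsion) torsion_basis_facts:
  assumes m: "m \<ge> 3" and basis: "torsion_basis E m P Q"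
  shows "P \<in> torsion E m" "Q \<in> torsion E m" "P \<noteq> Q" "P \<noteq> ec_neg E Q" "ec_neg E P \<noteq> P" "ec_neg E Q \<noteq> Q"
    and "weil_pairing E m P Q * weil_pairing E m P Q \<noteq> 1"
proof -
  let ?f = "\<lambda>(a, b). ec_add E (ec_mult E a P) (ec_mult E b Q)"
  show PQ: "P \<in> torsion E m" "Q \<in> torsion E m" using basis by (auto simp: torsion_basis_def)
  note PQ' = torsion_in[OF PQ(1)] torsion_in[OF PQ(2)]
  have inj: "inj_on ?f ({..<m} \<times> {..<m})" and img: "?f ` ({..<m} \<times> {..<m}) = torsion E m"
    using basis by (auto simp: torsion_basis_def bij_betw_def)
  have ne: "?f s \<noteq> ?f t" if "s \<noteq> t" "s \<in> {..<m} \<times> {..<m}" "t \<in> {..<m} \<times> {..<m}" for s t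
    using inj that by (meson inj_onD)
  have one: "ec_mult E (Suc 0) R = R" "ec_mult E 2 R = ec_add E R R" for R
    by (simp_all add: ec_mult_Suc numeral_2_eq_2)
  show "P \<noteq> Q" using ne[of "(1, 0)" "(0, 1)"] m by (auto simp: one)
  show "P \<noteq> ec_neg E Q" using ne[of "(1, 1)" "(0, 0)"] m by (auto simp: one)
  have 2: "ec_add E P P \<noteq> Infinity" "ec_add E Q Q \<noteq> Infinity"
    using ne[of "(2, 0)" "(0, 0)"] ne[of "(0, 2)" "(0, 0)"] m by (auto simp: one)
  show "ec_neg E P \<noteq> P" "ec_neg E Q \<noteq> Q" using 2 ec_add_neg by metis+
  show "weil_pairing E m P Q * weil_pairing E m P Q \<noteq> 1"
  proof
    assume sq: "weil_pairing E m P Q * weil_pairing E m P Q = 1"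
    have QQ: "ec_add E Q Q \<in> torsion E m" by (rule torsion_add[OF PQ(2,2)])
    have "weil_pairing E m S (ec_add E Q Q) = 1" if S_in: "S \<in> torsion E m" for S
    proof -
      obtain a b where S: "S = ec_add E (ec_mult E a P) (ec_mult E b Q)" using S_in unfolding img[symmetric] by auto
      have "weil_pairing E m P (ec_add E Q Q) = 1" "weil_pairing E m Q (ec_add E Q Q) = 1"
        using sq weil_pairing_add_right[OF PQ(1) PQ(2) PQ(2)] weil_pairing_add_right[OF PQ(2) PQ(2) PQ(2)] weil_pairing_self[OF PQ(2)] by auto
      thus ?thesis unfolding S
        using weil_pairing_mult_left[OF PQ(1) QQ, of a] weil_pairing_mult_left[OF PQ(2) QQ, of b] weil_pairing_add_left[OF _ _ QQ] by simp
    qed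
    from weil_pairing_nondegenerate[OF QQ this] show False using 2 by blast
  qed
qed

text \<open>Torsion points are combinations of the basis, and the addition formulas have
  coefficients in K.\<close>

lemma torsion_field_subset:
  assumes "torsion_basis (base_change E) m (Affine x1 y1) (Affine x2 y2)"
    and F: "ac_subfield F" "x1 \<in> F" "y1 \<in> F" "x2 \<in> F" "y2 \<in> F"
  shows "torsion_field E m \<subseteq> F"
  unfolding torsion_field_def
proof (rule adjoin_least[OF F(1)])
  have "pt_over F P" if "P \<in> torsion (base_change E) m" for P
  proof -
    obtain a b where "P = ec_add (base_change E) (ec_mult (base_change E) a (Affine x1 y1)) (ec_mult (base_change E) b (Affine x2 y2))"
      using assms(1) \<open>P \<in> torsion (base_change E) m\<close> by (fastforce simp: torsion_basis_def bij_betw_def)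
    thus ?thesis using pt_over_add[OF F(1)] pt_over_mult[OF F(1)] F(2-) by simp
  qed
  thus "\<Union>{{x, y} |x y. Affine x y \<in> torsion (base_change E) m} \<subseteq> F" by fastforce
qed

theorem theorem2p8:
  fixes E :: "'a::field weierstrass"
    and m :: nat
    and x1 y1 x2 y2 \<zeta> :: "'a alg_closure"
  assumes "elliptic_curve E"
    and "m \<ge> 3"
    and "CHAR('a) > 0 \<longrightarrow> coprime m CHAR('a)"
    and "torsion_basis (base_change E) m (Affine x1 y1) (Affine x2 y2)"
    and "\<zeta> = weil_pairing (base_change E) m (Affine x1 y1) (Affine x2 y2)"
  shows "torsion_field E m = adjoin {x1 + x2, x1 * x2, \<zeta>, y1}"
proof -
  define C where "C = base_change E"
  define P1 where "P1 = Affine x1 y1"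
  define P2 where "P2 = Affine x2 y2"
  interpret elliptic C unfolding C_def by unfold_locales (rule elliptic_curve_base_change[OF assms(1)])
  have basis: "torsion_basis C m P1 P2" using assms(4) by (simp add: C_def P1_def P2_def)
  interpret elliptic_torsion C m
  proof
    show "m > 0" using assms(2) by simp
    have "card ({..<m} \<times> {..<m}) = card (torsion C m)"
      using basis unfolding torsion_basis_def by (blast intro: bij_betw_same_card)
    thus "card (torsion C m) = m * m" by simp
  qed
  note facts = torsion_basis_facts[OF assms(2) basis]
  have \<zeta>: "\<zeta> = weil_pairing C m P1 P2" using assms(5) by (simp add: C_def P1_def P2_def)
  have inE: "P1 \<in> ec_points C" "P2 \<in> ec_points C" using facts(1,2) torsion_in by auto
  have fin: "P1 \<noteq> Infinity" "P2 \<noteq> Infinity" by (auto simp: P1_def P2_def)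
  have swap: "\<zeta> * weil_pairing C m P2 P1 = 1" using weil_pairing_swap[OF facts(1,2)] by (simp add: \<zeta>)
  have pair: "\<sigma> \<zeta> = weil_pairing C m (map_ec_point \<sigma> P1) (map_ec_point \<sigma> P2)" if "field_auto \<sigma>" for \<sigma>
    using weil_pairing_auto[OF _ facts(1,2), of \<sigma>] field_auto_elliptic_auto[OF assms(1) that] by (simp add: \<zeta> C_def)
  have aC: "a\<^sub>1 C \<in> range to_ac" "a\<^sub>3 C \<in> range to_ac" "a\<^sub>2 C \<in> range to_ac" "a\<^sub>4 C \<in> range to_ac" "a\<^sub>6 C \<in> range to_ac"
    by (cases E; simp add: C_def)+
  have aF: "a\<^sub>1 C \<in> F" "a\<^sub>3 C \<in> F" "a\<^sub>2 C \<in> F" "a\<^sub>4 C \<in> F" "a\<^sub>6 C \<in> F" if "ac_subfield F" for F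
    using aC that unfolding ac_subfield_def by blast+
  have map_in: "map_ec_point \<sigma> P \<in> ec_points C" if "field_auto \<sigma>" "P \<in> ec_points C" for \<sigma> P
  proof -
    interpret A: elliptic_auto C \<sigma> unfolding C_def by (rule field_auto_elliptic_auto[OF assms(1) that(1)])
    show ?thesis using that(2) by (simp add: A.autopt_def[symmetric])
  qed

  define F where "F = adjoin {x1 + x2, x1 * x2, \<zeta>, y1}"
  have F: "ac_subfield F" unfolding F_def by (rule ac_subfield_adjoin)
  note cl = ac_subfield_closed[OF F]
  have memF: "x1 + x2 \<in> F" "x1 * x2 \<in> F" "\<zeta> \<in> F" "y1 \<in> F"
    using adjoin_incl[of "{x1 + x2, x1 * x2, \<zeta>, y1}"] by (auto simp: F_def)

  have x1F: "x1 \<in> F"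
  proof (rule ccontr)
    assume "x1 \<notin> F"
    then obtain \<sigma> where \<sigma>: "field_auto \<sigma>" "\<And>z. z \<in> F \<Longrightarrow> \<sigma> z = z" "\<sigma> x1 = x2"
      using ex_conjugation_quadratic[OF F _ memF(1,2)] by blast
    interpret A: elliptic_auto C \<sigma> unfolding C_def by (rule field_auto_elliptic_auto[OF assms(1) \<sigma>(1)])
    have "\<sigma> x1 + \<sigma> x2 = x1 + x2" using \<sigma>(2)[OF memF(1)] by (simp add: A.auto_add)
    hence \<sigma>x2: "\<sigma> x2 = x1" using \<sigma>(3) by (simp add: add.commute)
    have \<sigma>y1: "\<sigma> y1 = y1" and \<sigma>\<zeta>: "\<sigma> \<zeta> = \<zeta>" using \<sigma>(2) memF by auto
    have m1: "map_ec_point \<sigma> P1 = Affine x2 y1" and m2: "map_ec_point \<sigma> P2 = Affine x1 (\<sigma> y2)"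
      using \<sigma>(3) \<sigma>x2 \<sigma>y1 by (simp_all add: P1_def P2_def)
    have 1: "map_ec_point \<sigma> P1 = P2 \<or> map_ec_point \<sigma> P1 = ec_neg C P2"
      using same_xc[OF inE(2) map_in[OF \<sigma>(1) inE(1)] fin(2)] m1 by (simp add: P2_def)
    have 2: "map_ec_point \<sigma> P2 = P1 \<or> map_ec_point \<sigma> P2 = ec_neg C P1"
      using same_xc[OF inE(1) map_in[OF \<sigma>(1) inE(2)] fin(1)] m2 by (simp add: P1_def)
    have self: False if "y1 = - y1 - a\<^sub>1 C * x1 - a\<^sub>3 C"
      using facts(5) that by (simp add: P1_def)
    have e: "\<zeta> = weil_pairing C m (map_ec_point \<sigma> P1) (map_ec_point \<sigma> P2)" using pair[OF \<sigma>(1)] \<sigma>\<zeta> by simp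
    \<comment> \<open>The pairing of P2 with P1 is the inverse of \<zeta>, so equality would give
      \<zeta>^2 = 1.\<close>
    have inv: False if "\<zeta> = weil_pairing C m P2 P1"
      using facts(7) swap that unfolding \<zeta>[symmetric] by simp
    from 1 2 consider "map_ec_point \<sigma> P1 = P2" "map_ec_point \<sigma> P2 = P1"
      | "map_ec_point \<sigma> P1 = P2" "map_ec_point \<sigma> P2 = ec_neg C P1"
      | "map_ec_point \<sigma> P1 = ec_neg C P2" "map_ec_point \<sigma> P2 = P1"
      | "map_ec_point \<sigma> P1 = ec_neg C P2" "map_ec_point \<sigma> P2 = ec_neg C P1" by blast
    thus False
    proof cases
      case 1
      thus False using e inv by simp
    next
      case 2
      \<comment> \<open>Applying \<sigma> to y2 = y1 and using that y1 is fixed makes y1 the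
        y-coordinate of -P1.\<close>
      hence "y2 = y1" "\<sigma> y2 = - y1 - a\<^sub>1 C * x1 - a\<^sub>3 C" using m1 m2 by (simp_all add: P1_def P2_def)
      thus False using \<sigma>y1 self by simp
    next
      case 3
      hence y1: "y1 = - y2 - a\<^sub>1 C * x2 - a\<^sub>3 C" and \<sigma>y2: "\<sigma> y2 = y1" using m1 m2 by (simp_all add: P1_def P2_def)
      \<comment> \<open>The mirror image of the previous case: \<sigma> applied to the relation
        between y1 and y2 again gives P1 = -P1.\<close>
      have "\<sigma> y1 = - \<sigma> y2 - a\<^sub>1 C * \<sigma> x2 - a\<^sub>3 C" by (subst y1) (simp only: A.auto_simps)
      thus False using \<sigma>y1 \<sigma>y2 \<sigma>x2 self by simp
    next
      case 4
      have n: "ec_neg C P2 \<in> torsion C m" "ec_neg C P1 \<in> torsion C m" using torsion_neg facts by auto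
      \<comment> \<open>Negating both arguments inverts the pairing twice.\<close>
      have "weil_pairing C m (ec_neg C P2) (ec_neg C P1) = weil_pairing C m P2 P1"
      proof -
        have r: "weil_pairing C m (ec_neg C P2) P1 * weil_pairing C m (ec_neg C P2) (ec_neg C P1) = 1"
          by (rule weil_pairing_neg_right[OF n(1) facts(1)])
        have l: "weil_pairing C m P2 P1 * weil_pairing C m (ec_neg C P2) P1 = 1"
          using weil_pairing_add_left[OF facts(2) n(1) facts(1)] weil_pairing_Infinity_left[OF facts(1)] by simp
        have "c = a" if "b * c = 1" "a * b = 1" for a b c :: "'a alg_closure"
          using that by (metis mult.assoc mult_1 mult_1_right)
        from this[OF r l] show ?thesis .
      qed
      thus False using e inv 4 by simp
    qed
  qed
  have x2F: "x2 \<in> F" using cl(5)[OF memF(1) x1F] by simp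
  have y2F: "y2 \<in> F"
  proof (rule ccontr)
    assume y2: "y2 \<notin> F"
    \<comment> \<open>The y-coordinate of -P2. With y2 it forms the pair of roots of the curve
      equation at x2, so their sum and product lie in F once x2 does.\<close>
    let ?y = "- y2 - a\<^sub>1 C * x2 - a\<^sub>3 C"
    have "y2 + ?y = - (a\<^sub>1 C * x2) - a\<^sub>3 C" by simp
    moreover have "- (a\<^sub>1 C * x2) - a\<^sub>3 C \<in> F" by (intro cl(2,5) cl(4)[OF _ x2F] aF[OF F] x2F)
    ultimately have s: "y2 + ?y \<in> F" by (simp only:)
    have "y2 * ?y = - (y2 * y2 + poly lin x2 * y2)" by (simp add: poly_lin algebra_simps)
    also have "\<dots> = - poly cubic x2" using inE(2) by (simp add: P2_def Affine_in_iff')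
    also have "\<dots> = - (x2 * x2 * x2 + a\<^sub>2 C * (x2 * x2) + a\<^sub>4 C * x2 + a\<^sub>6 C)"
      by (simp add: poly_cubic power2_eq_square power3_eq_cube)
    also have "\<dots> \<in> F" by (intro cl(1,2) cl(4)[OF _ x2F] aF[OF F] x2F)
    finally have p: "y2 * ?y \<in> F" .
    obtain \<sigma> where \<sigma>: "field_auto \<sigma>" "\<And>z. z \<in> F \<Longrightarrow> \<sigma> z = z" "\<sigma> y2 = ?y"
      using ex_conjugation_quadratic[OF F y2 s p] by blast
    have "map_ec_point \<sigma> P1 = P1" "map_ec_point \<sigma> P2 = ec_neg C P2"
      using \<sigma> x1F x2F memF(4) by (simp_all add: P1_def P2_def)
    hence "\<zeta> = weil_pairing C m P1 (ec_neg C P2)" using pair[OF \<sigma>(1)] \<sigma>(2)[OF memF(3)] by simp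
    hence "\<zeta> * \<zeta> = 1" using weil_pairing_neg_right[OF facts(1,2)] unfolding \<zeta>[symmetric] by simp
    thus False using facts(7) \<zeta> by simp
  qed
  have 1: "torsion_field E m \<subseteq> F"
    by (rule torsion_field_subset[OF assms(4) F x1F memF(4) x2F y2F])

  define T where "T = torsion_field E m"
  have T: "ac_subfield T" unfolding T_def torsion_field_def by (rule ac_subfield_adjoin)
  have memT: "x1 \<in> T" "y1 \<in> T" "x2 \<in> T" "y2 \<in> T"
    using pt_over_torsion_field[of P1 E m] pt_over_torsion_field[of P2 E m] facts(1,2)
    by (auto simp: T_def C_def P1_def P2_def)
  have "\<zeta> \<in> T"
  proof (rule ccontr)
    assume "\<zeta> \<notin> T"
    moreover have "\<zeta> ^ m = 1" using weil_pairing_power[OF facts(1,2)] \<zeta> by simp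
    \<comment> \<open>The separability of X^m - 1, which is where coprimality to the characteristic
      enters.\<close>
    moreover have "of_nat m \<noteq> (0 :: 'a alg_closure)"
    proof
      assume "of_nat m = (0 :: 'a alg_closure)"
      hence dvd: "CHAR('a) dvd m" by (simp add: of_nat_eq_0_iff_char_dvd)
      show False
      proof (cases "CHAR('a) = 0")
        case True
        thus False using dvd assms(2) by simp
      next
        case False
        hence "coprime m CHAR('a)" using assms(3) by simp
        hence "CHAR('a) = 1" using dvd coprime_common_divisor[of m "CHAR('a)" "CHAR('a)"] by simp
        thus False using CHAR_not_1' by simp
      qed
    qed
    ultimately obtain \<sigma> where \<sigma>: "field_auto \<sigma>" "\<forall>z\<in>T. \<sigma> z = z" "\<sigma> \<zeta> \<noteq> \<zeta>"
      using ex_conjugation_root_of_unity[OF T] by blast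
    have "map_ec_point \<sigma> P1 = P1" "map_ec_point \<sigma> P2 = P2" using \<sigma>(2) memT by (simp_all add: P1_def P2_def)
    thus False using pair[OF \<sigma>(1)] \<sigma>(3) \<zeta> by simp
  qed
  hence "F \<subseteq> T" unfolding F_def using memT ac_subfield_closed[OF T] by (intro adjoin_least[OF T]) auto
  thus ?thesis using 1 by (auto simp: F_def T_def)
qed

end
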